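(* Let $X=W_T^{1,p}(0,T)$ and define $L:X\to X^*$ by $$\langle L(u),v\rangle=\int_0^T\left(|u'|^{p-2}u'v'+q|u|^{p-2}uv\right)dx,\qquad u,v\in X.$$ Then: (i) $L:X\to X^*$ is a continuous and strictly monotone operator; (ii) $L$ is a map of type $(S_+)$, i.e., if $u_n\rightharpoonup u$ weakly in $X$ and $\limsup_{n\to+\infty}\langle L(u_n)-L(u),u_n-u\rangle\le0$, then $u_n\to u$ in $X$; (iii) $L:X\to X^*$ is a homeomorphism.
   Context: Here $T>0$, $1<p<+\infty$, $q\in C([0,T];[0,+\infty))$ with $q\not\equiv0$. $W_T^{1,p}(0,T)=\{u\in W^{1,p}(0,T)\mid u(0)=u(T)\}$ with norm $\|u\|=(\int_0^T(|u'|^p+q|u|^p)\,dx)^{1/p}$, a Banach space; $X^*$ is its dual and $\langle\cdot,\cdot\rangle$ the duality pairing. Strictly monotone means $\langle L(u)-L(v),u-v\rangle>0$ whenever $u\ne v$. *)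

theory Defs
  imports "HOL-Analysis.Analysis"
begin

section \<open>Normed spaces of functions and their duals\<close>

text \<open>
  The Sobolev space below depends on the real parameters \<open>T\<close> and \<open>p\<close>, so it cannot be a type.
  A normed space is therefore given by a carrier \<open>X\<close>, a set of real functions closed under the
  pointwise operations, and a norm \<open>N\<close> on it.
\<close>

text \<open>
  The locale \<^locale>\<open>Metric_space\<close> requires a distance to be nonnegative and symmetric also off the
  carrier, where \<open>N\<close> has no meaning; hence the guard.
\<close>

definition norm_topology :: "('a \<Rightarrow> real) set \<Rightarrow> (('a \<Rightarrow> real) \<Rightarrow> real) \<Rightarrow> ('a \<Rightarrow> real) topology" where
  "norm_topology X N =
     Metric_space.mtopology X (\<lambda>u v. if u \<in> X \<and> v \<in> X then N (u - v) else 0)"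

text \<open>
  A functional is extended by \<open>0\<close> outside \<open>X\<close>, so that equality of elements of the dual is equality
  of functions and subtraction is pointwise. The pairing of \<open>f\<close> with \<open>u\<close> is application.
\<close>

definition dual_space ::
  "('a \<Rightarrow> real) set \<Rightarrow> (('a \<Rightarrow> real) \<Rightarrow> real) \<Rightarrow> (('a \<Rightarrow> real) \<Rightarrow> real) set" where
  "dual_space X N = {f.
     (\<forall>u\<in>X. \<forall>v\<in>X. \<forall>a b. f (\<lambda>x. a * u x + b * v x) = a * f u + b * f v) \<and>
     (\<exists>C. \<forall>u\<in>X. \<bar>f u\<bar> \<le> C * N u) \<and>
     (\<forall>u. u \<notin> X \<longrightarrow> f u = 0)}"

definition dual_norm ::
  "('a \<Rightarrow> real) set \<Rightarrow> (('a \<Rightarrow> real) \<Rightarrow> real) \<Rightarrow> (('a \<Rightarrow> real) \<Rightarrow> real) \<Rightarrow> real" where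
  "dual_norm X N f = (SUP u\<in>{u \<in> X. N u \<le> 1}. \<bar>f u\<bar>)"

definition dual_topology ::
  "('a \<Rightarrow> real) set \<Rightarrow> (('a \<Rightarrow> real) \<Rightarrow> real) \<Rightarrow> (('a \<Rightarrow> real) \<Rightarrow> real) topology" where
  "dual_topology X N = norm_topology (dual_space X N) (dual_norm X N)"

definition weakly_converges ::
  "('a \<Rightarrow> real) set \<Rightarrow> (('a \<Rightarrow> real) \<Rightarrow> real) \<Rightarrow> (nat \<Rightarrow> 'a \<Rightarrow> real) \<Rightarrow> ('a \<Rightarrow> real) \<Rightarrow> bool" where
  "weakly_converges X N s u \<longleftrightarrow>
     (\<forall>n. s n \<in> X) \<and> u \<in> X \<and> (\<forall>f\<in>dual_space X N. (\<lambda>n. f (s n)) \<longlonglongrightarrow> f u)"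

definition strictly_monotone ::
  "('a \<Rightarrow> real) set \<Rightarrow> (('a \<Rightarrow> real) \<Rightarrow> ('a \<Rightarrow> real) \<Rightarrow> real) \<Rightarrow> bool" where
  "strictly_monotone X A \<longleftrightarrow> (\<forall>u\<in>X. \<forall>v\<in>X. u \<noteq> v \<longrightarrow> (A u - A v) (u - v) > 0)"

definition type_S_plus ::
  "('a \<Rightarrow> real) set \<Rightarrow> (('a \<Rightarrow> real) \<Rightarrow> real) \<Rightarrow> (('a \<Rightarrow> real) \<Rightarrow> ('a \<Rightarrow> real) \<Rightarrow> real) \<Rightarrow> bool" where
  "type_S_plus X N A \<longleftrightarrow>
     (\<forall>s u. weakly_converges X N s u \<longrightarrow>
        limsup (\<lambda>n. ereal ((A (s n) - A u) (s n - u))) \<le> 0 \<longrightarrow>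
        limitin (norm_topology X N) s u sequentially)"


section \<open>The periodic Sobolev space\<close>

definition test_functions :: "real \<Rightarrow> (real \<Rightarrow> real) set" where
  "test_functions T = {\<phi>.
     (\<forall>k. (deriv ^^ k) \<phi> differentiable_on UNIV) \<and>
     compact (closure {x. \<phi> x \<noteq> 0}) \<and> closure {x. \<phi> x \<noteq> 0} \<subseteq> {0<..<T}}"

definition locally_integrable :: "real \<Rightarrow> (real \<Rightarrow> real) \<Rightarrow> bool" where
  "locally_integrable T u \<longleftrightarrow>
     (\<forall>K. compact K \<longrightarrow> K \<subseteq> {0<..<T} \<longrightarrow> set_integrable lebesgue K u)"

definition has_weak_deriv :: "real \<Rightarrow> (real \<Rightarrow> real) \<Rightarrow> (real \<Rightarrow> real) \<Rightarrow> bool" where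
  "has_weak_deriv T u g \<longleftrightarrow>
     locally_integrable T u \<and> locally_integrable T g \<and>
     (\<forall>\<phi>\<in>test_functions T.
        (LINT x:{0<..<T}|lebesgue. u x * deriv \<phi> x) = - (LINT x:{0<..<T}|lebesgue. g x * \<phi> x))"

text \<open>Weak derivatives are unique almost everywhere on \<open>(0,T)\<close>; any representative serves.\<close>

definition weak_deriv :: "real \<Rightarrow> (real \<Rightarrow> real) \<Rightarrow> real \<Rightarrow> real" where
  "weak_deriv T u = (SOME g. has_weak_deriv T u g)"

definition Lp :: "real \<Rightarrow> real \<Rightarrow> (real \<Rightarrow> real) set" where
  "Lp T p = {u. set_borel_measurable lebesgue {0<..<T} u \<and>
                set_integrable lebesgue {0<..<T} (\<lambda>x. \<bar>u x\<bar> powr p)}"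

definition W1p :: "real \<Rightarrow> real \<Rightarrow> (real \<Rightarrow> real) set" where
  "W1p T p = {u \<in> Lp T p. \<exists>g\<in>Lp T p. has_weak_deriv T u g}"

text \<open>
  Every class in \<open>W\<^sup>1\<^sup>,\<^sup>p(0,T)\<close> has exactly one representative that is continuous on \<open>[0,T]\<close>, and the
  condition \<open>u(0) = u(T)\<close> refers to it. A class is represented here by this function, extended
  by \<open>0\<close> outside \<open>[0,T]\<close>, so that equality of classes is equality of functions.
\<close>

definition W1p_periodic :: "real \<Rightarrow> real \<Rightarrow> (real \<Rightarrow> real) set" where
  "W1p_periodic T p =
     {u \<in> W1p T p. continuous_on {0..T} u \<and> (\<forall>x. x \<notin> {0..T} \<longrightarrow> u x = 0) \<and> u 0 = u T}"

definition W1p_norm :: "real \<Rightarrow> real \<Rightarrow> (real \<Rightarrow> real) \<Rightarrow> (real \<Rightarrow> real) \<Rightarrow> real" where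
  "W1p_norm T p q u =
     (LINT x:{0<..<T}|lebesgue. \<bar>weak_deriv T u x\<bar> powr p + q x * \<bar>u x\<bar> powr p) powr (1 / p)"

text \<open>
  Since \<open>0 powr a = 0\<close> for every \<open>a\<close>, the term \<open>|s|\<^sup>p\<^sup>-\<^sup>2 s\<close> has its usual value \<open>0\<close> at \<open>s = 0\<close>,
  also for \<open>p < 2\<close>.
\<close>

definition L_op ::
  "real \<Rightarrow> real \<Rightarrow> (real \<Rightarrow> real) \<Rightarrow> (real \<Rightarrow> real) \<Rightarrow> (real \<Rightarrow> real) \<Rightarrow> real" where
  "L_op T p q u = (\<lambda>v. if v \<in> W1p_periodic T p
     then (LINT x:{0<..<T}|lebesgue.
             \<bar>weak_deriv T u x\<bar> powr (p - 2) * weak_deriv T u x * weak_deriv T v x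
             + q x * \<bar>u x\<bar> powr (p - 2) * u x * v x)
     else 0)"

end

theory Submission
  imports Defs "HOL-Computational_Algebra.Polynomial"
begin

text \<open>
  Write \<open>\<psi>(s) = |s|\<^sup>p\<^sup>-\<^sup>2 s\<close>. Every estimate on \<open>L\<close> is the integral of a pointwise inequality between
  continuous, positively \<open>p\<close>-homogeneous functions of at most three real variables, with a small
  multiple of the sum of the \<open>p\<close>-th powers as error term; such inequalities follow from compactness of the
  sphere. For instance \<open>|a - b|\<^sup>p \<le> \<epsilon> (|a|\<^sup>p + |b|\<^sup>p) + C (\<psi>(a) - \<psi>(b)) (a - b)\<close> gives strict
  monotonicity, the \<open>(S\<^sub>+)\<close> property and continuity of the inverse, for all \<open>p > 1\<close> at once.
  In \<open>(S\<^sub>+)\<close> the sequence is bounded because of the hypothesis on the upper limit, so that the uniform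
  boundedness principle is not needed.

  Surjectivity is proved by minimising \<open>\<parallel>u\<parallel>\<^sup>p / p - f(u)\<close>: uniform convexity makes a minimising sequence
  a Cauchy sequence, so only completeness of the space is used and no reflexivity. Completeness rests
  on the identity \<open>u(x) - u(y) = \<integral>\<^sub>y\<^sup>x u'\<close>, obtained by testing with smooth approximations of the
  indicator function of \<open>(y,x]\<close>; the same identity for \<open>u = 0\<close> gives uniqueness of weak derivatives.
\<close>

section \<open>Normed function spaces and their duals\<close>

text \<open>The error term in the pointwise inequalities is forced: for \<open>p < 2\<close> and
  \<open>a\<close> close to \<open>b \<noteq> 0\<close> the product
  \<open>(psi p a - psi p b) * (a - b)\<close> is only of order \<open>(a - b)^2\<close>, and no
  constant lifts this to \<open>\<bar>a - b\<bar> powr p\<close>. The error is harmless only while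
  energies stay bounded, so applications to varying functions first find a bound: from coercivity of
  the form in (S+), from the growth of \<open>energy u / p - f u\<close> in the minimisation, from
  \<open>energy v = L v v\<close> for the inverse.

  The norm sees constants only through \<open>q\<close>, which may vanish on most of [0,T]. One
  interval on which \<open>q\<close> is positive controls \<open>u\<close> at one point, and the
  integral of the derivative carries the bound to all others. The resulting sup bound makes the norm
  definite and turns Cauchy sequences into uniformly convergent ones.

  Weak derivatives are chosen by a description operator, so the map from \<open>u\<close> to its
  derivative is linear only almost everywhere. Hence the inequalities are stated for integrals in
  which the derivatives of \<open>u\<close>, \<open>v\<close>, \<open>w\<close> occur
  separately.\<close>

locale normed_function_space =
  fixes X :: "('a \<Rightarrow> real) set" and N :: "('a \<Rightarrow> real) \<Rightarrow> real"
  assumes zero_in: "(\<lambda>_. 0) \<in> X"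
    and lincomb_in: "u \<in> X \<Longrightarrow> v \<in> X \<Longrightarrow> (\<lambda>x. a * u x + b * v x) \<in> X"
    and norm_nonneg: "u \<in> X \<Longrightarrow> N u \<ge> 0"
    and norm_scale: "u \<in> X \<Longrightarrow> N (\<lambda>x. a * u x) = \<bar>a\<bar> * N u"
    and norm_triangle: "u \<in> X \<Longrightarrow> v \<in> X \<Longrightarrow> N (\<lambda>x. u x + v x) \<le> N u + N v"
    and norm_zero_imp: "u \<in> X \<Longrightarrow> N u = 0 \<Longrightarrow> u = (\<lambda>_. 0)"
begin

lemma diff_in: "u \<in> X \<Longrightarrow> v \<in> X \<Longrightarrow> u - v \<in> X"
  using lincomb_in[of u v 1 "-1"] by (simp add: fun_diff_def)

lemma scale_in: "u \<in> X \<Longrightarrow> (\<lambda>x. a * u x) \<in> X"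
  using lincomb_in[of u u a 0] by simp

lemma norm_zero: "N (\<lambda>_. 0) = 0"
  using norm_scale[OF zero_in, of 0] by simp

lemma norm_minus_commute: "u \<in> X \<Longrightarrow> v \<in> X \<Longrightarrow> N (u - v) = N (v - u)"
  using norm_scale[OF diff_in[of u v], of "-1"] by (simp add: fun_diff_def)

lemma norm_triangle_sub: "u \<in> X \<Longrightarrow> v \<in> X \<Longrightarrow> w \<in> X \<Longrightarrow> N (u - w) \<le> N (u - v) + N (v - w)"
  using norm_triangle[OF diff_in[of u v] diff_in[of v w]] by (simp add: fun_diff_def)

lemma norm_le_add_diff: "u \<in> X \<Longrightarrow> v \<in> X \<Longrightarrow> N u \<le> N v + N (u - v)"
  using norm_triangle[OF _ diff_in[of u v], of v] by (simp add: fun_diff_def)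

sublocale Metric_space X "\<lambda>u v. if u \<in> X \<and> v \<in> X then N (u - v) else 0"
proof
  show "((if x \<in> X \<and> y \<in> X then N (x - y) else 0) = 0) = (x = y)" if "x \<in> X" "y \<in> X" for x y
    using that norm_zero_imp[OF diff_in[OF that]] norm_zero by (auto simp: fun_eq_iff fun_diff_def)
qed (auto simp: norm_nonneg diff_in norm_minus_commute norm_triangle_sub)

lemma topspace_norm_topology: "topspace (norm_topology X N) = X"
  by (simp add: norm_topology_def)

lemma limitin_norm_topology:
  assumes s: "\<And>n. s n \<in> X" and u: "u \<in> X" and l: "(\<lambda>n. N (s n - u)) \<longlonglongrightarrow> 0"
  shows "limitin (norm_topology X N) s u sequentially"
  unfolding norm_topology_def limitin_metric
proof (intro conjI allI impI u)
  fix e :: real assume "e > 0"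
  from order_tendstoD(2)[OF l this] show "\<forall>\<^sub>F n in sequentially.
      s n \<in> X \<and> (if s n \<in> X \<and> u \<in> X then N (s n - u) else 0) < e"
    by eventually_elim (simp add: s u)
qed

lemma dual_lincomb: "f \<in> dual_space X N \<Longrightarrow> u \<in> X \<Longrightarrow> v \<in> X \<Longrightarrow>
    f (\<lambda>x. a * u x + b * v x) = a * f u + b * f v"
  by (simp add: dual_space_def)

lemma dual_diff: "f \<in> dual_space X N \<Longrightarrow> u \<in> X \<Longrightarrow> v \<in> X \<Longrightarrow> f (u - v) = f u - f v"
  using dual_lincomb[of f u v 1 "-1"] by (simp add: fun_diff_def)

lemma dual_scale: "f \<in> dual_space X N \<Longrightarrow> u \<in> X \<Longrightarrow> f (\<lambda>x. a * u x) = a * f u"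
  using dual_lincomb[of f u u a 0] by simp

lemma dual_outside: "f \<in> dual_space X N \<Longrightarrow> u \<notin> X \<Longrightarrow> f u = 0"
  by (simp add: dual_space_def)

lemma dual_norm_bdd:
  assumes "f \<in> dual_space X N"
  shows "bdd_above ((\<lambda>u. \<bar>f u\<bar>) ` {u \<in> X. N u \<le> 1})"
proof -
  obtain C where C: "\<And>u. u \<in> X \<Longrightarrow> \<bar>f u\<bar> \<le> C * N u"
    using assms unfolding dual_space_def by blast
  have "\<bar>f u\<bar> \<le> \<bar>C\<bar>" if "u \<in> X" "N u \<le> 1" for u
  proof -
    have "C * N u \<le> \<bar>C\<bar> * 1"
      using that norm_nonneg by (intro mult_mono) auto
    then show ?thesis using C[OF that(1)] by simp
  qed
  then show ?thesis by (auto intro!: bdd_aboveI[of _ "\<bar>C\<bar>"])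
qed

lemma dual_norm_leI:
  assumes "\<And>u. u \<in> X \<Longrightarrow> N u \<le> 1 \<Longrightarrow> \<bar>f u\<bar> \<le> c"
  shows "dual_norm X N f \<le> c"
  unfolding dual_norm_def using zero_in norm_zero by (intro cSUP_least) (auto intro: assms)

lemma dual_bound:
  assumes f: "f \<in> dual_space X N" and u: "u \<in> X"
  shows "\<bar>f u\<bar> \<le> dual_norm X N f * N u"
proof (cases "N u = 0")
  case True
  then have "u = (\<lambda>_. 0)" using u norm_zero_imp by blast
  then have "f u = 0"
    using dual_scale[OF f u, of 0] by simp
  then show ?thesis using True by simp
next
  case False
  then have n: "N u > 0" using norm_nonneg[OF u] by simp
  define v where "v = (\<lambda>x. inverse (N u) * u x)"
  have "v \<in> X" "N v = 1"
    unfolding v_def using scale_in[OF u] norm_scale[OF u, of "inverse (N u)"] n by auto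
  then have "\<bar>f v\<bar> \<le> dual_norm X N f"
    unfolding dual_norm_def by (intro cSUP_upper dual_norm_bdd f) auto
  moreover have "f v = inverse (N u) * f u"
    unfolding v_def by (rule dual_scale[OF f u])
  ultimately show ?thesis
    using n by (simp add: abs_mult field_simps)
qed

lemma dual_norm_nonneg: "f \<in> dual_space X N \<Longrightarrow> dual_norm X N f \<ge> 0"
  using dual_norm_bdd[of f] zero_in norm_zero unfolding dual_norm_def
  by (intro cSUP_upper2[of _ _ "\<lambda>_. 0"]) auto

lemma dual_space_lincomb:
  assumes f: "f \<in> dual_space X N" and g: "g \<in> dual_space X N"
  shows "(\<lambda>u. a * f u + b * g u) \<in> dual_space X N"
proof -
  have "\<bar>a * f u + b * g u\<bar> \<le> (\<bar>a\<bar> * dual_norm X N f + \<bar>b\<bar> * dual_norm X N g) * N u" if "u \<in> X" for u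
  proof -
    have "\<bar>a * f u + b * g u\<bar> \<le> \<bar>a\<bar> * \<bar>f u\<bar> + \<bar>b\<bar> * \<bar>g u\<bar>"
      by (metis abs_mult abs_triangle_ineq)
    also have "\<dots> \<le> \<bar>a\<bar> * (dual_norm X N f * N u) + \<bar>b\<bar> * (dual_norm X N g * N u)"
      using that f g by (intro add_mono mult_left_mono dual_bound) auto
    finally show ?thesis by (simp add: algebra_simps)
  qed
  then have "\<exists>C. \<forall>u\<in>X. \<bar>a * f u + b * g u\<bar> \<le> C * N u"
    by blast
  then show ?thesis
    using dual_lincomb[OF f] dual_lincomb[OF g] dual_outside[OF f] dual_outside[OF g]
    unfolding dual_space_def by (auto simp: algebra_simps)
qed

text \<open>Puts the dual under the same locale as the space itself, so that balls, limits and
  continuity are treated alike on both sides of \<open>L\<close>.\<close>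

lemma normed_dual_space: "normed_function_space (dual_space X N) (dual_norm X N)"
proof
  show "(\<lambda>_. 0) \<in> dual_space X N"
    by (auto simp: dual_space_def intro: exI[of _ 0])
  fix f assume f: "f \<in> dual_space X N"
  show "0 \<le> dual_norm X N f"
    using f by (rule dual_norm_nonneg)
  show "dual_norm X N (\<lambda>u. a * f u) = \<bar>a\<bar> * dual_norm X N f" for a
  proof (rule antisym)
    \<comment> \<open>Proved for every scalar and functional at once: the reverse inequality is this
      one applied to \<open>inverse a\<close> and the functional \<open>a * f\<close>.\<close>
    have le: "dual_norm X N (\<lambda>u. b * g u) \<le> \<bar>b\<bar> * dual_norm X N g" if g: "g \<in> dual_space X N" for b g
    proof (rule dual_norm_leI)
      fix u assume u: "u \<in> X" "N u \<le> 1"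
      have "\<bar>g u\<bar> \<le> dual_norm X N g * N u" by (rule dual_bound[OF g u(1)])
      also have "\<dots> \<le> dual_norm X N g * 1"
        using u dual_norm_nonneg[OF g] by (intro mult_left_mono) auto
      finally show "\<bar>b * g u\<bar> \<le> \<bar>b\<bar> * dual_norm X N g"
        by (simp add: abs_mult mult_left_mono)
    qed
    show "dual_norm X N (\<lambda>u. a * f u) \<le> \<bar>a\<bar> * dual_norm X N f"
      by (rule le[OF f])
    have af: "(\<lambda>u. a * f u) \<in> dual_space X N"
      using dual_space_lincomb[OF f f, of a 0] by simp
    show "\<bar>a\<bar> * dual_norm X N f \<le> dual_norm X N (\<lambda>u. a * f u)"
    proof (cases "a = 0")
      case True
      then show ?thesis using dual_norm_nonneg[OF af] by simp
    next
      case False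
      then have "dual_norm X N f \<le> \<bar>inverse a\<bar> * dual_norm X N (\<lambda>u. a * f u)"
        using le[OF af, of "inverse a"] by (simp add: mult.assoc[symmetric])
      then show ?thesis
        using False by (simp add: field_simps)
    qed
  qed
  show "f = (\<lambda>_. 0)" if "dual_norm X N f = 0"
  proof
    fix u show "f u = 0"
      using dual_bound[OF f, of u] dual_outside[OF f, of u] that by (cases "u \<in> X") auto
  qed
  fix g assume g: "g \<in> dual_space X N"
  show "(\<lambda>u. a * f u + b * g u) \<in> dual_space X N" for a b
    by (rule dual_space_lincomb[OF f g])
  show "dual_norm X N (\<lambda>u. f u + g u) \<le> dual_norm X N f + dual_norm X N g"
  proof (rule dual_norm_leI)
    fix u assume u: "u \<in> X" "N u \<le> 1"
    have "\<bar>f u\<bar> \<le> dual_norm X N f" "\<bar>g u\<bar> \<le> dual_norm X N g"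
      unfolding dual_norm_def using u f g by (auto intro!: cSUP_upper dual_norm_bdd)
    then show "\<bar>f u + g u\<bar> \<le> dual_norm X N f + dual_norm X N g"
      by linarith
  qed
qed

end

text \<open>One epsilon-delta criterion for both directions: it serves \<open>L\<close> and, with
  the two spaces exchanged, its inverse.\<close>

lemma continuous_map_norm_topology:
  assumes "normed_function_space X N" "normed_function_space Y M"
    and f: "\<And>u. u \<in> X \<Longrightarrow> f u \<in> Y"
    and c: "\<And>u e. u \<in> X \<Longrightarrow> e > 0 \<Longrightarrow> \<exists>d>0. \<forall>v\<in>X. N (v - u) < d \<longrightarrow> M (f v - f u) < e"
  shows "continuous_map (norm_topology X N) (norm_topology Y M) f"
proof -
  interpret X: normed_function_space X N by fact
  interpret Y: normed_function_space Y M by fact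
  show ?thesis
    unfolding norm_topology_def Y.continuous_map_to_metric X.topspace_mtopology
  proof (intro ballI allI impI)
    fix u e assume u: "u \<in> X" and e: "e > (0::real)"
    obtain d where d: "d > 0" "\<And>v. v \<in> X \<Longrightarrow> N (v - u) < d \<Longrightarrow> M (f v - f u) < e"
      using c[OF u e] by blast
    show "\<exists>U. openin X.mtopology U \<and> u \<in> U \<and> (\<forall>y\<in>U. f y \<in> Y.mball (f u) e)"
    proof (intro exI[of _ "X.mball u d"] conjI ballI)
      fix v assume "v \<in> X.mball u d"
      then show "f v \<in> Y.mball (f u) e"
        using d(2)[of v] u f X.norm_minus_commute[of u v] Y.norm_minus_commute[of "f u" "f v"]
        by (auto split: if_splits)
      next
      show "u \<in> X.mball u d"
        using u d X.centre_in_mball_iff by blast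
    qed auto
  qed
qed

section \<open>Smooth step functions\<close>

text \<open>The recursion takes one derivative off \<open>f\<close> itself, so the sum, product and
  chain rules become inductions on the order with \<open>f\<close> arbitrary. The iterates
  \<open>(deriv ^^ k) f\<close> of the test functions do not allow this directly;
  \<open>smooth_iff\<close> connects the two.\<close>

primrec times_differentiable :: "nat \<Rightarrow> (real \<Rightarrow> real) \<Rightarrow> bool" where
  "times_differentiable 0 f \<longleftrightarrow> f differentiable_on UNIV"
| "times_differentiable (Suc n) f \<longleftrightarrow> f differentiable_on UNIV \<and> times_differentiable n (deriv f)"

definition smooth :: "(real \<Rightarrow> real) \<Rightarrow> bool" where
  "smooth f \<longleftrightarrow> (\<forall>n. times_differentiable n f)"

lemma smooth_iff: "smooth f \<longleftrightarrow> (\<forall>k. (deriv ^^ k) f differentiable_on UNIV)"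
proof -
  have "times_differentiable n f \<longleftrightarrow> (\<forall>k\<le>n. (deriv ^^ k) f differentiable_on UNIV)" for n
  proof (induction n arbitrary: f)
    case (Suc n)
    have "(\<forall>k\<le>Suc n. (deriv ^^ k) f differentiable_on UNIV) \<longleftrightarrow>
        f differentiable_on UNIV \<and> (\<forall>k\<le>n. (deriv ^^ Suc k) f differentiable_on UNIV)"
    proof (intro iffI conjI allI impI; (elim conjE)?)
      fix k assume f: "f differentiable_on UNIV"
        and d: "\<forall>k\<le>n. (deriv ^^ Suc k) f differentiable_on UNIV" and k: "k \<le> Suc n"
      show "(deriv ^^ k) f differentiable_on UNIV"
      proof (cases k)
        case 0
        then show ?thesis using f by simp
      next
        case (Suc j)
        then show ?thesis using d k by blast
      qed
    next
      assume "\<forall>k\<le>Suc n. (deriv ^^ k) f differentiable_on UNIV"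
      then have "(deriv ^^ 0) f differentiable_on UNIV"
        by blast
      then show "f differentiable_on UNIV"
        by simp
    qed blast
    then show ?case
      using Suc.IH[of "deriv f"] by (simp add: funpow_swap1)
  qed simp
  then show ?thesis
    unfolding smooth_def by blast
qed

lemma times_differentiable_has_deriv:
  assumes "times_differentiable n f"
  shows "(f has_real_derivative deriv f x) (at x)"
proof -
  have "f differentiable_on UNIV"
    using assms by (cases n) auto
  then have "f differentiable (at x)"
    by (simp add: differentiable_on_def)
  then show ?thesis
    using DERIV_deriv_iff_real_differentiable by blast
qed

lemma times_differentiable_Suc:
  assumes "\<And>x. (f has_real_derivative f' x) (at x)" "times_differentiable n f'"
  shows "times_differentiable (Suc n) f"
proof -
  have "deriv f = f'"
    using assms(1) DERIV_imp_deriv by blast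
  moreover have "f differentiable_on UNIV"
    using assms(1) by (auto simp: differentiable_on_def real_differentiable_def)
  ultimately show ?thesis
    using assms(2) by simp
qed

lemma times_differentiable_0: 
  assumes "\<And>x. (f has_real_derivative f' x) (at x)"
  shows "times_differentiable 0 f"
  using assms by (auto simp: differentiable_on_def real_differentiable_def)

lemma times_differentiable_SucD: "times_differentiable (Suc n) f \<Longrightarrow> times_differentiable n f"
  by (induction n arbitrary: f) auto

lemma times_differentiable_const: "times_differentiable n (\<lambda>x. c)"
proof (induction n arbitrary: c)
  case (Suc n)
  show ?case
    by (rule times_differentiable_Suc[where f' = "\<lambda>x. 0"]) (auto simp: Suc.IH)
qed auto

lemma times_differentiable_add:
  "times_differentiable n f \<Longrightarrow> times_differentiable n g \<Longrightarrow> times_differentiable n (\<lambda>x. f x + g x)"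
proof (induction n arbitrary: f g)
  case (Suc n)
  note d = times_differentiable_has_deriv[OF Suc.prems(1)] times_differentiable_has_deriv[OF Suc.prems(2)]
  show ?case
    by (rule times_differentiable_Suc[OF DERIV_add[OF d]]) (use Suc in simp)
qed simp

lemma times_differentiable_mult:
  "times_differentiable n f \<Longrightarrow> times_differentiable n g \<Longrightarrow> times_differentiable n (\<lambda>x. f x * g x)"
proof (induction n arbitrary: f g)
  case (Suc n)
  note d = times_differentiable_has_deriv[OF Suc.prems(1)] times_differentiable_has_deriv[OF Suc.prems(2)]
  show ?case
  proof (rule times_differentiable_Suc[OF DERIV_mult[OF d]], rule times_differentiable_add)
    show "times_differentiable n (\<lambda>x. deriv f x * g x)" "times_differentiable n (\<lambda>x. deriv g x * f x)"
      using Suc.prems times_differentiable_SucD by (auto intro!: Suc.IH)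
  qed
qed (auto simp: differentiable_on_def)

lemma times_differentiable_diff:
  assumes "times_differentiable n f" "times_differentiable n g"
  shows "times_differentiable n (\<lambda>x. f x - g x)"
  using times_differentiable_add[OF assms(1)
      times_differentiable_mult[OF times_differentiable_const[of n "-1"] assms(2)]] by simp

lemma times_differentiable_affine:
  "times_differentiable n f \<Longrightarrow> times_differentiable n (\<lambda>x. f (a * x + b))"
proof (induction n arbitrary: f)
  case 0
  have "((\<lambda>x. f (a * x + b)) has_real_derivative deriv f (a * x + b) * a) (at x)" for x
    by (rule DERIV_chain2[OF times_differentiable_has_deriv[OF 0]]) (auto intro!: derivative_eq_intros)
  then show ?case
    by (rule times_differentiable_0)
next
  case (Suc n)
  have "((\<lambda>x. f (a * x + b)) has_real_derivative deriv f (a * x + b) * a) (at x)" for x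
    by (rule DERIV_chain2[OF times_differentiable_has_deriv[OF Suc.prems]])
      (auto intro!: derivative_eq_intros)
  then show ?case
    by (rule times_differentiable_Suc)
      (use Suc in \<open>auto intro!: times_differentiable_mult times_differentiable_const\<close>)
qed

lemma times_differentiable_inverse:
  assumes "\<And>x. f x \<noteq> 0"
  shows "times_differentiable n f \<Longrightarrow> times_differentiable n (\<lambda>x. inverse (f x))"
proof (induction n)
  case 0
  show ?case
    by (rule times_differentiable_0)
      (rule DERIV_inverse_fun[OF times_differentiable_has_deriv[OF 0] assms])
next
  case (Suc n)
  note i = Suc.IH[OF times_differentiable_SucD[OF Suc.prems]]
  \<comment> \<open>The derivative of the reciprocal is a product of reciprocals and
    \<open>deriv f\<close>, all differentiable \<open>n\<close> times; the sign is written as a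
    constant factor so that the product rule covers it.\<close>
  have "times_differentiable n (\<lambda>x. -1 * (inverse (f x) * deriv f x * inverse (f x)))"
    using Suc.prems i
    by (intro times_differentiable_mult times_differentiable_const) auto
  then have "times_differentiable n (\<lambda>x. - (inverse (f x) * deriv f x * inverse (f x)))"
    by simp
  moreover have "((\<lambda>x. inverse (f x)) has_real_derivative
      - (inverse (f x) * deriv f x * inverse (f x))) (at x)" for x
    using DERIV_inverse_fun[OF times_differentiable_has_deriv[OF Suc.prems] assms[of x]]
    by (simp add: ac_simps)
  ultimately show ?case
    by (rule times_differentiable_Suc[rotated])
qed

text \<open>The family is closed under differentiation, with only the polynomial changing, so
  smoothness across 0 needs just one derivative computed for all \<open>P\<close>.\<close>

definition flat :: "real poly \<Rightarrow> real \<Rightarrow> real" where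
  "flat P x = (if x > 0 then poly P (1 / x) * exp (- (1 / x)) else 0)"

lemma tendsto_poly_times_exp: "((\<lambda>y. poly P y * exp (- y)) \<longlongrightarrow> 0) (at_top :: real filter)"
proof -
  have "((\<lambda>y. \<Sum>i\<le>degree P. coeff P i * (y ^ i / exp y)) \<longlongrightarrow> 0) (at_top :: real filter)"
    by (intro tendsto_null_sum tendsto_mult_right_zero tendsto_power_div_exp_0)
  then show ?thesis
    by (simp add: poly_altdef sum_distrib_right exp_minus divide_inverse mult.assoc)
qed

text \<open>With \<open>y = 1/x\<close>, the derivative of \<open>P(y) e\<^sup>-\<^sup>y\<close> in \<open>x\<close> is \<open>y\<^sup>2 (P(y) - P'(y)) e\<^sup>-\<^sup>y\<close>.\<close>

lemma flat_has_deriv: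
  "(flat P has_real_derivative flat ([:0, 0, 1:] * (P - pderiv P)) x) (at x)"
proof -
  consider "x > 0" | "x < 0" | "x = 0" by linarith
  then show ?thesis
  proof cases
    case 1
    have "((\<lambda>x. poly P (1 / x) * exp (- (1 / x))) has_real_derivative
      flat ([:0, 0, 1:] * (P - pderiv P)) x) (at x)"
    proof -
      have i: "((\<lambda>x. 1 / x) has_real_derivative - ((1 / x)\<^sup>2)) (at x)"
        using 1 by (auto intro!: derivative_eq_intros simp: field_simps power2_eq_square)
      have "((\<lambda>x. poly P (1 / x)) has_real_derivative poly (pderiv P) (1 / x) * - ((1 / x)\<^sup>2)) (at x)"
        by (rule DERIV_chain2[OF poly_DERIV i])
      moreover have "((\<lambda>x. exp (- (1 / x))) has_real_derivative exp (- (1 / x)) * - (- ((1 / x)\<^sup>2))) (at x)"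
        by (rule DERIV_chain2[OF DERIV_exp DERIV_minus[OF i]])
      ultimately have "((\<lambda>x. poly P (1 / x) * exp (- (1 / x))) has_real_derivative
          (poly (pderiv P) (1 / x) * - ((1 / x)\<^sup>2)) * exp (- (1 / x)) +
          (exp (- (1 / x)) * - (- ((1 / x)\<^sup>2))) * poly P (1 / x)) (at x)"
        by (rule DERIV_mult)
      moreover have "(poly (pderiv P) (1 / x) * - ((1 / x)\<^sup>2)) * exp (- (1 / x)) +
          (exp (- (1 / x)) * - (- ((1 / x)\<^sup>2))) * poly P (1 / x) =
          flat ([:0, 0, 1:] * (P - pderiv P)) x"
        using 1 by (simp add: flat_def algebra_simps power2_eq_square)
      ultimately show ?thesis by simp
    qed
    moreover have ev: "eventually (\<lambda>x. flat P x = poly P (1 / x) * exp (- (1 / x))) (nhds x)"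
      using eventually_nhds_in_open[of "{0<..}" x] 1 by (auto elim!: eventually_mono simp: flat_def)
    ultimately show ?thesis
      using DERIV_cong_ev[OF refl ev refl] by simp
  next
    case 2
    have ev: "eventually (\<lambda>x. flat P x = 0) (nhds x)"
      using eventually_nhds_in_open[of "{..<0}" x] 2 by (auto elim!: eventually_mono simp: flat_def)
    moreover have "((\<lambda>x. 0) has_real_derivative flat ([:0, 0, 1:] * (P - pderiv P)) x) (at x)"
      using 2 by (simp add: flat_def)
    ultimately show ?thesis
      using DERIV_cong_ev[OF refl ev refl] by simp
  next
    case 3
    \<comment> \<open>With \<open>y = 1/h\<close> the difference quotient
      \<open>flat P h / h\<close> is \<open>y P(y)\<close> times the exponential of
      \<open>-y\<close>, and \<open>pCons 0 P\<close> is the polynomial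
      \<open>y P(y)\<close>.\<close>
    have "((\<lambda>h. poly (pCons 0 P) (inverse h) * exp (- inverse h)) \<longlongrightarrow> 0) (at_right 0)"
      by (rule filterlim_compose[OF tendsto_poly_times_exp filterlim_inverse_at_top_right])
    moreover have "eventually (\<lambda>h. poly (pCons 0 P) (inverse h) * exp (- inverse h) = flat P h / h) (at_right 0)"
      by (auto simp: eventually_at_filter flat_def field_simps)
    ultimately have "((\<lambda>h. flat P h / h) \<longlongrightarrow> 0) (at_right 0)"
      using tendsto_cong by fast
    moreover have "((\<lambda>h. flat P h / h) \<longlongrightarrow> 0) (at_left 0)"
      by (rule tendsto_eventually) (auto simp: eventually_at_filter flat_def)
    ultimately have "((\<lambda>h. flat P h / h) \<longlongrightarrow> 0) (at 0)"
      by (simp add: filterlim_split_at)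
    then show ?thesis
      using 3 by (simp add: DERIV_def flat_def)
  qed
qed

lemma times_differentiable_flat: "times_differentiable n (flat P)"
proof (induction n arbitrary: P)
  case 0
  show ?case
    by (rule times_differentiable_0[OF flat_has_deriv])
next
  case (Suc n)
  show ?case
    by (rule times_differentiable_Suc[OF flat_has_deriv Suc])
qed

lemma smooth_step:
  obtains S :: "real \<Rightarrow> real" where "smooth S" "\<And>x. x \<le> 0 \<Longrightarrow> S x = 0" "\<And>x. x \<ge> 1 \<Longrightarrow> S x = 1"
    "\<And>x. 0 \<le> S x" "\<And>x. S x \<le> 1"
proof
  define h where "h = flat 1"
  \<comment> \<open>The classical quotient \<open>h(x) / (h(x) + h(1 - x))\<close>. Its denominator
    is positive because \<open>x\<close> and \<open>1 - x\<close> are never both nonpositive;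
    \<open>- 1 * x + 1\<close> has the shape that \<open>times_differentiable_affine\<close>
    expects.\<close>
  define S where "S x = h x * inverse (h x + h (- 1 * x + 1))" for x
  have h: "h x \<ge> 0" "x > 0 \<Longrightarrow> h x > 0" "x \<le> 0 \<Longrightarrow> h x = 0" for x
    by (auto simp: h_def flat_def)
  have pos: "h x + h (- 1 * x + 1) > 0" for x
    using h(1)[of x] h(1)[of "- 1 * x + 1"] h(2)[of x] h(2)[of "- 1 * x + 1"]
    by (cases "x > 0") auto
  have nd: "times_differentiable n h" for n
    by (simp add: h_def times_differentiable_flat)
  have "times_differentiable n S" for n
    unfolding S_def using pos
    by (intro times_differentiable_mult times_differentiable_inverse times_differentiable_add
        times_differentiable_affine nd) (metis less_irrefl)
  then show "smooth S"
    by (simp add: smooth_def)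
  show "S x = 0" if "x \<le> 0" for x
    using that h by (simp add: S_def)
  show "S x = 1" if "x \<ge> 1" for x
    using that h(2)[of x] h(3)[of "-1 * x + 1"] by (simp add: S_def)
  show "0 \<le> S x" for x
    using pos[of x] h(1)[of x] by (simp add: S_def)
  show "S x \<le> 1" for x
    using pos[of x] h(1)[of "-1*x+1"] by (simp add: S_def field_simps)
qed

section \<open>Weak derivatives of continuous functions\<close>

lemma smooth_has_deriv: "smooth f \<Longrightarrow> (f has_real_derivative deriv f x) (at x)"
  by (auto simp: smooth_def intro: times_differentiable_has_deriv)

lemma smooth_deriv: "smooth f \<Longrightarrow> smooth (deriv f)"
  unfolding smooth_def by (metis times_differentiable.simps(2))

lemma smooth_continuous: "smooth f \<Longrightarrow> continuous_on A f"
  by (meson DERIV_continuous_on has_field_derivative_at_within smooth_has_deriv)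

lemma deriv_eq_0_of_const:
  fixes f :: "real \<Rightarrow> real"
  assumes "open A" "\<And>x. x \<in> A \<Longrightarrow> f x = c" "x \<in> A"
  shows "deriv f x = 0"
proof -
  have "eventually (\<lambda>x. f x = c) (nhds x)"
    using eventually_nhds_in_open[OF assms(1,3)] by (rule eventually_mono) (use assms(2) in auto)
  then have "deriv f x = deriv (\<lambda>x. c) x"
    by (intro deriv_cong_ev) auto
  then show ?thesis by simp
qed

text \<open>Substituting \<open>s = (n + k) (t - z)\<close> turns the integral of \<open>G n\<close> into that of \<open>u(z + s / (n + k)) S'(s)\<close>.\<close>

lemma mollified_limit:
  fixes u :: "real \<Rightarrow> real"
  assumes S: "smooth S" "\<And>x. x \<le> 0 \<Longrightarrow> S x = 0" "\<And>x. x \<ge> 1 \<Longrightarrow> S x = 1"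
    and u: "continuous_on {0<..<T} u" and z: "0 < z" "0 < k" "z + 1 / k < T"
  defines "G \<equiv> \<lambda>n t. u t * ((real n + k) * deriv S ((real n + k) * (t - z)))"
  shows "set_integrable lebesgue {0<..<T} (G n)"
    and "(\<lambda>n. LINT t:{0<..<T}|lebesgue. G n t) \<longlonglongrightarrow> u z"
proof -
  define S' where "S' = deriv S"
  define H where "H n t = indicator {0<..<T} t *\<^sub>R G n t" for n t
  have S'c: "continuous_on A S'" for A
    using smooth_continuous[OF smooth_deriv[OF S(1)]] by (simp add: S'_def)
  have S'0: "S' s = 0" if "s \<notin> {0..1}" for s
  proof (cases "s < 0")
    case True
    then show ?thesis
      unfolding S'_def by (intro deriv_eq_0_of_const[of "{..<0}" _ 0]) (auto simp: S)
  next
    case False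
    then show ?thesis
      unfolding S'_def using that by (intro deriv_eq_0_of_const[of "{1<..}" _ 1]) (auto simp: S)
  qed
  have "continuous_on {0<..<T} (G n)" for n
    unfolding G_def S'_def[symmetric]
    by (intro continuous_intros u continuous_on_compose2[OF S'c[of UNIV]]) auto
  then have Hm: "H n \<in> borel_measurable borel" for n
    unfolding H_def by (intro borel_measurable_continuous_on_indicator) auto
  define w where "w n s = indicator {0<..<T} (z + inverse (real n + k) * s) * u (z + inverse (real n + k) * s) * S' s" for n s
  have k: "real n + k > 0" for n using z by simp
  have HG: "H n (z + inverse (real n + k) * s) = (real n + k) * w n s" for n s
  proof -
    have "(real n + k) * (z + inverse (real n + k) * s - z) = s"
      using k[of n] by (metis add_diff_cancel_left' less_irrefl mult.assoc mult_1 right_inverse)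
    then show ?thesis
      unfolding H_def G_def w_def S'_def by (simp only: real_scaleR_def ac_simps)
  qed
  \<comment> \<open>The shift from \<open>n\<close> to \<open>n + k\<close> makes the step width at
    most \<open>1 / k\<close> already for \<open>n = 0\<close>, so every argument of
    \<open>u\<close> that matters lies in one compact interval inside (0,T), where \<open>u\<close>
    is bounded.\<close>
  have in_int: "z + inverse (real n + k) * s \<in> {z..z+1/k}" if "s \<in> {0..1}" for n s
  proof -
    have "inverse (real n + k) \<le> 1 / k"
      using z by (simp add: field_simps)
    then have "inverse (real n + k) * s \<le> 1 / k * 1"
      using that z by (intro mult_mono) auto
    then show ?thesis
      using that k[of n] by simp
  qed
  have sub: "{z..z+1/k} \<subseteq> {0<..<T}"
    using z by auto
  obtain B where B: "\<And>x. x \<in> {z..z+1/k} \<Longrightarrow> \<bar>u x\<bar> \<le> B"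
  proof -
    have "bounded (u ` {z..z+1/k})"
      by (intro compact_imp_bounded compact_continuous_image continuous_on_subset[OF u sub]) simp
    then show ?thesis
      using that unfolding bounded_iff real_norm_def by (metis imageI)
  qed
  obtain C where C: "\<And>x. x \<in> {0..1} \<Longrightarrow> \<bar>S' x\<bar> \<le> C"
  proof -
    have "bounded (S' ` {0..1})"
      by (intro compact_imp_bounded compact_continuous_image S'c) simp
    then show ?thesis
      using that unfolding bounded_iff real_norm_def by (metis imageI)
  qed
  have "0 \<le> B" using B[of z] z by force
  have "0 \<le> C" using C[of 0] by force
  have wm: "w n \<in> borel_measurable borel" for n
  proof -
    have "(\<lambda>s. inverse (real n + k) * H n (z + inverse (real n + k) * s)) \<in> borel_measurable borel"
      using Hm[of n] by measurable
    moreover have "inverse (real n + k) * H n (z + inverse (real n + k) * s) = w n s" for s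
      using k[of n] by (simp add: HG)
    ultimately show ?thesis by simp
  qed
  have bound: "norm (w n s) \<le> indicator {0..1} s * (B * C)" for n s
  proof (cases "s \<in> {0..1}")
    case True
    have "\<bar>u (z + inverse (real n + k) * s)\<bar> * \<bar>S' s\<bar> \<le> B * C"
      using True \<open>0 \<le> B\<close> by (intro mult_mono B C in_int) auto
    then show ?thesis
      using True \<open>0 \<le> B\<close> \<open>0 \<le> C\<close> by (auto simp: w_def abs_mult split: split_indicator)
  qed (simp add: w_def S'0)
  have lim: "(\<lambda>n. w n s) \<longlonglongrightarrow> u z * S' s" for s
  proof (cases "s \<in> {0..1}")
    case True
    have "filterlim (\<lambda>n. real n + k) at_top sequentially"
      using z k by (intro filterlim_at_top_mono[OF filterlim_real_sequentially]) auto
    then have "(\<lambda>n. inverse (real n + k)) \<longlonglongrightarrow> 0"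
      by (rule tendsto_inverse_0_at_top)
    then have "(\<lambda>n. z + inverse (real n + k) * s) \<longlonglongrightarrow> z + 0 * s"
      by (intro tendsto_intros)
    then have *: "(\<lambda>n. z + inverse (real n + k) * s) \<longlonglongrightarrow> z" by simp
    have "z \<in> {0<..<T}"
      using z by (auto intro: less_trans[OF _ z(3)])
    then have "isCont u z"
      using u by (simp add: continuous_on_eq_continuous_at)
    then have "(\<lambda>n. u (z + inverse (real n + k) * s)) \<longlonglongrightarrow> u z"
      using * by (rule isCont_tendsto_compose)
    then have "(\<lambda>n. u (z + inverse (real n + k) * s) * S' s) \<longlonglongrightarrow> u z * S' s"
      by (intro tendsto_intros)
    moreover have "w n s = u (z + inverse (real n + k) * s) * S' s" for n
      using in_int[OF True, of n] sub by (simp add: w_def subset_iff)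
    ultimately show ?thesis by simp
  qed (simp add: w_def S'0)
  have dom: "integrable lborel (\<lambda>s::real. indicator {0..1} s * (B * C))"
    by (intro integrable_mult_left integrable_real_indicator) auto
  have S'm: "(\<lambda>s. u z * S' s) \<in> borel_measurable lborel"
    using borel_measurable_continuous_onI[OF S'c] by measurable
  have wm': "w n \<in> borel_measurable lborel" for n using wm by simp
  note dc = S'm wm' dom AE_I2[OF lim] AE_I2[OF bound]
  have wi: "integrable lborel (w n)" for n
    by (rule integrable_dominated_convergence2[OF dc])
  have wl: "(\<lambda>n. LINT s|lborel. w n s) \<longlonglongrightarrow> (LINT s|lborel. u z * S' s)"
    by (rule integral_dominated_convergence[OF dc])
  have Hi: "integrable lborel (H n)" for n
    using wi[of n] k[of n]
    by (subst lborel_integrable_real_affine_iff[of "inverse (real n + k)" _ z, symmetric]) (auto simp: HG)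
  have Hl: "integral\<^sup>L lborel (H n) = integral\<^sup>L lborel (w n)" for n
    using k[of n]
    by (subst lborel_integral_real_affine[of "inverse (real n + k)" _ z]) (auto simp: HG)
  show "set_integrable lebesgue {0<..<T} (G n)"
    unfolding set_integrable_def using Hi[of n] Hm[of n] 
    by (simp add: integrable_completion H_def[abs_def])
  have "(LINT t:{0<..<T}|lebesgue. G n t) = integral\<^sup>L lborel (w n)" for n
    unfolding set_lebesgue_integral_def using Hl[of n] Hm[of n] 
    by (simp add: integral_completion H_def[abs_def])
  \<comment> \<open>The rise of \<open>S\<close> from 0 to 1 is the total mass of the
    mollifier.\<close>
  moreover have "(LINT s|lborel. S' s) = 1"
  proof -
    have "(S has_vector_derivative S' x) (at x within A)" for x A
      using smooth_has_deriv[OF S(1), of x]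
      by (auto simp: S'_def has_real_derivative_iff_has_vector_derivative intro: has_vector_derivative_at_within)
    then have "integral\<^sup>L lborel (\<lambda>x. indicator {0 .. 1} x *\<^sub>R S' x) = S 1 - S 0"
      by (intro integral_FTC_atLeastAtMost S'c) auto
    moreover have "(\<lambda>x. indicator {0 .. 1} x *\<^sub>R S' x) = S'"
      by (intro ext) (use S'0 in \<open>auto simp: indicator_def\<close>)
    ultimately have "integral\<^sup>L lborel S' = S 1 - S 0"
      by (simp only:)
    then show ?thesis using S(2)[of 0] S(3)[of 1] by simp
  qed
  ultimately show "(\<lambda>n. LINT t:{0<..<T}|lebesgue. G n t) \<longlonglongrightarrow> u z"
    using wl by simp
qed

text \<open>The test function rises just to the right of \<open>y\<close> and falls just to the
  right of \<open>x\<close>, so its derivative is a difference of two mollifiers and the left side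
  of the weak identity tends to \<open>u y - u x\<close>. The other side tends to the integral of
  \<open>g\<close> by dominated convergence.\<close>

lemma weak_deriv_increment:
  assumes w: "has_weak_deriv T u g" and u: "continuous_on {0<..<T} u"
    and y: "0 < y" "y < x" "x < T"
  shows "u x - u y = (LINT t:{y<..x}|lebesgue. g t)"
proof -
  obtain S where S: "smooth S" "\<And>x. x \<le> 0 \<Longrightarrow> S x = 0" "\<And>x. x \<ge> 1 \<Longrightarrow> S x = 1"
    "\<And>x. 0 \<le> S x" "\<And>x. S x \<le> 1"
    by (rule smooth_step) blast
  \<comment> \<open>Then \<open>1 / k\<close> is half the distance from \<open>x\<close> to
    \<open>T\<close>, which keeps the supports of all test functions in one compact subset of
    (0,T).\<close>
  define k where "k = 2 / (T - x)"
  have k: "0 < k" "x + 1 / k < T" "y + 1 / k < T"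
    using y by (auto simp: k_def field_simps)
  define N where "N n = real n + k" for n
  have N: "N n > 0" "1 / N n \<le> 1 / k" for n
    using k by (auto simp: N_def field_simps)
  define \<phi> where "\<phi> n t = S (N n * t + - (N n * y)) - S (N n * t + - (N n * x))" for n t
  define K where "K = {y..x + 1/k}"
  have out: "\<phi> n t = 0" if "t \<notin> K" for n t
  proof (cases "t < y")
    case True
    have "N n * t < N n * y" "N n * t < N n * x"
      using True y N(1)[of n] by (auto intro: mult_strict_left_mono)
    then show ?thesis
      by (simp add: \<phi>_def S)
  next
    case False
    then have "x + 1 / N n \<le> t" 
      using that N(2)[of n] by (auto simp: K_def)
    then have "N n * (x + 1 / N n) \<le> N n * t"
      using N(1)[of n] by (intro mult_left_mono) auto
    moreover have "N n * (x + 1 / N n) = N n * x + 1"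
      using N(1)[of n] by (simp add: distrib_left)
    moreover have "N n * y < N n * x"
      using y N(1)[of n] by simp
    ultimately show ?thesis
      by (simp add: \<phi>_def S)
  qed
  have td: "times_differentiable m (\<phi> n)" for m n
    using S(1) unfolding \<phi>_def
    by (intro times_differentiable_diff times_differentiable_affine) (auto simp: smooth_def)
  have d\<phi>: "(\<phi> n has_real_derivative
     N n * deriv S (N n * (t - y)) - N n * deriv S (N n * (t - x))) (at t)" for n t
  proof -
    have "((\<lambda>t. S (N n * t + - (N n * z))) has_real_derivative deriv S (N n * t + - (N n * z)) * N n) (at t)" for z
      by (rule DERIV_chain2[OF smooth_has_deriv[OF S(1)]]) (auto intro!: derivative_eq_intros)
    from DERIV_diff[OF this[of y] this[of x]] show ?thesis
      unfolding \<phi>_def by (simp add: algebra_simps)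
  qed
  have test: "\<phi> n \<in> test_functions T" for n
  proof -
    have "closure {t. \<phi> n t \<noteq> 0} \<subseteq> K"
    proof (rule closure_minimal)
      show "{t. \<phi> n t \<noteq> 0} \<subseteq> K"
        using out by blast
    qed (simp add: K_def)
    moreover have "K \<subseteq> {0<..<T}"
      using y k by (auto simp: K_def)
    moreover have "compact (closure {t. \<phi> n t \<noteq> 0})"
      using \<open>closure {t. \<phi> n t \<noteq> 0} \<subseteq> K\<close> closed_Int_compact[of "closure {t. \<phi> n t \<noteq> 0}" K]
      by (simp add: K_def inf.absorb1)
    moreover have "\<forall>j. (deriv ^^ j) (\<phi> n) differentiable_on UNIV"
      using td smooth_iff smooth_def by blast
    ultimately show ?thesis
      unfolding test_functions_def by blast
  qed
  have eq: "(LINT t:{0<..<T}|lebesgue. u t * deriv (\<phi> n) t) = - (LINT t:{0<..<T}|lebesgue. g t * \<phi> n t)" for n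
    using w test[of n] by (auto simp: has_weak_deriv_def)
  have "0 < x" using y by simp
  note my = mollified_limit[OF S(1-3) u y(1) k(1,3)] and mx = mollified_limit[OF S(1-3) u \<open>0 < x\<close> k(1,2)]
  have split: "(LINT t:{0<..<T}|lebesgue. u t * deriv (\<phi> n) t) =
     (LINT t:{0<..<T}|lebesgue. u t * (N n * deriv S (N n * (t - y)))) -
     (LINT t:{0<..<T}|lebesgue. u t * (N n * deriv S (N n * (t - x))))" for n
  proof -
    have "deriv (\<phi> n) t = N n * deriv S (N n * (t - y)) - N n * deriv S (N n * (t - x))" for t
      using d\<phi> DERIV_imp_deriv by blast
    then show ?thesis
      using my(1)[of n] mx(1)[of n]
      by (subst set_integral_diff(2)[symmetric]) (auto simp: right_diff_distrib N_def)
  qed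
  have "(\<lambda>n. LINT t:{0<..<T}|lebesgue. u t * deriv (\<phi> n) t) \<longlonglongrightarrow> u y - u x"
    unfolding split unfolding N_def by (intro tendsto_diff my(2) mx(2))
  then have l1: "(\<lambda>n. LINT t:{0<..<T}|lebesgue. g t * \<phi> n t) \<longlonglongrightarrow> u x - u y"
    unfolding eq using tendsto_minus by fastforce
  have "K \<subseteq> {0<..<T}" "compact K"
    using y k by (auto simp: K_def)
  then have gK: "integrable lebesgue (\<lambda>t. indicator K t * g t)"
    using w by (auto simp: has_weak_deriv_def locally_integrable_def set_integrable_def)
  have form: "indicator {0<..<T} t *\<^sub>R (g t * \<phi> n t) = (indicator K t * g t) * \<phi> n t" for n t
    using out[of t n] \<open>K \<subseteq> {0<..<T}\<close> by (auto simp: indicator_def)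
  have "{y<..x} \<subseteq> K"
    using k(1) unfolding K_def by (intro subsetI) (simp add: order_trans[of _ x])
  then have form2: "indicator {y<..x} t *\<^sub>R g t = (indicator K t * g t) * indicator {y<..x} t" for t
    by (auto simp: indicator_def)
  have \<phi>m: "\<phi> n \<in> borel_measurable lebesgue" for n
    using borel_measurable_continuous_onI[OF smooth_continuous, of "\<phi> n"] td[of _ n]
    by (simp add: smooth_def measurable_completion)
  have "(\<lambda>n. LINT t|lebesgue. (indicator K t * g t) * \<phi> n t) \<longlonglongrightarrow>
     (LINT t|lebesgue. (indicator K t * g t) * indicator {y<..x} t)"
  proof (rule integral_dominated_convergence[where w="\<lambda>t. \<bar>indicator K t * g t\<bar>"])
    show "integrable lebesgue (\<lambda>t. \<bar>indicator K t * g t\<bar>)"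
      using gK by (rule integrable_abs)
    show "(\<lambda>t. indicator K t * g t * indicator {y<..x} t) \<in> borel_measurable lebesgue"
      by (intro borel_measurable_times borel_measurable_indicator borel_measurable_integrable[OF gK]) auto
    show "(\<lambda>t. indicator K t * g t * \<phi> n t) \<in> borel_measurable lebesgue" for n
      by (intro borel_measurable_times borel_measurable_integrable[OF gK] \<phi>m)
    show "AE t in lebesgue. norm (indicator K t * g t * \<phi> n t) \<le> \<bar>indicator K t * g t\<bar>" for n
    proof (rule AE_I2)
      fix t
      have "\<bar>\<phi> n t\<bar> \<le> 1"
        using S(4)[of "N n * t + - (N n * y)"] S(5)[of "N n * t + - (N n * y)"]
          S(4)[of "N n * t + - (N n * x)"] S(5)[of "N n * t + - (N n * x)"]
        by (simp add: \<phi>_def)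
      then have "\<bar>indicator K t * g t\<bar> * \<bar>\<phi> n t\<bar> \<le> \<bar>indicator K t * g t\<bar> * 1"
        by (intro mult_left_mono) auto
      then show "norm (indicator K t * g t * \<phi> n t) \<le> \<bar>indicator K t * g t\<bar>"
        by (simp add: abs_mult)
    qed
    \<comment> \<open>At \<open>t = z\<close> the value is \<open>S 0 = 0\<close>, so the limit
      excludes the left end; the difference of two such limits is the indicator of the half-open
      interval.\<close>
    have step: "(\<lambda>n. S (N n * t + - (N n * z))) \<longlonglongrightarrow> indicator {z<..} t" for t z
    proof (cases "z < t")
      case True
      have "filterlim N at_top sequentially"
        unfolding N_def using k by (intro filterlim_at_top_mono[OF filterlim_real_sequentially]) auto
      then have "eventually (\<lambda>n. N n \<ge> 1 / (t - z)) sequentially"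
        by (simp add: filterlim_at_top)
      then have "eventually (\<lambda>n. S (N n * t + - (N n * z)) = 1) sequentially"
        by (rule eventually_mono) (use True in \<open>auto intro!: S simp: field_simps\<close>)
      then show ?thesis
        using True by (simp add: tendsto_eventually)
    next
      case False
      then have "S (N n * t + - (N n * z)) = 0" for n
        using N(1)[of n] by (auto intro!: S mult_left_mono)
      then show ?thesis using False by simp
    qed
    have "(\<lambda>n. \<phi> n t) \<longlonglongrightarrow> indicator {y<..x} t" for t
    proof -
      have "(\<lambda>n. \<phi> n t) \<longlonglongrightarrow> indicator {y<..} t - indicator {x<..} t"
        unfolding \<phi>_def by (intro tendsto_diff step)
      moreover have "indicator {y<..} t - indicator {x<..} t = (indicator {y<..x} t :: real)"
        using y by (auto simp: indicator_def)
      ultimately show ?thesis by simp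
    qed
    then show "AE t in lebesgue. (\<lambda>n. indicator K t * g t * \<phi> n t) \<longlonglongrightarrow> indicator K t * g t * indicator {y<..x} t"
      by (intro AE_I2 tendsto_mult tendsto_const)
  qed
  then have "(\<lambda>n. LINT t:{0<..<T}|lebesgue. g t * \<phi> n t) \<longlonglongrightarrow> (LINT t:{y<..x}|lebesgue. g t)"
    unfolding set_lebesgue_integral_def form form2 .
  with l1 show ?thesis
    by (rule LIMSEQ_unique)
qed

section \<open>Integrable functions determined by their integrals over rays\<close>

text \<open>The positive and the negative part define finite measures that agree on all rays, hence
  everywhere, and densities are unique almost everywhere.\<close>

lemma AE_zero_of_interval_integrals:
  fixes f :: "real \<Rightarrow> real"
  assumes f: "integrable lebesgue f" and z: "\<And>a. (LINT t:{a<..}|lebesgue. f t) = 0"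
  shows "AE x in lebesgue. f x = 0"
proof -
  \<comment> \<open>The comparison of measures on rays is one for Borel measures, so
    \<open>f\<close> is first replaced by a Borel function equal to it almost everywhere.\<close>
  obtain h where h: "h \<in> borel_measurable lborel" and fh: "AE x in lborel. f x = h x"
    using completion_ex_borel_measurable_real[of f lborel] f by (auto dest: borel_measurable_integrable)
  note [measurable] = h
  have fh': "AE x in lebesgue. f x = h x"
    using fh by (rule AE_completion)
  have "integrable lebesgue h"
    using f fh' h by (subst integrable_cong_AE[of _ _ f]) (auto simp: measurable_completion dest: borel_measurable_integrable)
  then have hi: "integrable lborel h"
    using h by (simp add: integrable_completion)
  have hz: "(LINT t:{a<..}|lborel. h t) = 0" for a
  proof -
    have "(LINT t:{a<..}|lebesgue. f t) = (LINT t:{a<..}|lebesgue. h t)"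
      unfolding set_lebesgue_integral_def
    proof (rule integral_cong_AE)
      show "(\<lambda>x. indicat_real {a<..} x *\<^sub>R f x) \<in> borel_measurable lebesgue"
        by (rule borel_measurable_integrable[OF integrable_mult_indicator[OF _ f]]) simp
      show "(\<lambda>x. indicat_real {a<..} x *\<^sub>R h x) \<in> borel_measurable lebesgue"
        by (rule measurable_completion) simp
      show "AE x in lebesgue. indicat_real {a<..} x *\<^sub>R f x = indicat_real {a<..} x *\<^sub>R h x"
        using fh' by eventually_elim simp
    qed
    also have "\<dots> = (LINT t:{a<..}|lborel. h t)"
      unfolding set_lebesgue_integral_def using h by (intro integral_completion) auto
    finally show ?thesis using z by simp
  qed
  \<comment> \<open>The conversion \<open>ennreal\<close> sends negative numbers to 0, so the two
    densities are the positive and the negative part of \<open>h\<close>.\<close>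
  have "density lborel (\<lambda>x. ennreal (h x)) = density lborel (\<lambda>x. ennreal (- h x))"
  proof (rule measure_eqI_lessThan)
    fix a :: real
    let ?i = "\<lambda>x. indicator {a<..} x * h x"
    have i: "integrable lborel ?i"
      using integrable_mult_indicator[of "{a<..}" lborel h] hi by simp
    have fin: "(\<integral>\<^sup>+x. ennreal (?i x) \<partial>lborel) < \<infinity>"
      using i unfolding real_integrable_def by (simp add: less_top)
    have e: "emeasure (density lborel (\<lambda>x. ennreal (h x))) {a<..} = (\<integral>\<^sup>+x. ennreal (?i x) \<partial>lborel)"
      by (subst emeasure_density) (auto intro!: nn_integral_cong split: split_indicator)
    have e': "emeasure (density lborel (\<lambda>x. ennreal (- h x))) {a<..} = (\<integral>\<^sup>+x. ennreal (- ?i x) \<partial>lborel)"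
      by (subst emeasure_density) (auto intro!: nn_integral_cong split: split_indicator)
    show "emeasure (density lborel (\<lambda>x. ennreal (h x))) {a<..} < \<infinity>"
      using e fin by simp
    have "enn2real (\<integral>\<^sup>+x. ennreal (?i x) \<partial>lborel) - enn2real (\<integral>\<^sup>+x. ennreal (- ?i x) \<partial>lborel) = 0"
      using real_lebesgue_integral_def[OF i] hz[of a] by (simp add: set_lebesgue_integral_def)
    moreover have "(\<integral>\<^sup>+x. ennreal (- ?i x) \<partial>lborel) < \<infinity>"
      using i unfolding real_integrable_def by (simp add: less_top)
    ultimately show "emeasure (density lborel (\<lambda>x. ennreal (h x))) {a<..} =
        emeasure (density lborel (\<lambda>x. ennreal (- h x))) {a<..}"
      unfolding e e' using fin
      by (metis (no_types) eq_iff_diff_eq_0 ennreal_enn2real infinity_ennreal_def)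
  qed auto
  then have "AE x in lborel. ennreal (h x) = ennreal (- h x)"
    by (intro iffD1[OF sigma_finite_measure.density_unique_iff[OF sigma_finite_lborel]]) auto
  then have "AE x in lborel. h x = 0"
  proof (rule AE_mp, intro AE_I2 impI)
    fix x assume "ennreal (h x) = ennreal (- h x)"
    then show "h x = 0"
      by (cases "h x \<ge> 0") (auto simp: ennreal_neg ennreal_eq_0_iff)
  qed
  then have "AE x in lebesgue. h x = 0"
    by (rule AE_completion)
  then show ?thesis
    using fh' by eventually_elim simp
qed

lemma test_function_props:
  assumes "\<phi> \<in> test_functions T"
  obtains K where "compact K" "K \<subseteq> {0<..<T}" "\<And>x. x \<notin> K \<Longrightarrow> \<phi> x = 0" "\<And>x. x \<notin> K \<Longrightarrow> deriv \<phi> x = 0"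
    "continuous_on UNIV \<phi>" "continuous_on UNIV (deriv \<phi>)"
proof
  let ?K = "closure {x. \<phi> x \<noteq> 0}"
  show "compact ?K" "?K \<subseteq> {0<..<T}"
    using assms by (auto simp: test_functions_def)
  have s: "smooth \<phi>"
    using assms by (simp add: test_functions_def smooth_iff)
  then show "continuous_on UNIV \<phi>" "continuous_on UNIV (deriv \<phi>)"
    by (auto intro: smooth_continuous smooth_deriv)
  show z: "\<phi> x = 0" if "x \<notin> ?K" for x
    using that closure_subset[of "{x. \<phi> x \<noteq> 0}"] by blast
  show "deriv \<phi> x = 0" if "x \<notin> ?K" for x
  proof (rule deriv_eq_0_of_const)
    show "open (- ?K)" by (simp add: open_Compl)
    show "x \<in> - ?K" using that by simp
    show "\<phi> y = 0" if "y \<in> - ?K" for y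
      by (rule z) (use that in blast)
  qed
qed

text \<open>Supplies the integrability without which the integrals in the weak identity could not be
  split into sums: \<open>u\<close> is integrable on compact sets only, and the support of
  \<open>\<psi>\<close> is one of them.\<close>

lemma locally_integrable_mult:
  assumes u: "locally_integrable T u" and K: "compact K" "K \<subseteq> {0<..<T}"
    and c: "continuous_on UNIV \<psi>" and z: "\<And>x. x \<notin> K \<Longrightarrow> \<psi> x = 0"
  shows "set_integrable lebesgue {0<..<T} (\<lambda>x. u x * \<psi> x)"
proof -
  have i: "integrable lebesgue (\<lambda>x. indicator K x *\<^sub>R u x)"
    using u K by (auto simp: locally_integrable_def set_integrable_def)
  have "bounded (\<psi> ` K)"
    using K(1) c by (intro compact_imp_bounded compact_continuous_image) (auto intro: continuous_on_subset)
  then obtain B where B: "\<And>x. x \<in> K \<Longrightarrow> \<bar>\<psi> x\<bar> \<le> B"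
    unfolding bounded_iff real_norm_def by (metis imageI)
  have eq: "indicator {0<..<T} x *\<^sub>R (u x * \<psi> x) = (indicator K x *\<^sub>R u x) * \<psi> x" for x
    using z[of x] K(2) by (auto simp: indicator_def)
  have "\<psi> \<in> borel_measurable lebesgue"
    using borel_measurable_continuous_onI[OF c] by (simp add: measurable_completion)
  then have m: "(\<lambda>x. (indicator K x *\<^sub>R u x) * \<psi> x) \<in> borel_measurable lebesgue"
    using borel_measurable_integrable[OF i] by (intro borel_measurable_times)
  have "integrable lebesgue (\<lambda>x. (indicator K x *\<^sub>R u x) * \<psi> x)"
  proof (rule Bochner_Integration.integrable_bound[OF _ m])
    show "integrable lebesgue (\<lambda>x. B * \<bar>indicator K x *\<^sub>R u x\<bar>)"
      using i by (intro integrable_mult_right integrable_abs)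
    show "AE x in lebesgue. norm (indicator K x *\<^sub>R u x * \<psi> x) \<le> norm (B * \<bar>indicator K x *\<^sub>R u x\<bar>)"
    proof (rule AE_I2)
      fix x
      show "norm (indicator K x *\<^sub>R u x * \<psi> x) \<le> norm (B * \<bar>indicator K x *\<^sub>R u x\<bar>)"
      proof (cases "x \<in> K")
        case True
        then have "\<bar>u x\<bar> * \<bar>\<psi> x\<bar> \<le> \<bar>u x\<bar> * \<bar>B\<bar>"
          using B by (intro mult_left_mono) fastforce+
        then show ?thesis using True by (simp add: abs_mult ac_simps)
      qed simp
    qed
  qed
  then show ?thesis
    unfolding set_integrable_def eq .
qed

lemma locally_integrable_lincomb:
  assumes "locally_integrable T u" "locally_integrable T v"
  shows "locally_integrable T (\<lambda>x. a * u x + b * v x)"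
  using assms unfolding locally_integrable_def by (auto intro!: set_integral_add)

lemma has_weak_deriv_lincomb:
  assumes u: "has_weak_deriv T u g" and v: "has_weak_deriv T v h"
  shows "has_weak_deriv T (\<lambda>x. a * u x + b * v x) (\<lambda>x. a * g x + b * h x)"
  unfolding has_weak_deriv_def
proof (intro conjI ballI)
  have li: "locally_integrable T u" "locally_integrable T v" "locally_integrable T g" "locally_integrable T h"
    using u v by (auto simp: has_weak_deriv_def)
  then show "locally_integrable T (\<lambda>x. a * u x + b * v x)" "locally_integrable T (\<lambda>x. a * g x + b * h x)"
    by (auto intro: locally_integrable_lincomb)
  fix \<phi> assume \<phi>: "\<phi> \<in> test_functions T"
  obtain K where K: "compact K" "K \<subseteq> {0<..<T}" "\<And>x. x \<notin> K \<Longrightarrow> \<phi> x = 0" "\<And>x. x \<notin> K \<Longrightarrow> deriv \<phi> x = 0"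
    "continuous_on UNIV \<phi>" "continuous_on UNIV (deriv \<phi>)"
    using test_function_props[OF \<phi>] by blast
  have lin: "(LINT x:{0<..<T}|lebesgue. (a * w x + b * z x) * \<psi> x) =
     a * (LINT x:{0<..<T}|lebesgue. w x * \<psi> x) + b * (LINT x:{0<..<T}|lebesgue. z x * \<psi> x)"
    if "locally_integrable T w" "locally_integrable T z" "continuous_on UNIV \<psi>" "\<And>x. x \<notin> K \<Longrightarrow> \<psi> x = 0" for w z \<psi>
  proof -
    note i = locally_integrable_mult[OF that(1) K(1,2) that(3,4)] locally_integrable_mult[OF that(2) K(1,2) that(3,4)]
    have "(LINT x:{0<..<T}|lebesgue. a * (w x * \<psi> x) + b * (z x * \<psi> x)) =
      (LINT x:{0<..<T}|lebesgue. a * (w x * \<psi> x)) + (LINT x:{0<..<T}|lebesgue. b * (z x * \<psi> x))"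
      using i by (intro set_integral_add) auto
    then show ?thesis by (simp add: algebra_simps)
  qed
  show "(LINT x:{0<..<T}|lebesgue. (a * u x + b * v x) * deriv \<phi> x) =
    - (LINT x:{0<..<T}|lebesgue. (a * g x + b * h x) * \<phi> x)"
  proof -
    have "(LINT x:{0<..<T}|lebesgue. u x * deriv \<phi> x) = - (LINT x:{0<..<T}|lebesgue. g x * \<phi> x)"
      "(LINT x:{0<..<T}|lebesgue. v x * deriv \<phi> x) = - (LINT x:{0<..<T}|lebesgue. h x * \<phi> x)"
      using u v \<phi> by (auto simp: has_weak_deriv_def)
    moreover have "(LINT x:{0<..<T}|lebesgue. (a * u x + b * v x) * deriv \<phi> x) =
       a * (LINT x:{0<..<T}|lebesgue. u x * deriv \<phi> x) + b * (LINT x:{0<..<T}|lebesgue. v x * deriv \<phi> x)"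
      by (rule lin) (fact li K)+
    moreover have "(LINT x:{0<..<T}|lebesgue. (a * g x + b * h x) * \<phi> x) =
       a * (LINT x:{0<..<T}|lebesgue. g x * \<phi> x) + b * (LINT x:{0<..<T}|lebesgue. h x * \<phi> x)"
      by (rule lin) (fact li K)+
    ultimately show ?thesis
      by (simp only: mult_minus_right minus_add_distrib)
  qed
qed

section \<open>The finite measure on the interval and uniqueness of weak derivatives\<close>

text \<open>Turns set integrals into integrals over a finite measure space, where integrability of
  the \<open>p\<close>-th power implies integrability.\<close>

definition interval_measure :: "real \<Rightarrow> real measure" where
  "interval_measure T = restrict_space lebesgue {0<..<T}"

lemma space_interval_measure [simp]: "space (interval_measure T) = {0<..<T}"
  by (simp add: interval_measure_def space_restrict_space)

lemma finite_interval_measure: "finite_measure (interval_measure T)"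
  by (rule finite_measureI, cases "T \<ge> 0")
    (auto simp: interval_measure_def emeasure_restrict_space space_restrict_space)

lemma measure_interval_measure: "T > 0 \<Longrightarrow> measure (interval_measure T) {0<..<T} = T"
  by (simp add: interval_measure_def measure_restrict_space)

lemma set_integral_interval_measure:
  fixes f :: "real \<Rightarrow> real"
  shows "(LINT x:{0<..<T}|lebesgue. f x) = (LINT x|interval_measure T. f x)"
  by (simp add: interval_measure_def integral_restrict_space set_lebesgue_integral_def)

lemma set_integrable_interval_measure:
  fixes f :: "real \<Rightarrow> real"
  shows "set_integrable lebesgue {0<..<T} f \<longleftrightarrow> integrable (interval_measure T) f"
  by (simp add: interval_measure_def integrable_restrict_space set_integrable_def)

lemma set_borel_measurable_interval_measure:
  fixes f :: "real \<Rightarrow> real"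
  shows "set_borel_measurable lebesgue {0<..<T} f \<longleftrightarrow> f \<in> borel_measurable (interval_measure T)"
  by (simp add: interval_measure_def borel_measurable_restrict_space_iff set_borel_measurable_def)

text \<open>The offset 3 makes the removed margins at most a third of the interval, so that the
  exhausting intervals are nonempty for every \<open>n\<close>. They are half-open to match
  \<open>weak_deriv_increment\<close>.\<close>

lemma interval_exhaustion:
  assumes "0 < x" "x < (T::real)"
  shows "eventually (\<lambda>n. T / real (n + 3) < x \<and> x \<le> T - T / real (n + 3)) sequentially"
proof -
  have "(\<lambda>n. T * (1 / real (n + 3))) \<longlonglongrightarrow> T * 0"
    by (intro tendsto_mult tendsto_const LIMSEQ_ignore_initial_segment[OF lim_1_over_n])
  then have "(\<lambda>n. T / real (n + 3)) \<longlonglongrightarrow> 0" by simp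
  then have "eventually (\<lambda>n. T / real (n + 3) < min x (T - x)) sequentially"
    using assms by (intro order_tendstoD(2)) auto
  then show ?thesis
    by (rule eventually_mono) (simp add: less_diff_eq add.commute)
qed

lemma interval_exhaustion_bounds:
  assumes "T > (0::real)"
  shows "0 < T / real (n + 3)" "T / real (n + 3) < T - T / real (n + 3)"
proof -
  show "0 < T / real (n + 3)" using assms by simp
  have "T / real (n + 3) \<le> T / 3"
    using assms by (intro divide_left_mono) auto
  then show "T / real (n + 3) < T - T / real (n + 3)"
    using assms by linarith
qed

text \<open>Local integrability gives measurability on compact subsets only; the function is the
  pointwise limit of its truncations. This is applied to the chosen weak derivative, of which at
  first nothing but \<open>has_weak_deriv\<close> is known.\<close>

lemma locally_integrable_measurable:
  assumes "T > 0" and g: "locally_integrable T g"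
  shows "g \<in> borel_measurable (interval_measure T)"
proof -
  define f where "f n x = indicator {T / real (n + 3) .. T - T / real (n + 3)} x *\<^sub>R g x" for n x
  have "integrable lebesgue (f n)" for n
  proof -
    have "{T / real (n + 3) .. T - T / real (n + 3)} \<subseteq> {0<..<T}"
      using interval_exhaustion_bounds[OF \<open>T > 0\<close>, of n] by auto
    then show ?thesis
      using g unfolding f_def locally_integrable_def set_integrable_def by blast
  qed
  then have m: "f n \<in> borel_measurable (interval_measure T)" for n
    unfolding interval_measure_def by (intro measurable_restrict_space1 borel_measurable_integrable)
  show ?thesis
  proof (rule borel_measurable_LIMSEQ_real[OF _ m])
    fix x assume "x \<in> space (interval_measure T)"
    then have "eventually (\<lambda>n. T / real (n + 3) < x \<and> x \<le> T - T / real (n + 3)) sequentially"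
      by (intro interval_exhaustion) auto
    then have "eventually (\<lambda>n. f n x = g x) sequentially"
      by eventually_elim (simp add: f_def)
    then show "(\<lambda>n. f n x) \<longlonglongrightarrow> g x"
      by (rule tendsto_eventually)
  qed
qed

text \<open>Truncated to \<open>{a n<..T - a n}\<close>, the function \<open>h\<close> is
  integrable, and its integral over a ray is one over a half-open interval, that is, an increment of
  the zero function.\<close>

lemma weak_deriv_of_0:
  assumes "T > 0" and h: "has_weak_deriv T (\<lambda>_. 0) h"
  shows "AE x in interval_measure T. h x = 0"
proof -
  define a where "a n = T / real (n + 3)" for n
  have "AE x in lebesgue. indicator {a n<..T - a n} x * h x = 0" for n
  proof -
    have a: "0 < a n" "a n < T - a n"
      using interval_exhaustion_bounds[OF \<open>T > 0\<close>] by (auto simp: a_def)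
    then have sub: "{a n..T - a n} \<subseteq> {0<..<T}" by auto
    have "set_integrable lebesgue {a n..T - a n} h"
      using h sub by (auto simp: has_weak_deriv_def locally_integrable_def)
    then have i: "set_integrable lebesgue {a n<..T - a n} h"
      by (rule set_integrable_subset) auto
    show ?thesis
    proof (rule AE_zero_of_interval_integrals)
      show "integrable lebesgue (\<lambda>x. indicator {a n<..T - a n} x * h x)"
        using i by (simp add: set_integrable_def)
      fix b
      have eq: "indicator {b<..} x * (indicator {a n<..T - a n} x * h x) = indicator {max b (a n)<..T - a n} x * h x" for x
        by (auto simp: indicator_def)
      have "(LINT x:{max b (a n)<..T - a n}|lebesgue. h x) = 0"
      proof (cases "max b (a n) < T - a n")
        case True
        then have "0 - 0 = (LINT x:{max b (a n)<..T - a n}|lebesgue. h x)"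
          using a by (intro weak_deriv_increment[OF h]) auto
        then show ?thesis by simp
      next
        case False
        then have empty: "{max b (a n)<..T - a n} = {}"
          by (simp only: greaterThanAtMost_empty_iff not_less)
        show ?thesis
          unfolding empty by (simp add: set_lebesgue_integral_def)
      qed
      then show "(LINT x:{b<..}|lebesgue. indicator {a n<..T - a n} x * h x) = 0"
        by (simp add: set_lebesgue_integral_def eq)
    qed
  qed
  then have "AE x in lebesgue. \<forall>n. indicator {a n<..T - a n} x * h x = 0"
    unfolding AE_all_countable by blast
  then have "AE x in lebesgue. x \<in> {0<..<T} \<longrightarrow> h x = 0"
  proof eventually_elim
    case (elim x)
    show ?case
    proof
      assume "x \<in> {0<..<T}"
      then have "eventually (\<lambda>n. a n < x \<and> x \<le> T - a n) sequentially"
        unfolding a_def by (intro interval_exhaustion) auto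
      then obtain n where "a n < x" "x \<le> T - a n"
        by (auto simp: eventually_sequentially)
      then show "h x = 0"
        using elim[rule_format, of n] by simp
    qed
  qed
  then show ?thesis
    unfolding interval_measure_def by (subst AE_restrict_space_iff) auto
qed

text \<open>The difference \<open>g - h\<close> is a weak derivative of \<open>u - u\<close>. This
  is the zero function, which is continuous, so the increment identity settles uniqueness for
  arbitrary \<open>u\<close>.\<close>

lemma weak_deriv_unique:
  assumes "T > 0" "has_weak_deriv T u g" "has_weak_deriv T u h"
  shows "AE x in interval_measure T. g x = h x"
  using weak_deriv_of_0[of T "\<lambda>x. g x - h x"] has_weak_deriv_lincomb[OF assms(2,3), of 1 "-1"] assms(1) by simp

section \<open>Homogeneous functions\<close>

text \<open>
  Triples are the values at one point of three functions \<open>u, v, w\<close> of the space, or of their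
  derivatives; inequalities involving fewer functions ignore the last components.
\<close>

definition homogeneous :: "real \<Rightarrow> (real \<times> real \<times> real \<Rightarrow> real) \<Rightarrow> bool" where
  "homogeneous p F \<longleftrightarrow> continuous_on UNIV F \<and> (\<forall>t>0. \<forall>x. F (t *\<^sub>R x) = t powr p * F x)"

definition power_sum :: "real \<Rightarrow> real \<times> real \<times> real \<Rightarrow> real" where
  "power_sum p x = \<bar>fst x\<bar> powr p + \<bar>fst (snd x)\<bar> powr p + \<bar>snd (snd x)\<bar> powr p"

text \<open>Coefficients of a linear combination of three functions. The same
  \<open>lin a b c\<close> is applied to the triple of values and to the triple of derivatives;
  \<open>lin 1 (-1) 0\<close> stands for \<open>u - v\<close>, and \<open>lin 0 0 1\<close> for a
  test direction \<open>w\<close>.\<close>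

definition lin :: "real \<Rightarrow> real \<Rightarrow> real \<Rightarrow> real \<times> real \<times> real \<Rightarrow> real" where
  "lin a b c x = a * fst x + b * fst (snd x) + c * snd (snd x)"

section \<open>The power function, its derivative and its convexity\<close>

definition psi :: "real \<Rightarrow> real \<Rightarrow> real" where
  "psi p a = \<bar>a\<bar> powr (p - 2) * a"

lemma psi_0 [simp]: "psi p 0 = 0"
  by (simp add: psi_def)

lemma psi_pos: "a > 0 \<Longrightarrow> psi p a = a powr (p - 1)"
  using powr_add[of a "p - 2" 1] by (simp add: psi_def)

lemma psi_minus: "psi p (- a) = - psi p a"
  by (simp add: psi_def)

lemma psi_times: "p > 1 \<Longrightarrow> psi p a * a = \<bar>a\<bar> powr p"
  using powr_add[of "\<bar>a\<bar>" "p - 2" 2] by (auto simp: psi_def power2_eq_square[symmetric])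

lemma abs_psi: "p > 1 \<Longrightarrow> \<bar>psi p a\<bar> = \<bar>a\<bar> powr (p - 1)"
  using powr_add[of "\<bar>a\<bar>" "p - 2" 1] by (auto simp: psi_def abs_mult)

lemma psi_scale: "t > 0 \<Longrightarrow> psi p (t * a) = t powr (p - 1) * psi p a"
  using powr_add[of t "p - 2" 1] by (simp add: psi_def abs_mult powr_mult)

text \<open>Only the positive exponent \<open>p - 1\<close> occurs on the right, so continuity at 0
  is visible; the factor \<open>\<bar>a\<bar> powr (p - 2)\<close> alone is discontinuous there for
  \<open>p \<le> 2\<close>.\<close>

lemma psi_eq: "p > 1 \<Longrightarrow> psi p a = (max a 0) powr (p - 1) - (max (- a) 0) powr (p - 1)"
  using psi_pos[of a p] psi_pos[of "- a" p] psi_minus[of p a]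
  by (cases a "0::real" rule: linorder_cases) (auto simp: max_def)

lemma continuous_on_psi: "p > 1 \<Longrightarrow> continuous_on A (psi p)"
  by (subst continuous_on_cong[OF refl psi_eq]) (auto intro!: continuous_intros continuous_on_powr')

lemma psi_strict_mono:
  assumes p: "p > 1" and ab: "a < b"
  shows "psi p a < psi p b"
proof -
  consider "0 \<le> a" | "b \<le> 0" | "a < 0" "0 < b" by linarith
  then show ?thesis
  proof cases
    case 1
    then show ?thesis
      using ab p psi_pos[of b p] psi_pos[of a p] powr_less_mono2[of "p - 1" a b]
      by (cases "a = 0") auto
  next
    case 2
    then show ?thesis
      using ab p psi_pos[of "-b" p] psi_pos[of "-a" p] powr_less_mono2[of "p - 1" "-b" "-a"]
        powr_gt_zero[of "-a" "p - 1"]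
      by (cases "b = 0") (auto simp: psi_minus simp del: powr_gt_zero)
  next
    case 3
    have "psi p (- a) > 0"
      using 3 by (subst psi_pos) auto
    moreover have "psi p b > 0"
      using 3 by (subst psi_pos) auto
    ultimately show ?thesis
      by (simp add: psi_minus)
  qed
qed

lemma psi_monotone:
  assumes p: "p > 1"
  shows "(psi p a - psi p b) * (a - b) \<ge> 0" and "a \<noteq> b \<Longrightarrow> (psi p a - psi p b) * (a - b) > 0"
proof -
  show *: "(psi p a - psi p b) * (a - b) > 0" if "a \<noteq> b"
    using that psi_strict_mono[OF p, of a b] psi_strict_mono[OF p, of b a]
    by (cases "a < b") (auto simp: mult_neg_neg)
  show "(psi p a - psi p b) * (a - b) \<ge> 0"
    using * by (cases "a = b") (auto intro: less_imp_le)
qed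

lemma abs_powr_has_deriv:
  assumes p: "p > 1"
  shows "((\<lambda>x. \<bar>x\<bar> powr p) has_real_derivative p * psi p x) (at x)"
proof -
  consider "x > 0" | "x < 0" | "x = 0" by linarith
  then show ?thesis
  proof cases
    case 1
    have "eventually (\<lambda>x. \<bar>x\<bar> powr p = x powr p) (nhds x)"
      using eventually_nhds_in_open[of "{0<..}" x] 1 by (auto elim!: eventually_mono)
    from DERIV_cong_ev[OF refl this refl] show ?thesis
      using has_real_derivative_powr[OF 1, of p] 1 by (simp add: psi_pos)
  next
    case 2
    have ev: "eventually (\<lambda>x. \<bar>x\<bar> powr p = (- x) powr p) (nhds x)"
      using eventually_nhds_in_open[of "{..<0}" x] 2 by (auto elim!: eventually_mono)
    have "((\<lambda>x. (- x) powr p) has_real_derivative (p * (- x) powr (p - 1)) * -1) (at x)"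
      using 2 by (intro DERIV_chain2[OF has_real_derivative_powr]) (auto intro!: derivative_eq_intros)
    moreover have "p * psi p x = (p * (- x) powr (p - 1)) * -1"
      using psi_minus[of p x] psi_pos[of "- x" p] 2 by simp
    ultimately show ?thesis
      using DERIV_cong_ev[OF refl ev refl] by simp
  next
    case 3
    have "isCont (psi p) 0"
      using continuous_on_psi[OF p, of UNIV] by (simp add: continuous_on_eq_continuous_at)
    then have "(psi p \<longlongrightarrow> 0) (at 0)"
      by (simp add: isCont_def)
    \<comment> \<open>At 0 the difference quotient of the \<open>p\<close>-th power is
      \<open>psi p\<close> itself.\<close>
    moreover have "eventually (\<lambda>h. psi p h = (\<bar>0 + h\<bar> powr p - \<bar>0\<bar> powr p) / h) (at 0)"
      using psi_times[OF p] by (auto simp: eventually_at_filter field_simps)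
    ultimately have "((\<lambda>h. (\<bar>0 + h\<bar> powr p - \<bar>0\<bar> powr p) / h) \<longlongrightarrow> 0) (at 0)"
      using tendsto_cong by fast
    then show ?thesis
      using 3 by (simp add: DERIV_def)
  qed
qed

lemma abs_powr_tangent_strict:
  fixes p a b :: real
  assumes p: "p > 1" and ab: "a \<noteq> b"
  shows "\<bar>b\<bar> powr p > \<bar>a\<bar> powr p + p * psi p a * (b - a)"
proof (cases "a < b")
  case True
  obtain z where z: "a < z" "z < b" "\<bar>b\<bar> powr p - \<bar>a\<bar> powr p = (b - a) * (p * psi p z)"
    using MVT2[OF True, of "\<lambda>x. \<bar>x\<bar> powr p"] abs_powr_has_deriv[OF p] by metis
  have "(b - a) * (p * psi p a) < (b - a) * (p * psi p z)"
    using psi_strict_mono[OF p z(1)] p True by simp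
  then show ?thesis
    using z(3) by (simp add: algebra_simps)
next
  case False
  then have "b < a" using ab by simp
  obtain z where z: "b < z" "z < a" "\<bar>a\<bar> powr p - \<bar>b\<bar> powr p = (a - b) * (p * psi p z)"
    using MVT2[OF \<open>b < a\<close>, of "\<lambda>x. \<bar>x\<bar> powr p"] abs_powr_has_deriv[OF p] by metis
  have "(a - b) * (p * psi p z) < (a - b) * (p * psi p a)"
    using psi_strict_mono[OF p z(2)] p \<open>b < a\<close> by simp
  then show ?thesis
    using z(3) by (simp add: algebra_simps)
qed

lemma abs_powr_tangent: "p > 1 \<Longrightarrow> \<bar>b :: real\<bar> powr p \<ge> \<bar>a\<bar> powr p + p * psi p a * (b - a)"
  using abs_powr_tangent_strict[of p a b] by (cases "a = b") auto

text \<open>Tangent inequalities at the intermediate point, weighted by \<open>t\<close> and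
  \<open>1 - t\<close>; the linear terms cancel.\<close>

lemma abs_powr_convex:
  fixes p a b t :: real
  assumes p: "p > 1" and t: "0 \<le> t" "t \<le> 1"
  shows "\<bar>t * a + (1 - t) * b\<bar> powr p \<le> t * \<bar>a\<bar> powr p + (1 - t) * \<bar>b\<bar> powr p"
proof -
  define m where "m = t * a + (1 - t) * b"
  have "t * (\<bar>m\<bar> powr p + p * psi p m * (a - m)) + (1 - t) * (\<bar>m\<bar> powr p + p * psi p m * (b - m))
      \<le> t * \<bar>a\<bar> powr p + (1 - t) * \<bar>b\<bar> powr p"
    using t by (intro add_mono mult_left_mono abs_powr_tangent[OF p]) auto
  moreover have "t * (\<bar>m\<bar> powr p + p * psi p m * (a - m)) + (1 - t) * (\<bar>m\<bar> powr p + p * psi p m * (b - m))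
     = \<bar>m\<bar> powr p + p * psi p m * (t * a + (1 - t) * b - m)"
    by (simp add: algebra_simps)
  ultimately show ?thesis
    by (simp add: m_def)
qed

lemma abs_powr_midpoint_strict:
  fixes p a b :: real
  assumes p: "p > 1" and ab: "a \<noteq> b"
  shows "2 * \<bar>(a + b) / 2\<bar> powr p < \<bar>a\<bar> powr p + \<bar>b\<bar> powr p"
proof -
  define m where "m = (a + b) / 2"
  have "m \<noteq> a" "m \<noteq> b" using ab by (auto simp: m_def field_simps)
  from abs_powr_tangent_strict[OF p this(1)] abs_powr_tangent_strict[OF p this(2)]
  have "2 * \<bar>m\<bar> powr p + p * psi p m * (a + b - 2 * m) < \<bar>a\<bar> powr p + \<bar>b\<bar> powr p"
    by (simp add: algebra_simps)
  moreover have "a + b - 2 * m = 0" by (simp add: m_def)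
  ultimately have "2 * \<bar>m\<bar> powr p < \<bar>a\<bar> powr p + \<bar>b\<bar> powr p" by simp
  then show ?thesis by (simp add: m_def)
qed

text \<open>A crude Young inequality: both factors are bounded by powers of the larger of the two
  numbers.\<close>

lemma abs_psi_times_le:
  assumes p: "p > 1"
  shows "\<bar>psi p a * b\<bar> \<le> \<bar>a\<bar> powr p + \<bar>b\<bar> powr p"
proof -
  define m where "m = max \<bar>a\<bar> \<bar>b\<bar>"
  have "\<bar>psi p a * b\<bar> = \<bar>a\<bar> powr (p - 1) * \<bar>b\<bar>"
    by (simp add: abs_mult abs_psi[OF p])
  also have "\<dots> \<le> m powr (p - 1) * m"
    using p by (intro mult_mono powr_mono2) (auto simp: m_def)
  also have "\<dots> = m powr p"
    using powr_add[of m "p - 1" 1] by (cases "m = 0") (auto simp: m_def)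
  also have "\<dots> \<le> \<bar>a\<bar> powr p + \<bar>b\<bar> powr p"
    by (auto simp: m_def max_def)
  finally show ?thesis .
qed

section \<open>Homogeneous functions and compactness of the sphere\<close>

lemma continuous_on_lin [continuous_intros]: "continuous_on A (lin a b c)"
  unfolding lin_def[abs_def] by (intro continuous_intros)

lemma lin_scale: "lin a b c (t *\<^sub>R x) = t * lin a b c x"
  by (simp add: lin_def algebra_simps)

lemma homogeneous_abs_powr: "p > 1 \<Longrightarrow> homogeneous p (\<lambda>x. \<bar>lin a b c x\<bar> powr p)"
  unfolding homogeneous_def
  by (auto intro!: continuous_intros continuous_on_powr' simp: lin_scale abs_mult powr_mult)

lemma homogeneous_psi_times:
  assumes p: "p > 1"
  shows "homogeneous p (\<lambda>x. psi p (lin a b c x) * lin a' b' c' x)"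
  unfolding homogeneous_def
proof (intro conjI allI impI)
  show "continuous_on UNIV (\<lambda>x. psi p (lin a b c x) * lin a' b' c' x)"
    by (intro continuous_intros continuous_on_compose2[OF continuous_on_psi[OF p, of UNIV]]) auto
  fix t :: real and x assume "t > 0"
  then show "psi p (lin a b c (t *\<^sub>R x)) * lin a' b' c' (t *\<^sub>R x) =
      t powr p * (psi p (lin a b c x) * lin a' b' c' x)"
    using powr_add[of t "p - 1" 1] by (simp add: lin_scale psi_scale)
qed

lemma homogeneous_add: "homogeneous p F \<Longrightarrow> homogeneous p G \<Longrightarrow> homogeneous p (\<lambda>x. F x + G x)"
  unfolding homogeneous_def by (auto intro!: continuous_intros simp: algebra_simps)

lemma homogeneous_diff: "homogeneous p F \<Longrightarrow> homogeneous p G \<Longrightarrow> homogeneous p (\<lambda>x. F x - G x)"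
  unfolding homogeneous_def by (auto intro!: continuous_intros simp: algebra_simps)

lemma homogeneous_cmult: "homogeneous p F \<Longrightarrow> homogeneous p (\<lambda>x. c * F x)"
  unfolding homogeneous_def by (auto intro!: continuous_intros simp: algebra_simps)

lemma homogeneous_abs: "homogeneous p F \<Longrightarrow> homogeneous p (\<lambda>x. \<bar>F x\<bar>)"
  unfolding homogeneous_def by (auto intro!: continuous_intros simp: abs_mult)

lemma homogeneous_power_sum: "p > 1 \<Longrightarrow> homogeneous p (power_sum p)"
  using homogeneous_add[OF homogeneous_add[OF homogeneous_abs_powr[of p 1 0 0]
        homogeneous_abs_powr[of p 0 1 0]] homogeneous_abs_powr[of p 0 0 1]]
  by (simp add: lin_def power_sum_def[abs_def])

lemma power_sum_pos:
  assumes "x \<noteq> 0"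
  shows "power_sum p x > 0"
proof -
  have "fst x \<noteq> 0 \<or> fst (snd x) \<noteq> 0 \<or> snd (snd x) \<noteq> 0"
    using assms by (cases x) (auto simp: zero_prod_def)
  then have "\<bar>fst x\<bar> powr p > 0 \<or> \<bar>fst (snd x)\<bar> powr p > 0 \<or> \<bar>snd (snd x)\<bar> powr p > 0"
    by simp
  moreover have "\<bar>fst x\<bar> powr p \<ge> 0" "\<bar>fst (snd x)\<bar> powr p \<ge> 0" "\<bar>snd (snd x)\<bar> powr p \<ge> 0"
    by simp_all
  ultimately show ?thesis
    unfolding power_sum_def by linarith
qed

lemma homogeneous_zero:
  assumes "homogeneous p F" "p > 1"
  shows "F 0 = 0"
proof -
  have "F (2 *\<^sub>R 0) = 2 powr p * F 0"
    using assms(1) zero_less_numeral unfolding homogeneous_def by blast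
  moreover have "2 powr p > (1::real)"
    using assms(2) by simp
  ultimately show ?thesis using assms(2) by simp
qed

text \<open>By homogeneity it suffices to consider the sphere. Where \<open>F\<close> is below
  \<open>e\<close> times the power sum the error term is enough. The remaining set \<open>K\<close>
  is compact, and \<open>G\<close> is positive on it, because a zero of \<open>G\<close> would give
  \<open>F x \<le> 0\<close>, which is less than the error term.\<close>

lemma homogeneous_le:
  assumes p: "p > 1" and F: "homogeneous p F" and G: "homogeneous p G"
    and G0: "\<And>x. G x \<ge> 0" and FG: "\<And>x. G x = 0 \<Longrightarrow> F x \<le> 0" and e: "e > 0"
  obtains C where "C \<ge> 0" "\<And>x. F x \<le> e * power_sum p x + C * G x"
proof -
  define H where "H = power_sum p"
  note H = homogeneous_power_sum[OF p, folded H_def]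
  define K where "K = {x \<in> sphere 0 1. e * H x \<le> F x}"
  have cont: "continuous_on A F" "continuous_on A G" "continuous_on A H" for A
    using F G H by (auto simp: homogeneous_def intro: continuous_on_subset)
  have "closed {x. e * H x \<le> F x}"
    by (rule closed_Collect_le[OF continuous_on_mult[OF continuous_on_const cont(3)] cont(1)])
  then have "compact (sphere 0 1 \<inter> {x. e * H x \<le> F x})"
    by (rule compact_Int_closed[OF compact_sphere])
  moreover have "sphere 0 1 \<inter> {x. e * H x \<le> F x} = K"
    by (auto simp: K_def)
  ultimately have K: "compact K"
    by simp
  have Hpos: "H x > 0" if "x \<noteq> 0" for x
    unfolding H_def using that by (rule power_sum_pos)
  have Gpos: "G x > 0" if "x \<in> K" for x
  proof -
    have "x \<noteq> 0" using that by (auto simp: K_def)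
    then have "0 < e * H x" using e Hpos by simp
    then have "F x > 0" using that by (auto simp: K_def)
    then show ?thesis using FG[of x] G0[of x] by force
  qed
  have "\<exists>C\<ge>0. \<forall>x\<in>sphere 0 1. F x \<le> e * H x + C * G x"
  proof (cases "K = {}")
    case True
    then show ?thesis
      by (intro exI[of _ 0]) (auto simp: K_def not_le intro: less_imp_le)
  next
    case False
    obtain x0 where x0: "x0 \<in> K" "\<And>x. x \<in> K \<Longrightarrow> G x0 \<le> G x"
      using continuous_attains_inf[OF K False cont(2)] by blast
    obtain x1 where x1: "x1 \<in> K" "\<And>x. x \<in> K \<Longrightarrow> F x \<le> F x1"
      using continuous_attains_sup[OF K False cont(1)] by blast
    have g: "G x0 > 0" using Gpos x0 by blast
    \<comment> \<open>The maximum of \<open>F\<close> on \<open>K\<close> over the minimum of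
      \<open>G\<close> there.\<close>
    define C where "C = \<bar>F x1\<bar> / G x0"
    have C: "C \<ge> 0" using g by (simp add: C_def)
    have "F x \<le> e * H x + C * G x" if x: "x \<in> sphere 0 1" for x
    proof (cases "x \<in> K")
      case True
      have "F x \<le> C * G x0"
        using x1(2)[OF True] g by (simp add: C_def)
      also have "\<dots> \<le> C * G x"
        using C x0(2)[OF True] by (rule mult_left_mono[rotated])
      finally show ?thesis
        using Hpos[of x] x e by (smt (verit) mult_pos_pos norm_zero mem_sphere_0)
    next
      case False
      then have "F x < e * H x"
        using x by (auto simp: K_def)
      moreover have "0 \<le> C * G x"
        using C G0 by simp
      ultimately show ?thesis by linarith
    qed
    then show ?thesis using C by blast
  qed
  then obtain C where C: "C \<ge> 0" "\<And>x. x \<in> sphere 0 1 \<Longrightarrow> F x \<le> e * H x + C * G x"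
    by blast
  have "F x \<le> e * H x + C * G x" for x
  proof (cases "x = 0")
    case True
    then show ?thesis using homogeneous_zero[OF F] homogeneous_zero[OF G] homogeneous_zero[OF H] p by simp
  next
    case False
    define t where "t = norm x"
    define y where "y = inverse t *\<^sub>R x"
    have t: "t > 0" and y: "y \<in> sphere 0 1" and x: "x = t *\<^sub>R y"
      using False by (auto simp: t_def y_def)
    have "F x = t powr p * F y" "G x = t powr p * G y" "H x = t powr p * H y"
      using F G H t unfolding x homogeneous_def by blast+
    moreover have "t powr p * F y \<le> t powr p * (e * H y + C * G y)"
      using C(2)[OF y] by (intro mult_left_mono) auto
    ultimately show ?thesis by (simp add: algebra_simps)
  qed
  then show thesis
    using C(1) that unfolding H_def by blast
qed

text \<open>This domination makes every homogeneous integrand integrable as soon as the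
  \<open>p\<close>-th powers are.\<close>

lemma homogeneous_bound:
  assumes p: "p > 1" and F: "homogeneous p F"
  obtains C where "\<And>x. \<bar>F x\<bar> \<le> C * power_sum p x"
proof (rule homogeneous_le[OF p homogeneous_abs[OF F] homogeneous_power_sum[OF p], of 1])
  show "0 \<le> power_sum p x" for x
    by (simp add: power_sum_def)
  show "\<bar>F x\<bar> \<le> 0" if "power_sum p x = 0" for x
    using that power_sum_pos[of x p] homogeneous_zero[OF F p] by (cases "x = 0") auto
  show thesis if "\<And>x. \<bar>F x\<bar> \<le> 1 * power_sum p x + C * power_sum p x" for C
    using \<open>\<And>C. (\<And>x. \<bar>F x\<bar> \<le> C * power_sum p x) \<Longrightarrow> thesis\<close>[of "1 + C"] that
    by (simp add: distrib_right)
qed simp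

section \<open>Pointwise inequalities with an error term\<close>

lemma psi_diff_coercive:
  assumes p: "p > 1" and e: "e > 0"
  obtains C where "C \<ge> 0" "\<And>x. \<bar>lin 1 (-1) 0 x\<bar> powr p \<le> e * power_sum p x +
    C * (psi p (lin 1 0 0 x) * lin 1 (-1) 0 x - psi p (lin 0 1 0 x) * lin 1 (-1) 0 x)"
proof -
  let ?F = "\<lambda>x. \<bar>lin 1 (-1) 0 x\<bar> powr p"
  let ?G = "\<lambda>x. psi p (lin 1 0 0 x) * lin 1 (-1) 0 x - psi p (lin 0 1 0 x) * lin 1 (-1) 0 x"
  have G: "?G x = (psi p (fst x) - psi p (fst (snd x))) * (fst x - fst (snd x))" for x
    by (simp add: lin_def algebra_simps)
  show thesis
  proof (rule homogeneous_le[of p ?F ?G e])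
    show "0 \<le> ?G x" for x
      unfolding G by (rule psi_monotone[OF p])
    show "?F x \<le> 0" if "?G x = 0" for x
      using that psi_monotone(2)[OF p, of "fst x" "fst (snd x)"] unfolding G by (force simp: lin_def)
  qed (use that p e in \<open>auto intro!: homogeneous_abs_powr homogeneous_diff homogeneous_psi_times\<close>)
qed

text \<open>Coercivity. For second component 0 the form difference equals the \<open>p\<close>-th
  power of the first, so the left side minus it vanishes where the last term does. The factor 1/2 is
  below 1, so that the first power on the right can be absorbed on the left.\<close>

lemma abs_powr_le_psi_diff:
  assumes p: "p > 1"
  obtains C where "C \<ge> 0" "\<And>x. \<bar>lin 1 0 0 x\<bar> powr p \<le> 1/2 * power_sum p x +
    (psi p (lin 1 0 0 x) * lin 1 (-1) 0 x - psi p (lin 0 1 0 x) * lin 1 (-1) 0 x) +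
    C * \<bar>lin 0 1 0 x\<bar> powr p"
proof -
  define D where "D x = psi p (lin 1 0 0 x) * lin 1 (-1) 0 x - psi p (lin 0 1 0 x) * lin 1 (-1) 0 x" for x
  have D: "homogeneous p D"
    unfolding D_def[abs_def] by (intro homogeneous_diff homogeneous_psi_times p)
  obtain C where "C \<ge> 0" "\<And>x. \<bar>lin 1 0 0 x\<bar> powr p - D x \<le> 1/2 * power_sum p x + C * \<bar>lin 0 1 0 x\<bar> powr p"
  proof (rule homogeneous_le[OF p homogeneous_diff[OF homogeneous_abs_powr[OF p] D]
      homogeneous_abs_powr[OF p], of 0 1 0 1 0 0 "1/2"])
    fix x :: "real \<times> real \<times> real"
    assume "\<bar>lin 0 1 0 x\<bar> powr p = 0"
    then show "\<bar>lin 1 0 0 x\<bar> powr p - D x \<le> 0"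
      using psi_times[OF p, of "fst x"] by (simp add: D_def lin_def)
  qed auto
  then show thesis
    using that[of C] unfolding D_def by (simp add: algebra_simps)
qed

text \<open>The source of continuity of \<open>L\<close>: the third component is the direction in
  which the functionals are tested, and the left side vanishes where the first two components
  agree.\<close>

lemma psi_diff_le:
  assumes p: "p > 1" and e: "e > 0"
  obtains C where "C \<ge> 0" "\<And>x. \<bar>psi p (lin 1 0 0 x) * lin 0 0 1 x - psi p (lin 0 1 0 x) * lin 0 0 1 x\<bar>
    \<le> e * power_sum p x + C * \<bar>lin 1 (-1) 0 x\<bar> powr p"
proof -
  let ?F = "\<lambda>x. \<bar>psi p (lin 1 0 0 x) * lin 0 0 1 x - psi p (lin 0 1 0 x) * lin 0 0 1 x\<bar>"
  let ?G = "\<lambda>x. \<bar>lin 1 (-1) 0 x\<bar> powr p"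
  show thesis
  proof (rule homogeneous_le[of p ?F ?G e])
    show "?F x \<le> 0" if "?G x = 0" for x
      using that by (simp add: lin_def)
  qed (use that p e in \<open>auto intro!: homogeneous_abs homogeneous_abs_powr homogeneous_diff homogeneous_psi_times\<close>)
qed

text \<open>The bracket is the midpoint convexity defect, which is zero only for equal components.
  This takes the place of Clarkson's inequalities and treats \<open>p\<close> below and above 2
  alike.\<close>

lemma abs_powr_uniformly_convex:
  assumes p: "p > 1" and e: "e > 0"
  obtains C where "C \<ge> 0" "\<And>x. \<bar>lin 1 (-1) 0 x\<bar> powr p \<le> e * power_sum p x +
    C * (\<bar>lin 1 0 0 x\<bar> powr p + \<bar>lin 0 1 0 x\<bar> powr p - 2 * \<bar>lin (1/2) (1/2) 0 x\<bar> powr p)"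
proof -
  let ?F = "\<lambda>x. \<bar>lin 1 (-1) 0 x\<bar> powr p"
  let ?G = "\<lambda>x. \<bar>lin 1 0 0 x\<bar> powr p + \<bar>lin 0 1 0 x\<bar> powr p - 2 * \<bar>lin (1/2) (1/2) 0 x\<bar> powr p"
  have G: "?G x = \<bar>fst x\<bar> powr p + \<bar>fst (snd x)\<bar> powr p - 2 * \<bar>(fst x + fst (snd x)) / 2\<bar> powr p" for x
    by (simp add: lin_def add_divide_distrib)
  show thesis
  proof (rule homogeneous_le[of p ?F ?G e])
    show "0 \<le> ?G x" for x
      unfolding G using abs_powr_midpoint_strict[OF p, of "fst x" "fst (snd x)"]
      by (cases "fst x = fst (snd x)") auto
    show "?F x \<le> 0" if "?G x = 0" for x
      using that abs_powr_midpoint_strict[OF p, of "fst x" "fst (snd x)"] unfolding G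
      by (force simp: lin_def)
  qed (use that p e in \<open>auto intro!: homogeneous_abs_powr homogeneous_diff homogeneous_add homogeneous_cmult\<close>)
qed

section \<open>Completeness of \<open>L\<^sup>p\<close>\<close>

text \<open>The sum is twice the midpoint; the weights 1/2 given by convexity are simply
  dropped.\<close>

lemma abs_powr_add_le:
  fixes a b p :: real
  assumes p: "p > 1"
  shows "\<bar>a + b\<bar> powr p \<le> 2 powr p * (\<bar>a\<bar> powr p + \<bar>b\<bar> powr p)"
proof -
  have "a + b = 2 * (1/2 * a + (1 - 1/2) * b)" by simp
  then have "\<bar>a + b\<bar> = 2 * \<bar>1/2 * a + (1 - 1/2) * b\<bar>"
    by (simp only: abs_mult abs_numeral)
  then have "\<bar>a + b\<bar> powr p = 2 powr p * \<bar>1/2 * a + (1 - 1/2) * b\<bar> powr p"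
    by (simp only: powr_mult)
  also have "\<dots> \<le> 2 powr p * (1/2 * \<bar>a\<bar> powr p + (1 - 1/2) * \<bar>b\<bar> powr p)"
    by (intro mult_left_mono abs_powr_convex[OF p]) auto
  also have "\<dots> \<le> 2 powr p * (\<bar>a\<bar> powr p + \<bar>b\<bar> powr p)"
    by (intro mult_left_mono add_mono mult_left_le_one_le) auto
  finally show ?thesis .
qed

lemma integrable_abs_powr_add:
  fixes f g :: "'a \<Rightarrow> real"
  assumes p: "p > 1" and [measurable]: "f \<in> borel_measurable M" "g \<in> borel_measurable M"
    and i: "integrable M (\<lambda>x. \<bar>f x\<bar> powr p)" "integrable M (\<lambda>x. \<bar>g x\<bar> powr p)"
  shows "integrable M (\<lambda>x. \<bar>f x + g x\<bar> powr p)"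
proof (rule Bochner_Integration.integrable_bound)
  show "integrable M (\<lambda>x. 2 powr p * (\<bar>f x\<bar> powr p + \<bar>g x\<bar> powr p))"
    using i by simp
qed (use abs_powr_add_le[OF p] in auto)

lemma integrable_abs_powr_diff:
  fixes f g :: "'a \<Rightarrow> real"
  assumes p: "p > 1" and "f \<in> borel_measurable M" "g \<in> borel_measurable M"
    and i: "integrable M (\<lambda>x. \<bar>f x\<bar> powr p)" "integrable M (\<lambda>x. \<bar>g x\<bar> powr p)"
  shows "integrable M (\<lambda>x. \<bar>f x - g x\<bar> powr p)"
  using integrable_abs_powr_add[of p f M "\<lambda>x. - g x"] assms by simp

text \<open>Takes the place of Hoelder's inequality on a finite measure space: above the level
  \<open>\<delta>\<close> the decreasing power \<open>1 - p\<close> of \<open>\<bar>h\<bar>\<close>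
  is at most that of \<open>\<delta>\<close>. The level is chosen later to balance the two
  terms.\<close>

lemma abs_le_abs_powr:
  fixes h \<delta> p :: real
  assumes p: "p > 1" and d: "\<delta> > 0"
  shows "\<bar>h\<bar> \<le> \<delta> + \<delta> powr (1 - p) * \<bar>h\<bar> powr p"
proof (cases "\<bar>h\<bar> \<le> \<delta>")
  case True
  then show ?thesis by (simp add: add_increasing2)
next
  case False
  then have "\<bar>h\<bar> powr (1 - p) \<le> \<delta> powr (1 - p)"
    using p d by (intro powr_mono2') auto
  then have "\<bar>h\<bar> powr (1 - p) * \<bar>h\<bar> powr p \<le> \<delta> powr (1 - p) * \<bar>h\<bar> powr p"
    by (intro mult_right_mono) auto
  moreover have "\<bar>h\<bar> powr (1 - p) * \<bar>h\<bar> powr p = \<bar>h\<bar>"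
    using False d by (subst powr_add[symmetric]) auto
  ultimately show ?thesis using d by linarith
qed

lemma (in finite_measure) integrable_of_abs_powr:
  fixes h :: "'a \<Rightarrow> real"
  assumes p: "p > 1" and [measurable]: "h \<in> borel_measurable M"
    and i: "integrable M (\<lambda>x. \<bar>h x\<bar> powr p)"
  shows "integrable M h"
proof (rule Bochner_Integration.integrable_bound)
  show "integrable M (\<lambda>x. 1 + 1 powr (1 - p) * \<bar>h x\<bar> powr p)"
    using i by simp
  show "AE x in M. norm (h x) \<le> norm (1 + 1 powr (1 - p) * \<bar>h x\<bar> powr p)"
  proof (rule AE_I2)
    fix x show "norm (h x) \<le> norm (1 + 1 powr (1 - p) * \<bar>h x\<bar> powr p)"
      using abs_le_abs_powr[OF p zero_less_one, of "h x"] by simp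
  qed
qed simp

lemma (in finite_measure) integral_abs_le_abs_powr:
  fixes h :: "'a \<Rightarrow> real"
  assumes p: "p > 1" and d: "\<delta> > 0" and [measurable]: "h \<in> borel_measurable M"
    and i: "integrable M (\<lambda>x. \<bar>h x\<bar> powr p)"
  shows "(LINT x|M. \<bar>h x\<bar>) \<le> \<delta> * measure M (space M) + \<delta> powr (1 - p) * (LINT x|M. \<bar>h x\<bar> powr p)"
proof -
  have "(LINT x|M. \<bar>h x\<bar>) \<le> (LINT x|M. \<delta> + \<delta> powr (1 - p) * \<bar>h x\<bar> powr p)"
    using i integrable_of_abs_powr[OF p _ i] by (intro integral_mono abs_le_abs_powr p d) auto
  also have "\<dots> = \<delta> * measure M (space M) + \<delta> powr (1 - p) * (LINT x|M. \<bar>h x\<bar> powr p)"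
    using i by simp
  finally show ?thesis .
qed

text \<open>Riesz-Fischer: a subsequence with summable increments converges almost everywhere, and
  Fatou's lemma transfers the Cauchy estimate to the limit.\<close>

lemma (in finite_measure) Lp_complete:
  fixes f :: "nat \<Rightarrow> 'a \<Rightarrow> real"
  assumes p: "p > 1" and fm [measurable]: "\<And>n. f n \<in> borel_measurable M"
    and fi: "\<And>n. integrable M (\<lambda>x. \<bar>f n x\<bar> powr p)"
    and cauchy: "\<And>e. e > 0 \<Longrightarrow> \<exists>K. \<forall>m\<ge>K. \<forall>n\<ge>K. (LINT x|M. \<bar>f m x - f n x\<bar> powr p) < e"
  obtains g where "g \<in> borel_measurable M" "integrable M (\<lambda>x. \<bar>g x\<bar> powr p)"
    "(\<lambda>n. LINT x|M. \<bar>f n x - g x\<bar> powr p) \<longlonglongrightarrow> 0"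
proof -
  have di: "integrable M (\<lambda>x. \<bar>f m x - f n x\<bar> powr p)" for m n
    by (intro integrable_abs_powr_diff p fm fi)
  define \<delta> :: "nat \<Rightarrow> real" where "\<delta> k = (1/2) ^ k" for k
  have \<delta>: "\<delta> k > 0" for k by (simp add: \<delta>_def)
  have "\<exists>K. \<forall>m\<ge>K. \<forall>n\<ge>K. (LINT x|M. \<bar>f m x - f n x\<bar> powr p) < \<delta> k powr p" for k
    using \<delta>[of k] by (intro cauchy) simp
  then obtain K where K: "\<And>k m n. m \<ge> K k \<Longrightarrow> n \<ge> K k \<Longrightarrow> (LINT x|M. \<bar>f m x - f n x\<bar> powr p) < \<delta> k powr p"
    by metis
  \<comment> \<open>The partial sum is monotone in \<open>k\<close> and dominates every
    \<open>K j\<close> with \<open>j \<le> k\<close>, which is all that the subsequence has to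
    satisfy.\<close>
  define r where "r k = (\<Sum>j\<le>k. K j)" for k
  have rK: "K j \<le> r k" if "j \<le> k" for j k
    unfolding r_def using that by (intro member_le_sum) auto
  define h where "h k x = f (r (Suc k)) x - f (r k) x" for k x
  have hm [measurable]: "h k \<in> borel_measurable M" for k
    unfolding h_def by measurable
  have hi: "integrable M (\<lambda>x. \<bar>h k x\<bar> powr p)" for k
    unfolding h_def by (rule di)
  define c where "c = measure M (space M) + 1"
  \<comment> \<open>Here \<open>\<delta> k\<close> is both the truncation level and, through its
    \<open>p\<close>-th power, the bound on the increment; the powers \<open>1 - p\<close> and
    \<open>p\<close> multiply to \<open>\<delta> k\<close>, which is summable.\<close>
  have hb: "(LINT x|M. \<bar>h k x\<bar>) \<le> c * \<delta> k" for k
  proof -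
    have "(LINT x|M. \<bar>h k x\<bar>) \<le> \<delta> k * measure M (space M) + \<delta> k powr (1 - p) * (LINT x|M. \<bar>h k x\<bar> powr p)"
      by (intro integral_abs_le_abs_powr p \<delta> hm hi)
    also have "\<dots> \<le> \<delta> k * measure M (space M) + \<delta> k powr (1 - p) * \<delta> k powr p"
      unfolding h_def by (intro add_left_mono mult_left_mono less_imp_le[OF K] rK) auto
    also have "\<delta> k powr (1 - p) * \<delta> k powr p = \<delta> k"
      using \<delta>[of k] by (subst powr_add[symmetric]) auto
    finally show ?thesis by (simp add: c_def algebra_simps)
  qed
  have "(\<integral>\<^sup>+x. (\<Sum>k. ennreal \<bar>h k x\<bar>) \<partial>M) = (\<Sum>k. \<integral>\<^sup>+x. ennreal \<bar>h k x\<bar> \<partial>M)"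
    by (rule nn_integral_suminf) auto
  also have "\<dots> = (\<Sum>k. ennreal (LINT x|M. \<bar>h k x\<bar>))"
    using integrable_of_abs_powr[OF p hm hi] by (subst nn_integral_eq_integral) auto
  also have "\<dots> \<le> (\<Sum>k. ennreal (c * \<delta> k))"
    by (intro suminf_le ennreal_leI hb) auto
  also have "\<dots> < top"
  proof -
    have "summable (\<lambda>k. c * \<delta> k)"
      unfolding \<delta>_def by (intro summable_mult summable_geometric) auto
    moreover have "0 \<le> c * \<delta> k" for k
      using \<delta>[of k] by (simp add: c_def)
    ultimately show ?thesis
      unfolding less_top[symmetric] by (intro ennreal_suminf_neq_top)
  qed
  finally have "AE x in M. (\<Sum>k. ennreal \<bar>h k x\<bar>) \<noteq> \<infinity>"
    by (intro nn_integral_PInf_AE) auto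
  then have conv: "AE x in M. convergent (\<lambda>k. f (r k) x)"
  proof eventually_elim
    case (elim x)
    then have "summable (\<lambda>k. \<bar>h k x\<bar>)"
      by (intro summable_suminf_not_top) auto
    then have "summable (\<lambda>k. h k x)"
      by (rule summable_rabs_cancel)
    then have "(\<lambda>n. \<Sum>k<n. h k x) \<longlonglongrightarrow> (\<Sum>k. h k x)"
      by (rule summable_LIMSEQ)
    moreover have "(\<Sum>k<n. h k x) = f (r n) x - f (r 0) x" for n
      unfolding h_def by (rule sum_lessThan_telescope)
    ultimately have "(\<lambda>n. f (r n) x - f (r 0) x + f (r 0) x) \<longlonglongrightarrow> (\<Sum>k. h k x) + f (r 0) x"
      by (intro tendsto_add) auto
    then show ?case by (auto simp: convergent_def)
  qed
  \<comment> \<open>Where the subsequence diverges, \<open>lim\<close> takes some default value;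
    measurability holds regardless, and the exceptional set is null.\<close>
  define g where "g x = lim (\<lambda>k. f (r k) x)" for x
  have gm [measurable]: "g \<in> borel_measurable M"
    unfolding g_def by measurable
  have glim: "AE x in M. (\<lambda>k. f (r k) x) \<longlonglongrightarrow> g x"
    using conv by eventually_elim (simp add: g_def convergent_LIMSEQ_iff)
  \<comment> \<open>Fatou's lemma along the subsequence, with \<open>n\<close> fixed: from index
    \<open>j\<close> on, both indices exceed \<open>K j\<close>.\<close>
  have fat: "(\<integral>\<^sup>+x. ennreal (\<bar>f n x - g x\<bar> powr p) \<partial>M) \<le> ennreal (\<delta> j powr p)" if n: "n \<ge> K j" for n j
  proof -
    have "AE x in M. liminf (\<lambda>k. ennreal (\<bar>f n x - f (r k) x\<bar> powr p)) = ennreal (\<bar>f n x - g x\<bar> powr p)"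
      using glim
    proof eventually_elim
      case (elim x)
      have "(\<lambda>k. \<bar>f n x - f (r k) x\<bar> powr p) \<longlonglongrightarrow> \<bar>f n x - g x\<bar> powr p"
        using p elim by (intro tendsto_powr' tendsto_intros) auto
      then have "(\<lambda>k. ennreal (\<bar>f n x - f (r k) x\<bar> powr p)) \<longlonglongrightarrow> ennreal (\<bar>f n x - g x\<bar> powr p)"
        by (rule tendsto_ennrealI)
      then show ?case
        by (rule lim_imp_Liminf[OF sequentially_bot])
    qed
    then have "(\<integral>\<^sup>+x. ennreal (\<bar>f n x - g x\<bar> powr p) \<partial>M) =
       (\<integral>\<^sup>+x. liminf (\<lambda>k. ennreal (\<bar>f n x - f (r k) x\<bar> powr p)) \<partial>M)"
      by (intro nn_integral_cong_AE) auto
    also have "\<dots> \<le> liminf (\<lambda>k. \<integral>\<^sup>+x. ennreal (\<bar>f n x - f (r k) x\<bar> powr p) \<partial>M)"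
      by (rule nn_integral_liminf) measurable
    also have "\<dots> \<le> ennreal (\<delta> j powr p)"
    proof (rule Liminf_le)
      show "\<forall>\<^sub>F k in sequentially. (\<integral>\<^sup>+x. ennreal (\<bar>f n x - f (r k) x\<bar> powr p) \<partial>M) \<le> ennreal (\<delta> j powr p)"
        using eventually_ge_at_top[of j]
      proof eventually_elim
        case (elim k)
        have "(\<integral>\<^sup>+x. ennreal (\<bar>f n x - f (r k) x\<bar> powr p) \<partial>M) = ennreal (LINT x|M. \<bar>f n x - f (r k) x\<bar> powr p)"
          by (rule nn_integral_eq_integral[OF di]) auto
        also have "\<dots> \<le> ennreal (\<delta> j powr p)"
          by (intro ennreal_leI less_imp_le[OF K] n rK elim)
        finally show ?case .
      qed
    qed simp
    finally show ?thesis .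
  qed
  have gi: "integrable M (\<lambda>x. \<bar>f n x - g x\<bar> powr p)" and gb: "(LINT x|M. \<bar>f n x - g x\<bar> powr p) \<le> \<delta> j powr p"
    if n: "n \<ge> K j" for n j
  proof -
    show i: "integrable M (\<lambda>x. \<bar>f n x - g x\<bar> powr p)"
    proof (rule integrableI_nonneg)
      show "(\<integral>\<^sup>+x. ennreal (\<bar>f n x - g x\<bar> powr p) \<partial>M) < \<infinity>"
        using order.strict_trans1[OF fat[OF n] ennreal_less_top] by simp
    qed auto
    have "ennreal (LINT x|M. \<bar>f n x - g x\<bar> powr p) \<le> ennreal (\<delta> j powr p)"
      using nn_integral_eq_integral[OF i] fat[OF n] by simp
    then show "(LINT x|M. \<bar>f n x - g x\<bar> powr p) \<le> \<delta> j powr p"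
      by (simp add: ennreal_le_iff)
  qed
  \<comment> \<open>The limit is \<open>f (K 0)\<close> minus their difference, and both have
    integrable \<open>p\<close>-th powers.\<close>
  have "integrable M (\<lambda>x. \<bar>f (K 0) x - (f (K 0) x - g x)\<bar> powr p)"
    by (intro integrable_abs_powr_diff p fi gi[of 0]) auto
  then have "integrable M (\<lambda>x. \<bar>g x\<bar> powr p)" by simp
  moreover have "(\<lambda>n. LINT x|M. \<bar>f n x - g x\<bar> powr p) \<longlonglongrightarrow> 0"
  proof (rule LIMSEQ_I)
    fix e :: real assume "e > 0"
    then obtain j where j: "\<delta> j < e"
      using real_arch_pow_inv[of e "1/2"] by (auto simp: \<delta>_def)
    have "\<delta> j powr p \<le> \<delta> j powr 1"
      using p \<delta>[of j] by (intro powr_mono') (auto simp: \<delta>_def power_le_one)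
    then have "\<delta> j powr p < e"
      using j \<delta>[of j] by simp
    then have "\<forall>n\<ge>K j. norm ((LINT x|M. \<bar>f n x - g x\<bar> powr p) - 0) < e"
      using gb[of j] by fastforce
    then show "\<exists>no. \<forall>n\<ge>no. norm ((LINT x|M. \<bar>f n x - g x\<bar> powr p) - 0) < e"
      by blast
  qed
  ultimately show thesis
    using that gm by blast
qed

section \<open>The energy and its form\<close>

locale periodic_sobolev =
  fixes T p :: real and q :: "real \<Rightarrow> real"
  assumes T_pos: "T > 0" and p_gt_1: "p > 1" and q_cont: "continuous_on {0..T} q"
    and q_nonneg: "\<And>x. x \<in> {0..T} \<Longrightarrow> q x \<ge> 0" and q_nonzero: "\<exists>x\<in>{0..T}. q x \<noteq> 0"
begin

abbreviation X :: "(real \<Rightarrow> real) set" where "X \<equiv> W1p_periodic T p"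
abbreviation N :: "(real \<Rightarrow> real) \<Rightarrow> real" where "N \<equiv> W1p_norm T p q"
abbreviation \<mu> :: "real measure" where "\<mu> \<equiv> interval_measure T"
abbreviation D :: "(real \<Rightarrow> real) \<Rightarrow> real \<Rightarrow> real" where "D \<equiv> weak_deriv T"

sublocale finite_measure \<mu>
  by (rule finite_interval_measure)

lemma Lp_iff: "u \<in> Lp T p \<longleftrightarrow> u \<in> borel_measurable \<mu> \<and> integrable \<mu> (\<lambda>x. \<bar>u x\<bar> powr p)"
  by (simp add: Lp_def set_borel_measurable_interval_measure set_integrable_interval_measure)

lemma Lp_lincomb:
  assumes "u \<in> Lp T p" "v \<in> Lp T p"
  shows "(\<lambda>x. a * u x + b * v x) \<in> Lp T p"
  unfolding Lp_iff
proof
  have [measurable]: "u \<in> borel_measurable \<mu>" "v \<in> borel_measurable \<mu>"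
    using assms by (auto simp: Lp_iff)
  show "(\<lambda>x. a * u x + b * v x) \<in> borel_measurable \<mu>"
    by measurable
  show "integrable \<mu> (\<lambda>x. \<bar>a * u x + b * v x\<bar> powr p)"
    by (rule integrable_abs_powr_add[OF p_gt_1])
      (use assms in \<open>auto simp: Lp_iff abs_mult powr_mult\<close>)
qed

lemma locally_integrable_of_Lp:
  assumes "u \<in> Lp T p"
  shows "locally_integrable T u"
proof -
  have "integrable \<mu> u"
    by (rule integrable_of_abs_powr[OF p_gt_1]) (use assms in \<open>auto simp: Lp_iff\<close>)
  then have i: "set_integrable lebesgue {0<..<T} u"
    by (simp add: set_integrable_interval_measure)
  show ?thesis
    unfolding locally_integrable_def
    by (intro allI impI set_integrable_subset[OF i]) (auto simp: compact_imp_closed)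
qed

text \<open>The chosen representative \<open>D u\<close> may differ from the weak derivative that
  the membership in \<open>W1p\<close> provides; uniqueness almost everywhere transfers the
  integrability.\<close>

lemma W1p_weak_deriv:
  assumes "u \<in> W1p T p"
  shows "has_weak_deriv T u (D u)" and "D u \<in> Lp T p"
proof -
  obtain g where g: "g \<in> Lp T p" "has_weak_deriv T u g"
    using assms by (auto simp: W1p_def)
  show w: "has_weak_deriv T u (D u)"
    unfolding weak_deriv_def by (rule someI[of _ g]) (rule g)
  have m [measurable]: "D u \<in> borel_measurable \<mu>" "g \<in> borel_measurable \<mu>"
    using w g T_pos by (auto simp: has_weak_deriv_def Lp_iff intro: locally_integrable_measurable)
  have "AE x in \<mu>. D u x = g x"
    by (rule weak_deriv_unique[OF T_pos w g(2)])
  then have "integrable \<mu> (\<lambda>x. \<bar>D u x\<bar> powr p)"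
    using g(1) by (subst integrable_cong_AE[of _ _ "\<lambda>x. \<bar>g x\<bar> powr p"]) (auto simp: Lp_iff)
  then show "D u \<in> Lp T p"
    using m by (simp add: Lp_iff)
qed

lemma weak_deriv_AE_eq:
  assumes "has_weak_deriv T u g"
  shows "AE x in \<mu>. D u x = g x"
proof -
  have "has_weak_deriv T u (D u)"
    unfolding weak_deriv_def by (rule someI[of _ g]) (rule assms)
  then show ?thesis
    by (rule weak_deriv_unique[OF T_pos _ assms])
qed

lemma X_D:
  assumes "u \<in> X"
  shows "has_weak_deriv T u (D u)" "D u \<in> Lp T p" "u \<in> Lp T p" "continuous_on {0..T} u"
    "\<And>x. x \<notin> {0..T} \<Longrightarrow> u x = 0" "u 0 = u T"
  using assms W1p_weak_deriv[of u] by (auto simp: W1p_periodic_def W1p_def)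

lemma X_I:
  assumes "u \<in> Lp T p" "has_weak_deriv T u g" "g \<in> Lp T p" "continuous_on {0..T} u"
    "\<And>x. x \<notin> {0..T} \<Longrightarrow> u x = 0" "u 0 = u T"
  shows "u \<in> X"
  using assms unfolding W1p_periodic_def W1p_def by blast

lemma X_lincomb:
  assumes u: "u \<in> X" and v: "v \<in> X"
  shows "(\<lambda>x. a * u x + b * v x) \<in> X"
proof (rule X_I)
  show "has_weak_deriv T (\<lambda>x. a * u x + b * v x) (\<lambda>x. a * D u x + b * D v x)"
    by (intro has_weak_deriv_lincomb X_D u v)
  show "(\<lambda>x. a * u x + b * v x) \<in> Lp T p" "(\<lambda>x. a * D u x + b * D v x) \<in> Lp T p"
    by (intro Lp_lincomb X_D u v)+
  show "continuous_on {0..T} (\<lambda>x. a * u x + b * v x)"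
    by (intro continuous_intros X_D u v)
qed (use X_D[OF u] X_D[OF v] in auto)

lemma deriv_lincomb:
  assumes u: "u \<in> X" and v: "v \<in> X"
  shows "AE x in \<mu>. D (\<lambda>x. a * u x + b * v x) x = a * D u x + b * D v x"
  by (intro weak_deriv_AE_eq has_weak_deriv_lincomb X_D u v)

lemma deriv_lincomb3:
  assumes u: "u \<in> X" and v: "v \<in> X" and w: "w \<in> X"
  shows "AE x in \<mu>. D (\<lambda>x. a * u x + b * v x + c * w x) x = a * D u x + b * D v x + c * D w x"
  using deriv_lincomb[OF X_lincomb[OF u v, of a b] w, of 1 c] deriv_lincomb[OF u v, of a b]
  by eventually_elim simp

lemma X_lincomb3: "u \<in> X \<Longrightarrow> v \<in> X \<Longrightarrow> w \<in> X \<Longrightarrow> (\<lambda>x. a * u x + b * v x + c * w x) \<in> X"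
  using X_lincomb[OF X_lincomb[of u v a b], of w 1 c] by simp

lemma X_zero: "(\<lambda>_. 0) \<in> X"
  by (rule X_I[of _ "\<lambda>_. 0"])
    (use p_gt_1 in \<open>auto simp: Lp_iff has_weak_deriv_def locally_integrable_def set_integrable_def\<close>)

lemma X_measurable:
  assumes "u \<in> X"
  shows "u \<in> borel_measurable \<mu>" "D u \<in> borel_measurable \<mu>"
    "integrable \<mu> (\<lambda>x. \<bar>u x\<bar> powr p)" "integrable \<mu> (\<lambda>x. \<bar>D u x\<bar> powr p)"
  using X_D[OF assms] by (auto simp: Lp_iff)

lemma q_measurable [measurable]: "q \<in> borel_measurable \<mu>"
proof -
  have "(\<lambda>x. indicator {0<..<T} x *\<^sub>R q x) \<in> borel_measurable borel"
    by (intro borel_measurable_continuous_on_indicator continuous_on_subset[OF q_cont]) auto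
  then have "(\<lambda>x. indicator {0<..<T} x *\<^sub>R q x) \<in> borel_measurable lebesgue"
    by (intro measurable_completion) simp
  then show ?thesis
    unfolding interval_measure_def by (subst borel_measurable_restrict_space_iff) auto
qed

lemma q_bounded:
  obtains Q where "Q \<ge> 0" "\<And>x. x \<in> {0<..<T} \<Longrightarrow> \<bar>q x\<bar> \<le> Q"
proof -
  have "bounded (q ` {0..T})"
    by (intro compact_imp_bounded compact_continuous_image q_cont) simp
  then obtain Q where Q: "\<And>x. x \<in> {0..T} \<Longrightarrow> \<bar>q x\<bar> \<le> Q"
    unfolding bounded_iff real_norm_def by (metis imageI)
  have "Q \<ge> 0" using Q[of 0] T_pos by force
  then show thesis
    using that Q by force
qed

lemma integrable_q_mult:
  assumes i: "integrable \<mu> h"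
  shows "integrable \<mu> (\<lambda>x. q x * h x)"
proof -
  obtain Q where Q: "Q \<ge> 0" "\<And>x. x \<in> {0<..<T} \<Longrightarrow> \<bar>q x\<bar> \<le> Q"
    using q_bounded by blast
  show ?thesis
  proof (rule Bochner_Integration.integrable_bound)
    show "integrable \<mu> (\<lambda>x. Q * \<bar>h x\<bar>)"
      using i by (intro integrable_mult_right integrable_abs)
    show "(\<lambda>x. q x * h x) \<in> borel_measurable \<mu>"
      using i by (intro borel_measurable_times q_measurable borel_measurable_integrable)
    show "AE x in \<mu>. norm (q x * h x) \<le> norm (Q * \<bar>h x\<bar>)"
      using Q by (intro AE_I2) (auto simp: abs_mult intro!: mult_right_mono)
  qed
qed

text \<open>Puts one function \<open>F\<close> on the derivatives with weight 1 and on the values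
  with weight \<open>q\<close>. Since \<open>q\<close> is nonnegative, a pointwise inequality
  between two such functions integrates to one between functionals.\<close>

definition functional :: "(real \<times> real \<times> real \<Rightarrow> real) \<Rightarrow> (real \<Rightarrow> real) \<Rightarrow> (real \<Rightarrow> real) \<Rightarrow> (real \<Rightarrow> real) \<Rightarrow> real" where
  "functional F u v w = (LINT x|\<mu>. F (D u x, D v x, D w x) + q x * F (u x, v x, w x))"

lemma homogeneous_compose_measurable:
  assumes F: "homogeneous p F" and [measurable]: "f \<in> borel_measurable \<mu>" "g \<in> borel_measurable \<mu>" "h \<in> borel_measurable \<mu>"
  shows "(\<lambda>x. F (f x, g x, h x)) \<in> borel_measurable \<mu>"
proof -
  have [measurable]: "F \<in> borel_measurable borel"
    using F by (intro borel_measurable_continuous_onI) (simp add: homogeneous_def)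
  show ?thesis by measurable
qed

lemma homogeneous_compose_integrable:
  assumes F: "homogeneous p F" and m: "f \<in> borel_measurable \<mu>" "g \<in> borel_measurable \<mu>" "h \<in> borel_measurable \<mu>"
    and i: "integrable \<mu> (\<lambda>x. \<bar>f x\<bar> powr p)" "integrable \<mu> (\<lambda>x. \<bar>g x\<bar> powr p)" "integrable \<mu> (\<lambda>x. \<bar>h x\<bar> powr p)"
  shows "integrable \<mu> (\<lambda>x. F (f x, g x, h x))"
proof -
  obtain C where C: "\<And>x. \<bar>F x\<bar> \<le> C * power_sum p x"
    using homogeneous_bound[OF p_gt_1 F] by blast
  show ?thesis
  proof (rule Bochner_Integration.integrable_bound)
    show "integrable \<mu> (\<lambda>x. C * (\<bar>f x\<bar> powr p + \<bar>g x\<bar> powr p + \<bar>h x\<bar> powr p))"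
      using i by simp
    show "AE x in \<mu>. norm (F (f x, g x, h x)) \<le> norm (C * (\<bar>f x\<bar> powr p + \<bar>g x\<bar> powr p + \<bar>h x\<bar> powr p))"
    proof (rule AE_I2)
      fix x show "norm (F (f x, g x, h x)) \<le> norm (C * (\<bar>f x\<bar> powr p + \<bar>g x\<bar> powr p + \<bar>h x\<bar> powr p))"
        using C[of "(f x, g x, h x)"] by (simp add: power_sum_def)
    qed
  qed (rule homogeneous_compose_measurable[OF F m])
qed

lemma functional_integrable:
  assumes "homogeneous p F" "u \<in> X" "v \<in> X" "w \<in> X"
  shows "integrable \<mu> (\<lambda>x. F (D u x, D v x, D w x))" "integrable \<mu> (\<lambda>x. q x * F (u x, v x, w x))"
    "integrable \<mu> (\<lambda>x. F (D u x, D v x, D w x) + q x * F (u x, v x, w x))"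
proof -
  show 1: "integrable \<mu> (\<lambda>x. F (D u x, D v x, D w x))"
    by (intro homogeneous_compose_integrable X_measurable assms)
  show 2: "integrable \<mu> (\<lambda>x. q x * F (u x, v x, w x))"
    by (intro integrable_q_mult homogeneous_compose_integrable X_measurable assms)
  show "integrable \<mu> (\<lambda>x. F (D u x, D v x, D w x) + q x * F (u x, v x, w x))"
    using 1 2 by simp
qed

lemma functional_mono:
  assumes "homogeneous p F" "homogeneous p G" "u \<in> X" "v \<in> X" "w \<in> X" and le: "\<And>x. F x \<le> G x"
  shows "functional F u v w \<le> functional G u v w"
  unfolding functional_def
proof (rule integral_mono)
  fix x assume "x \<in> space \<mu>"
  then show "F (D u x, D v x, D w x) + q x * F (u x, v x, w x) \<le> G (D u x, D v x, D w x) + q x * G (u x, v x, w x)"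
    using q_nonneg[of x] by (intro add_mono mult_left_mono le) auto
qed (intro functional_integrable assms)+

lemma functional_add:
  assumes "homogeneous p F" "homogeneous p G" "u \<in> X" "v \<in> X" "w \<in> X"
  shows "functional (\<lambda>x. F x + G x) u v w = functional F u v w + functional G u v w"
  unfolding functional_def
  by (subst Bochner_Integration.integral_add[symmetric])
    (auto intro!: functional_integrable assms Bochner_Integration.integral_cong simp: algebra_simps)

lemma functional_diff:
  assumes "homogeneous p F" "homogeneous p G" "u \<in> X" "v \<in> X" "w \<in> X"
  shows "functional (\<lambda>x. F x - G x) u v w = functional F u v w - functional G u v w"
  unfolding functional_def
  by (subst Bochner_Integration.integral_diff[symmetric])
    (auto intro!: functional_integrable assms Bochner_Integration.integral_cong simp: algebra_simps)

lemma functional_cmult: "functional (\<lambda>x. c * F x) u v w = c * functional F u v w"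
  unfolding functional_def
  by (subst integral_mult_right_zero[symmetric]) (auto intro!: Bochner_Integration.integral_cong simp: algebra_simps)

definition energy :: "(real \<Rightarrow> real) \<Rightarrow> real" where
  "energy u = (LINT x|\<mu>. \<bar>D u x\<bar> powr p + q x * \<bar>u x\<bar> powr p)"

text \<open>On the space this is the pairing of \<open>L u\<close> with \<open>v\<close>, while
  \<open>energy\<close> is the \<open>p\<close>-th power of the norm; unlike the norm, both are
  integrals of homogeneous expressions.\<close>

definition form :: "(real \<Rightarrow> real) \<Rightarrow> (real \<Rightarrow> real) \<Rightarrow> real" where
  "form u v = (LINT x|\<mu>. psi p (D u x) * D v x + q x * (psi p (u x) * v x))"

lemma N_eq: "N u = energy u powr (1 / p)"
  unfolding W1p_norm_def energy_def set_integral_interval_measure ..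

lemma L_op_eq: "v \<in> X \<Longrightarrow> L_op T p q u v = form u v"
  unfolding L_op_def form_def set_integral_interval_measure psi_def
  by (simp add: mult.assoc)

text \<open>Resolves the derivative of a linear combination into the separate derivatives, almost
  everywhere, so that pointwise inequalities in \<open>lin\<close> apply.\<close>

lemma energy_lincomb3:
  assumes "u \<in> X" "v \<in> X" "w \<in> X"
  shows "energy (\<lambda>x. a * u x + b * v x + c * w x) = functional (\<lambda>x. \<bar>lin a b c x\<bar> powr p) u v w"
  unfolding energy_def functional_def
proof (rule integral_cong_AE)
  show "AE x in \<mu>. \<bar>D (\<lambda>x. a * u x + b * v x + c * w x) x\<bar> powr p + q x * \<bar>a * u x + b * v x + c * w x\<bar> powr p =
     \<bar>lin a b c (D u x, D v x, D w x)\<bar> powr p + q x * \<bar>lin a b c (u x, v x, w x)\<bar> powr p"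
    using deriv_lincomb3[OF assms, of a b c] by eventually_elim (simp add: lin_def)
  note [measurable] = X_measurable(1,2)[OF X_lincomb3[OF assms, of a b c]]
  show "(\<lambda>x. \<bar>D (\<lambda>x. a * u x + b * v x + c * w x) x\<bar> powr p + q x * \<bar>a * u x + b * v x + c * w x\<bar> powr p) \<in> borel_measurable \<mu>"
    by measurable
  show "(\<lambda>x. \<bar>lin a b c (D u x, D v x, D w x)\<bar> powr p + q x * \<bar>lin a b c (u x, v x, w x)\<bar> powr p) \<in> borel_measurable \<mu>"
    by (intro borel_measurable_integrable functional_integrable homogeneous_abs_powr p_gt_1 assms)
qed

lemma form_lincomb3:
  assumes "u \<in> X" "v \<in> X" "w \<in> X"
  shows "form (\<lambda>x. a * u x + b * v x + c * w x) (\<lambda>x. a' * u x + b' * v x + c' * w x) =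
    functional (\<lambda>x. psi p (lin a b c x) * lin a' b' c' x) u v w"
  unfolding form_def functional_def
proof (rule integral_cong_AE)
  show "AE x in \<mu>. psi p (D (\<lambda>x. a * u x + b * v x + c * w x) x) * D (\<lambda>x. a' * u x + b' * v x + c' * w x) x +
     q x * (psi p (a * u x + b * v x + c * w x) * (a' * u x + b' * v x + c' * w x)) =
     psi p (lin a b c (D u x, D v x, D w x)) * lin a' b' c' (D u x, D v x, D w x) +
     q x * (psi p (lin a b c (u x, v x, w x)) * lin a' b' c' (u x, v x, w x))"
    using deriv_lincomb3[OF assms, of a b c] deriv_lincomb3[OF assms, of a' b' c']
    by eventually_elim (simp add: lin_def)
  note m [measurable] = X_measurable(1,2)[OF X_lincomb3[OF assms, of a b c]] X_measurable(1,2)[OF X_lincomb3[OF assms, of a' b' c']]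
  have [measurable]: "psi p \<in> borel_measurable borel"
    by (intro borel_measurable_continuous_onI continuous_on_psi p_gt_1)
  show "(\<lambda>x. psi p (D (\<lambda>x. a * u x + b * v x + c * w x) x) * D (\<lambda>x. a' * u x + b' * v x + c' * w x) x +
     q x * (psi p (a * u x + b * v x + c * w x) * (a' * u x + b' * v x + c' * w x))) \<in> borel_measurable \<mu>"
    by measurable
  show "(\<lambda>x. psi p (lin a b c (D u x, D v x, D w x)) * lin a' b' c' (D u x, D v x, D w x) +
     q x * (psi p (lin a b c (u x, v x, w x)) * lin a' b' c' (u x, v x, w x))) \<in> borel_measurable \<mu>"
    by (intro borel_measurable_integrable functional_integrable homogeneous_psi_times p_gt_1 assms)
qed

end

section \<open>Integrated inequalities for the energy and its form\<close>

context periodic_sobolev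
begin

lemma functional_energies:
  assumes "u \<in> X" "v \<in> X" "w \<in> X"
  shows "energy u = functional (\<lambda>x. \<bar>lin 1 0 0 x\<bar> powr p) u v w"
    "energy v = functional (\<lambda>x. \<bar>lin 0 1 0 x\<bar> powr p) u v w"
    "energy w = functional (\<lambda>x. \<bar>lin 0 0 1 x\<bar> powr p) u v w"
    "energy (u - v) = functional (\<lambda>x. \<bar>lin 1 (-1) 0 x\<bar> powr p) u v w"
  using energy_lincomb3[OF assms, of 1 0 0] energy_lincomb3[OF assms, of 0 1 0]
    energy_lincomb3[OF assms, of 0 0 1] energy_lincomb3[OF assms, of 1 "-1" 0]
  by (simp_all add: fun_diff_def)

lemma functional_forms:
  assumes "u \<in> X" "v \<in> X" "w \<in> X"
  shows "form u w = functional (\<lambda>x. psi p (lin 1 0 0 x) * lin 0 0 1 x) u v w"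
    "form v w = functional (\<lambda>x. psi p (lin 0 1 0 x) * lin 0 0 1 x) u v w"
    "form u v = functional (\<lambda>x. psi p (lin 1 0 0 x) * lin 0 1 0 x) u v w"
    "form u (u - v) = functional (\<lambda>x. psi p (lin 1 0 0 x) * lin 1 (-1) 0 x) u v w"
    "form v (u - v) = functional (\<lambda>x. psi p (lin 0 1 0 x) * lin 1 (-1) 0 x) u v w"
  using form_lincomb3[OF assms, of 1 0 0 0 0 1] form_lincomb3[OF assms, of 0 1 0 0 0 1]
    form_lincomb3[OF assms, of 1 0 0 0 1 0]
    form_lincomb3[OF assms, of 1 0 0 1 "-1" 0] form_lincomb3[OF assms, of 0 1 0 1 "-1" 0]
  by (simp_all add: fun_diff_def)

lemma functional_power_sum:
  assumes "u \<in> X" "v \<in> X" "w \<in> X"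
  shows "functional (power_sum p) u v w = energy u + energy v + energy w"
proof -
  have "power_sum p = (\<lambda>x. \<bar>lin 1 0 0 x\<bar> powr p + \<bar>lin 0 1 0 x\<bar> powr p + \<bar>lin 0 0 1 x\<bar> powr p)"
    by (simp add: power_sum_def[abs_def] lin_def)
  then show ?thesis
    using assms p_gt_1
    by (simp add: functional_add homogeneous_add homogeneous_abs_powr functional_energies[OF assms])
qed

lemma energy_scale:
  assumes "u \<in> X"
  shows "energy (\<lambda>x. a * u x) = \<bar>a\<bar> powr p * energy u"
proof -
  have "energy (\<lambda>x. a * u x) = functional (\<lambda>x. \<bar>lin a 0 0 x\<bar> powr p) u u u"
    using energy_lincomb3[OF assms assms assms, of a 0 0] by simp
  also have "\<dots> = functional (\<lambda>x. \<bar>a\<bar> powr p * \<bar>lin 1 0 0 x\<bar> powr p) u u u"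
    by (simp add: lin_def abs_mult powr_mult)
  finally show ?thesis
    by (simp only: functional_cmult functional_energies(1)[OF assms assms assms])
qed

lemma energy_zero: "energy (\<lambda>_. 0) = 0"
  using energy_scale[OF X_zero, of 0] p_gt_1 by simp

lemma energy_nonneg: "energy u \<ge> 0"
  unfolding energy_def by (intro Bochner_Integration.integral_nonneg) (auto intro!: add_nonneg_nonneg mult_nonneg_nonneg q_nonneg)

lemma form_self: "form u u = energy u"
  unfolding form_def energy_def by (simp add: psi_times[OF p_gt_1])

lemma form_right_lincomb:
  assumes "u \<in> X" "v \<in> X" "w \<in> X"
  shows "form u (\<lambda>x. a * v x + b * w x) = a * form u v + b * form u w"
proof -
  have "form u (\<lambda>x. a * v x + b * w x) = functional (\<lambda>x. psi p (lin 1 0 0 x) * lin 0 a b x) u v w"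
    using form_lincomb3[OF assms, of 1 0 0 0 a b] by simp
  also have "\<dots> = functional (\<lambda>x. a * (psi p (lin 1 0 0 x) * lin 0 1 0 x) + b * (psi p (lin 1 0 0 x) * lin 0 0 1 x)) u v w"
    by (simp add: lin_def algebra_simps)
  also have "\<dots> = a * form u v + b * form u w"
    using assms p_gt_1 unfolding functional_forms(1,3)[OF assms]
    by (simp only: functional_add functional_cmult homogeneous_cmult homogeneous_psi_times)
  finally show ?thesis .
qed

text \<open>The constant depends on \<open>e\<close> alone and not on the functions. Statements
  about two functions fill the third slot with the zero function, whose energy is 0.\<close>

lemma energy_diff_le:
  assumes "e > 0"
  obtains C where "C \<ge> 0" "\<And>u v. u \<in> X \<Longrightarrow> v \<in> X \<Longrightarrow>
    energy (u - v) \<le> e * (energy u + energy v) + C * (form u (u - v) - form v (u - v))"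
proof -
  obtain C where C: "C \<ge> 0" "\<And>x. \<bar>lin 1 (-1) 0 x\<bar> powr p \<le> e * power_sum p x +
    C * (psi p (lin 1 0 0 x) * lin 1 (-1) 0 x - psi p (lin 0 1 0 x) * lin 1 (-1) 0 x)"
    using psi_diff_coercive[OF p_gt_1 assms] by metis
  have "energy (u - v) \<le> e * (energy u + energy v) + C * (form u (u - v) - form v (u - v))"
    if "u \<in> X" "v \<in> X" for u v
  proof -
    note X = that X_zero
    note h = homogeneous_add homogeneous_cmult homogeneous_diff homogeneous_psi_times homogeneous_abs_powr homogeneous_power_sum p_gt_1 X
    have "energy (u - v) \<le> functional (\<lambda>x. e * power_sum p x +
       C * (psi p (lin 1 0 0 x) * lin 1 (-1) 0 x - psi p (lin 0 1 0 x) * lin 1 (-1) 0 x)) u v (\<lambda>_. 0)"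
      unfolding functional_energies(4)[OF X] by (intro functional_mono h C(2))
    also have "\<dots> = e * (energy u + energy v) + C * (form u (u - v) - form v (u - v))"
      unfolding functional_forms(4,5)[OF X]
      by (subst functional_add; (intro h)?) (simp add: functional_cmult functional_diff h functional_power_sum[OF X] energy_zero)
    finally show ?thesis .
  qed
  then show thesis using that C(1) by blast
qed

lemma energy_le_form_diff:
  obtains C where "C \<ge> 0" "\<And>u v. u \<in> X \<Longrightarrow> v \<in> X \<Longrightarrow>
    energy u \<le> 2 * (form u (u - v) - form v (u - v)) + C * energy v"
proof -
  obtain C where C: "C \<ge> 0" "\<And>x. \<bar>lin 1 0 0 x\<bar> powr p \<le> 1/2 * power_sum p x +
    (psi p (lin 1 0 0 x) * lin 1 (-1) 0 x - psi p (lin 0 1 0 x) * lin 1 (-1) 0 x) +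
    C * \<bar>lin 0 1 0 x\<bar> powr p"
    using abs_powr_le_psi_diff[OF p_gt_1] by metis
  \<comment> \<open>Half of \<open>energy u\<close> comes from the power sum; absorbing it on the
    left and doubling the rest gives the factors 2 and \<open>2 * C + 1\<close>.\<close>
  have "energy u \<le> 2 * (form u (u - v) - form v (u - v)) + (2 * C + 1) * energy v"
    if "u \<in> X" "v \<in> X" for u v
  proof -
    note X = that X_zero
    note h = homogeneous_add homogeneous_cmult homogeneous_diff homogeneous_psi_times homogeneous_abs_powr homogeneous_power_sum p_gt_1 X
    have "energy u \<le> functional (\<lambda>x. 1/2 * power_sum p x +
      (psi p (lin 1 0 0 x) * lin 1 (-1) 0 x - psi p (lin 0 1 0 x) * lin 1 (-1) 0 x) +
      C * \<bar>lin 0 1 0 x\<bar> powr p) u v (\<lambda>_. 0)"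
      unfolding functional_energies(1)[OF X] by (intro functional_mono h C(2))
    also have "\<dots> = 1/2 * (energy u + energy v) + (form u (u - v) - form v (u - v)) + C * energy v"
      unfolding functional_forms(4,5)[OF X]
      by (subst functional_add; (intro h)?)+
        (simp only: functional_cmult functional_diff h functional_power_sum[OF X] energy_zero functional_energies(2)[OF X, symmetric] add_0_right)
    finally show ?thesis by (simp add: algebra_simps)
  qed
  then show thesis using that[of "2 * C + 1"] C(1) by simp
qed

lemma form_diff_le:
  assumes "e > 0"
  obtains C where "C \<ge> 0" "\<And>u v w. u \<in> X \<Longrightarrow> v \<in> X \<Longrightarrow> w \<in> X \<Longrightarrow>
    \<bar>form u w - form v w\<bar> \<le> e * (energy u + energy v + energy w) + C * energy (u - v)"
proof -
  obtain C where C: "C \<ge> 0" "\<And>x. \<bar>psi p (lin 1 0 0 x) * lin 0 0 1 x - psi p (lin 0 1 0 x) * lin 0 0 1 x\<bar>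
    \<le> e * power_sum p x + C * \<bar>lin 1 (-1) 0 x\<bar> powr p"
    using psi_diff_le[OF p_gt_1 assms] by metis
  have "\<bar>form u w - form v w\<bar> \<le> e * (energy u + energy v + energy w) + C * energy (u - v)"
    if "u \<in> X" "v \<in> X" "w \<in> X" for u v w
  proof -
    note X = that
    note h = homogeneous_add homogeneous_cmult homogeneous_diff homogeneous_psi_times homogeneous_abs_powr homogeneous_power_sum p_gt_1 X
    let ?F = "\<lambda>x. psi p (lin 1 0 0 x) * lin 0 0 1 x - psi p (lin 0 1 0 x) * lin 0 0 1 x"
    let ?G = "\<lambda>x. e * power_sum p x + C * \<bar>lin 1 (-1) 0 x\<bar> powr p"
    have F: "functional ?F u v w = form u w - form v w"
      unfolding functional_forms(1,2)[OF X] by (intro functional_diff h)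
    have G: "functional ?G u v w = e * (energy u + energy v + energy w) + C * energy (u - v)"
      unfolding functional_energies(4)[OF X]
      by (subst functional_add; (intro h)?) (simp only: functional_cmult functional_power_sum[OF X])
    \<comment> \<open>Monotonicity of the functional is one-sided, so the absolute value is resolved
      into the bounds for the integrand and for its negative.\<close>
    have le: "?F x \<le> ?G x" "-1 * ?F x \<le> ?G x" for x
      using C(2)[of x] unfolding abs_le_iff mult_minus1 by simp_all
    have "functional ?F u v w \<le> functional ?G u v w"
      by (intro functional_mono h le(1))
    moreover have "functional (\<lambda>x. -1 * ?F x) u v w \<le> functional ?G u v w"
      by (intro functional_mono h le(2))
    ultimately show ?thesis
      unfolding functional_cmult F G unfolding abs_le_iff mult_minus1 by simp
  qed
  then show thesis using that C(1) by blast
qed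

lemma energy_uniformly_convex:
  assumes "e > 0"
  obtains C where "C \<ge> 0" "\<And>u v. u \<in> X \<Longrightarrow> v \<in> X \<Longrightarrow>
    energy (u - v) \<le> e * (energy u + energy v) +
      C * (energy u + energy v - 2 * energy (\<lambda>x. 1/2 * u x + 1/2 * v x))"
proof -
  obtain C where C: "C \<ge> 0" "\<And>x. \<bar>lin 1 (-1) 0 x\<bar> powr p \<le> e * power_sum p x +
    C * (\<bar>lin 1 0 0 x\<bar> powr p + \<bar>lin 0 1 0 x\<bar> powr p - 2 * \<bar>lin (1/2) (1/2) 0 x\<bar> powr p)"
    using abs_powr_uniformly_convex[OF p_gt_1 assms] by metis
  have "energy (u - v) \<le> e * (energy u + energy v) +
      C * (energy u + energy v - 2 * energy (\<lambda>x. 1/2 * u x + 1/2 * v x))"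
    if "u \<in> X" "v \<in> X" for u v
  proof -
    note X = that X_zero
    note h = homogeneous_add homogeneous_cmult homogeneous_diff homogeneous_psi_times homogeneous_abs_powr homogeneous_power_sum p_gt_1 X
    have mid: "energy (\<lambda>x. 1/2 * u x + 1/2 * v x) = functional (\<lambda>x. \<bar>lin (1/2) (1/2) 0 x\<bar> powr p) u v (\<lambda>_. 0)"
      using energy_lincomb3[OF X, of "1/2" "1/2" 0] by simp
    have "energy (u - v) \<le> functional (\<lambda>x. e * power_sum p x +
       C * (\<bar>lin 1 0 0 x\<bar> powr p + \<bar>lin 0 1 0 x\<bar> powr p - 2 * \<bar>lin (1/2) (1/2) 0 x\<bar> powr p)) u v (\<lambda>_. 0)"
      unfolding functional_energies(4)[OF X] by (intro functional_mono h C(2))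
    also have "\<dots> = functional (\<lambda>x. e * power_sum p x) u v (\<lambda>_. 0) +
       functional (\<lambda>x. C * (\<bar>lin 1 0 0 x\<bar> powr p + \<bar>lin 0 1 0 x\<bar> powr p - 2 * \<bar>lin (1/2) (1/2) 0 x\<bar> powr p)) u v (\<lambda>_. 0)"
      by (intro functional_add h)
    also have "\<dots> = e * (energy u + energy v) + C * functional (\<lambda>x. \<bar>lin 1 0 0 x\<bar> powr p + \<bar>lin 0 1 0 x\<bar> powr p - 2 * \<bar>lin (1/2) (1/2) 0 x\<bar> powr p) u v (\<lambda>_. 0)"
      by (simp only: functional_cmult functional_power_sum[OF X] energy_zero add_0_right)
    also have "functional (\<lambda>x. \<bar>lin 1 0 0 x\<bar> powr p + \<bar>lin 0 1 0 x\<bar> powr p - 2 * \<bar>lin (1/2) (1/2) 0 x\<bar> powr p) u v (\<lambda>_. 0) =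
       functional (\<lambda>x. \<bar>lin 1 0 0 x\<bar> powr p + \<bar>lin 0 1 0 x\<bar> powr p) u v (\<lambda>_. 0) - functional (\<lambda>x. 2 * \<bar>lin (1/2) (1/2) 0 x\<bar> powr p) u v (\<lambda>_. 0)"
      by (intro functional_diff h)
    also have "functional (\<lambda>x. \<bar>lin 1 0 0 x\<bar> powr p + \<bar>lin 0 1 0 x\<bar> powr p) u v (\<lambda>_. 0) = energy u + energy v"
      unfolding functional_energies(1,2)[OF X] by (intro functional_add h)
    also have "functional (\<lambda>x. 2 * \<bar>lin (1/2) (1/2) 0 x\<bar> powr p) u v (\<lambda>_. 0) = 2 * energy (\<lambda>x. 1/2 * u x + 1/2 * v x)"
      unfolding mid by (rule functional_cmult)
    finally show ?thesis .
  qed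
  then show thesis using that C(1) by blast
qed

text \<open>The tangent is taken at the perturbed point, so that it bounds \<open>energy u\<close>
  from below. Together with minimality this yields a first-order condition for every
  \<open>t > 0\<close>, and the energy need not be differentiated under the integral.\<close>

lemma energy_tangent:
  assumes "u \<in> X" "v \<in> X"
  shows "energy (\<lambda>x. u x + t * v x) - p * t * form (\<lambda>x. u x + t * v x) v \<le> energy u"
proof -
  note X = assms X_zero
  note h = homogeneous_add homogeneous_cmult homogeneous_diff homogeneous_psi_times homogeneous_abs_powr homogeneous_power_sum p_gt_1 X
  have 1: "energy (\<lambda>x. u x + t * v x) = functional (\<lambda>x. \<bar>lin 1 t 0 x\<bar> powr p) u v (\<lambda>_. 0)"
    using energy_lincomb3[OF X, of 1 t 0] by simp
  have 2: "form (\<lambda>x. u x + t * v x) v = functional (\<lambda>x. psi p (lin 1 t 0 x) * lin 0 1 0 x) u v (\<lambda>_. 0)"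
    using form_lincomb3[OF X, of 1 t 0 0 1 0] by simp
  have "functional (\<lambda>x. \<bar>lin 1 t 0 x\<bar> powr p - (p * t) * (psi p (lin 1 t 0 x) * lin 0 1 0 x)) u v (\<lambda>_. 0) \<le> energy u"
    unfolding functional_energies(1)[OF X]
  proof (intro functional_mono h)
    fix x :: "real \<times> real \<times> real"
    show "\<bar>lin 1 t 0 x\<bar> powr p - (p * t) * (psi p (lin 1 t 0 x) * lin 0 1 0 x) \<le> \<bar>lin 1 0 0 x\<bar> powr p"
      using abs_powr_tangent[OF p_gt_1, of "lin 1 t 0 x" "lin 1 0 0 x"] by (simp add: lin_def algebra_simps)
  qed
  also have "functional (\<lambda>x. \<bar>lin 1 t 0 x\<bar> powr p - (p * t) * (psi p (lin 1 t 0 x) * lin 0 1 0 x)) u v (\<lambda>_. 0) =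
    functional (\<lambda>x. \<bar>lin 1 t 0 x\<bar> powr p) u v (\<lambda>_. 0) - functional (\<lambda>x. (p * t) * (psi p (lin 1 t 0 x) * lin 0 1 0 x)) u v (\<lambda>_. 0)"
    by (intro functional_diff h)
  finally show ?thesis
    by (simp only: functional_cmult 1 2)
qed

lemma energy_convex:
  assumes "u \<in> X" "v \<in> X" and t: "0 \<le> t" "t \<le> 1"
  shows "energy (\<lambda>x. t * u x + (1 - t) * v x) \<le> t * energy u + (1 - t) * energy v"
proof -
  note X = assms(1,2) X_zero
  note h = homogeneous_add homogeneous_cmult homogeneous_diff homogeneous_psi_times homogeneous_abs_powr homogeneous_power_sum p_gt_1 X
  have "energy (\<lambda>x. t * u x + (1 - t) * v x) = functional (\<lambda>x. \<bar>lin t (1 - t) 0 x\<bar> powr p) u v (\<lambda>_. 0)"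
    using energy_lincomb3[OF X, of t "1 - t" 0] by simp
  also have "\<dots> \<le> functional (\<lambda>x. t * \<bar>lin 1 0 0 x\<bar> powr p + (1 - t) * \<bar>lin 0 1 0 x\<bar> powr p) u v (\<lambda>_. 0)"
  proof (intro functional_mono h)
    fix x :: "real \<times> real \<times> real"
    show "\<bar>lin t (1 - t) 0 x\<bar> powr p \<le> t * \<bar>lin 1 0 0 x\<bar> powr p + (1 - t) * \<bar>lin 0 1 0 x\<bar> powr p"
      using abs_powr_convex[OF p_gt_1 t] by (simp add: lin_def)
  qed
  also have "\<dots> = functional (\<lambda>x. t * \<bar>lin 1 0 0 x\<bar> powr p) u v (\<lambda>_. 0) + functional (\<lambda>x. (1 - t) * \<bar>lin 0 1 0 x\<bar> powr p) u v (\<lambda>_. 0)"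
    by (intro functional_add h)
  finally show ?thesis
    by (simp only: functional_cmult functional_energies(1,2)[OF X])
qed

lemma abs_form_le:
  assumes "u \<in> X" "v \<in> X"
  shows "\<bar>form u v\<bar> \<le> energy u + energy v"
proof -
  note X = assms X_zero
  note h = homogeneous_add homogeneous_cmult homogeneous_diff homogeneous_psi_times homogeneous_abs_powr homogeneous_power_sum p_gt_1 X
  let ?F = "\<lambda>x. psi p (lin 1 0 0 x) * lin 0 1 0 x"
  let ?G = "\<lambda>x. \<bar>lin 1 0 0 x\<bar> powr p + \<bar>lin 0 1 0 x\<bar> powr p"
  have G: "functional ?G u v (\<lambda>_. 0) = energy u + energy v"
    unfolding functional_energies(1,2)[OF X] by (intro functional_add h)
  have le: "?F x \<le> ?G x" "-1 * ?F x \<le> ?G x" for x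
    using abs_psi_times_le[OF p_gt_1, of "lin 1 0 0 x" "lin 0 1 0 x"]
    unfolding abs_le_iff mult_minus1 by simp_all
  have "functional ?F u v (\<lambda>_. 0) \<le> functional ?G u v (\<lambda>_. 0)"
    by (intro functional_mono h le(1))
  moreover have "functional (\<lambda>x. -1 * ?F x) u v (\<lambda>_. 0) \<le> functional ?G u v (\<lambda>_. 0)"
    by (intro functional_mono h le(2))
  ultimately show ?thesis
    unfolding functional_cmult G functional_forms(3)[OF X, symmetric] unfolding abs_le_iff mult_minus1 by simp
qed

section \<open>The norm as the gauge of a convex set\<close>

lemma N_nonneg: "N u \<ge> 0"
  by (simp add: N_eq)

lemma energy_eq: "energy u = N u powr p"
  unfolding N_eq using p_gt_1 energy_nonneg[of u] by (simp add: powr_powr)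

lemma N_le_iff: "a \<ge> 0 \<Longrightarrow> N u \<le> a \<longleftrightarrow> energy u \<le> a powr p"
proof
  assume a: "a \<ge> 0"
  show "energy u \<le> a powr p" if "N u \<le> a"
    unfolding energy_eq using that p_gt_1 N_nonneg by (intro powr_mono2) auto
  show "N u \<le> a" if "energy u \<le> a powr p"
  proof -
    have "energy u powr (1 / p) \<le> (a powr p) powr (1 / p)"
      using that p_gt_1 energy_nonneg by (intro powr_mono2) auto
    then show ?thesis
      using a p_gt_1 by (simp add: N_eq powr_powr)
  qed
qed

lemma N_scale:
  assumes "u \<in> X"
  shows "N (\<lambda>x. a * u x) = \<bar>a\<bar> * N u"
  unfolding N_eq energy_scale[OF assms] using p_gt_1 energy_nonneg by (simp add: powr_mult powr_powr)

text \<open>The set of functions with energy at most 1 is convex, and the norm is its gauge. The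
  added \<open>e / 2\<close> keeps both scaling factors positive even where the norm is 0.\<close>

lemma N_triangle:
  assumes u: "u \<in> X" and v: "v \<in> X"
  shows "N (\<lambda>x. u x + v x) \<le> N u + N v"
proof (rule field_le_epsilon)
  fix e :: real assume e: "e > 0"
  define a where "a = N u + e / 2"
  define b where "b = N v + e / 2"
  have a: "a > 0" and b: "b > 0"
    using e N_nonneg[of u] N_nonneg[of v] by (auto simp: a_def b_def intro: add_nonneg_pos)
  have scaled: "energy (\<lambda>x. inverse c * w x) \<le> 1" if "w \<in> X" "c > 0" "N w \<le> c" for w c
  proof -
    have "N (\<lambda>x. inverse c * w x) \<le> 1"
      unfolding N_scale[OF that(1)] using that by (simp add: field_simps)
    then show ?thesis using N_le_iff[of 1] by simp
  qed
  \<comment> \<open>With this weight the scaled sum is a convex combination of \<open>u\<close> over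
    \<open>a\<close> and \<open>v\<close> over \<open>b\<close>, both of energy at most 1.\<close>
  define t where "t = a / (a + b)"
  have t: "0 \<le> t" "t \<le> 1" "1 - t = b / (a + b)"
    using a b by (auto simp: t_def field_simps)
  have "energy (\<lambda>x. inverse (a + b) * (u x + v x)) =
    energy (\<lambda>x. t * (inverse a * u x) + (1 - t) * (inverse b * v x))"
  proof -
    have "t * (inverse a * y) = inverse (a + b) * y" "(1 - t) * (inverse b * y) = inverse (a + b) * y" for y
      unfolding t(3) unfolding t_def using a b by (simp_all add: divide_inverse)
    then show ?thesis by (simp only: distrib_left)
  qed
  also have "\<dots> \<le> t * energy (\<lambda>x. inverse a * u x) + (1 - t) * energy (\<lambda>x. inverse b * v x)"
    using X_lincomb[OF u u, of "inverse a" 0] X_lincomb[OF v v, of "inverse b" 0] t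
    by (intro energy_convex) auto
  also have "\<dots> \<le> t * 1 + (1 - t) * 1"
    using t e by (intro add_mono mult_left_mono scaled u v a b) (auto simp: a_def b_def)
  finally have "N (\<lambda>x. inverse (a + b) * (u x + v x)) \<le> 1"
    using N_le_iff[of 1] by simp
  then have "inverse (a + b) * N (\<lambda>x. u x + v x) \<le> 1"
    using N_scale[OF X_lincomb[OF u v, of 1 1], of "inverse (a + b)"] a b by simp
  then show "N (\<lambda>x. u x + v x) \<le> N u + N v + e"
    using a b by (simp add: field_simps a_def b_def)
qed

end

section \<open>Norm and completeness of the Sobolev space\<close>

text \<open>Lets the weak identity pass to the limit: on a finite measure space convergence in
  \<open>p\<close>-th mean implies convergence in mean, and test functions and their derivatives are
  bounded.\<close>

lemma (in finite_measure) tendsto_integral_mult_bounded: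
  fixes f :: "nat \<Rightarrow> 'a \<Rightarrow> real" and g \<psi> :: "'a \<Rightarrow> real"
  assumes p: "p > 1" and fm [measurable]: "\<And>n. f n \<in> borel_measurable M" "g \<in> borel_measurable M" "\<psi> \<in> borel_measurable M"
    and fi: "\<And>n. integrable M (\<lambda>x. \<bar>f n x\<bar> powr p)" "integrable M (\<lambda>x. \<bar>g x\<bar> powr p)"
    and l: "(\<lambda>n. LINT x|M. \<bar>f n x - g x\<bar> powr p) \<longlonglongrightarrow> 0"
    and B: "\<And>x. \<bar>\<psi> x\<bar> \<le> B"
  shows "(\<lambda>n. LINT x|M. f n x * \<psi> x) \<longlonglongrightarrow> (LINT x|M. g x * \<psi> x)"
proof -
  have B0: "B \<ge> 0" using B[of undefined] by linarith
  have di: "integrable M (\<lambda>x. \<bar>f n x - g x\<bar> powr p)" for n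
    by (intro integrable_abs_powr_diff p fm fi)
  have dm: "(\<lambda>x. f n x - g x) \<in> borel_measurable M" for n by measurable
  note i = integrable_of_abs_powr[OF p fm(1) fi(1)] integrable_of_abs_powr[OF p fm(2) fi(2)]
    integrable_of_abs_powr[OF p dm di]
  have bi: "integrable M (\<lambda>x. h x * \<psi> x)" if "integrable M h" for h
  proof (rule Bochner_Integration.integrable_bound)
    show "integrable M (\<lambda>x. B * \<bar>h x\<bar>)" using that by simp
    show "(\<lambda>x. h x * \<psi> x) \<in> borel_measurable M"
      using borel_measurable_integrable[OF that] by measurable
    show "AE x in M. norm (h x * \<psi> x) \<le> norm (B * \<bar>h x\<bar>)"
      using B B0 by (intro AE_I2) (auto simp: abs_mult mult.commute[of "\<bar>h _\<bar>"] intro!: mult_right_mono)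
  qed
  have l1: "(\<lambda>n. LINT x|M. \<bar>f n x - g x\<bar>) \<longlonglongrightarrow> 0"
  proof (rule LIMSEQ_I)
    fix e :: real assume e: "e > 0"
    \<comment> \<open>The first term of the splitting becomes at most \<open>e / 2\<close>; the
      added 1 keeps the denominator positive for a null measure. With \<open>\<delta>\<close> fixed,
      the second term is small for large \<open>n\<close>.\<close>
    define \<delta> where "\<delta> = e / (2 * (measure M (space M) + 1))"
    have \<delta>: "\<delta> > 0" "\<delta> * measure M (space M) \<le> e / 2"
      using e by (auto simp: \<delta>_def field_simps add_pos_nonneg)
    have "eventually (\<lambda>n. (LINT x|M. \<bar>f n x - g x\<bar> powr p) < e / (2 * \<delta> powr (1 - p))) sequentially"
      using e \<delta> by (intro order_tendstoD(2)[OF l]) simp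
    then have "eventually (\<lambda>n. norm ((LINT x|M. \<bar>f n x - g x\<bar>) - 0) < e) sequentially"
    proof eventually_elim
      case (elim n)
      have "(LINT x|M. \<bar>f n x - g x\<bar>) \<le> \<delta> * measure M (space M) + \<delta> powr (1 - p) * (LINT x|M. \<bar>f n x - g x\<bar> powr p)"
        by (intro integral_abs_le_abs_powr p \<delta> dm di)
      moreover have "\<delta> powr (1 - p) * (LINT x|M. \<bar>f n x - g x\<bar> powr p) < e / 2"
        using elim \<delta>(1) by (simp add: field_simps)
      moreover have "(LINT x|M. \<bar>f n x - g x\<bar>) \<ge> 0" by simp
      ultimately show ?case using \<delta>(2) by (simp del: integral_nonneg)
    qed
    then show "\<exists>no. \<forall>n\<ge>no. norm ((LINT x|M. \<bar>f n x - g x\<bar>) - 0) < e"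
      by (simp add: eventually_sequentially)
  qed
  have "(\<lambda>n. (LINT x|M. f n x * \<psi> x) - (LINT x|M. g x * \<psi> x)) \<longlonglongrightarrow> 0"
  proof (rule Lim_null_comparison)
    show "(\<lambda>n. B * (LINT x|M. \<bar>f n x - g x\<bar>)) \<longlonglongrightarrow> 0"
      using tendsto_mult_right_zero[OF l1] .
    show "\<forall>\<^sub>F n in sequentially. norm ((LINT x|M. f n x * \<psi> x) - (LINT x|M. g x * \<psi> x)) \<le> B * (LINT x|M. \<bar>f n x - g x\<bar>)"
    proof (intro always_eventually allI)
      fix n
      have "(LINT x|M. f n x * \<psi> x) - (LINT x|M. g x * \<psi> x) = (LINT x|M. (f n x - g x) * \<psi> x)"
        by (subst Bochner_Integration.integral_diff[symmetric]) (auto intro: bi i simp: left_diff_distrib)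
      also have "norm \<dots> \<le> (LINT x|M. norm ((f n x - g x) * \<psi> x))"
        by (rule integral_norm_bound)
      also have "\<dots> \<le> (LINT x|M. B * \<bar>f n x - g x\<bar>)"
      proof (rule integral_mono)
        show "integrable M (\<lambda>x. norm ((f n x - g x) * \<psi> x))"
          by (intro integrable_norm bi i)
        show "integrable M (\<lambda>x. B * \<bar>f n x - g x\<bar>)"
          using i(3) by simp
        show "norm ((f n x - g x) * \<psi> x) \<le> B * \<bar>f n x - g x\<bar>" for x
          using B[of x] by (auto simp: abs_mult mult.commute[of B] intro!: mult_left_mono)
      qed
      finally show "norm ((LINT x|M. f n x * \<psi> x) - (LINT x|M. g x * \<psi> x)) \<le> B * (LINT x|M. \<bar>f n x - g x\<bar>)"
        by simp
    qed
  qed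
  then show ?thesis
    by (rule LIM_zero_cancel)
qed

context periodic_sobolev
begin

lemma integral_abs_deriv_powr_le: 
  assumes u: "u \<in> X"
  shows "(LINT x|\<mu>. \<bar>D u x\<bar> powr p) \<le> energy u"
  unfolding energy_def
proof (rule integral_mono)
  show "integrable \<mu> (\<lambda>x. \<bar>D u x\<bar> powr p)" "integrable \<mu> (\<lambda>x. \<bar>D u x\<bar> powr p + q x * \<bar>u x\<bar> powr p)"
    using X_measurable[OF u] by (auto intro: integrable_q_mult)
  show "\<bar>D u x\<bar> powr p \<le> \<bar>D u x\<bar> powr p + q x * \<bar>u x\<bar> powr p" if "x \<in> space \<mu>" for x
    using q_nonneg[of x] that by simp
qed

section \<open>Pointwise control by the norm\<close>

text \<open>The increment identity with the mean of the derivative split at level 1. The bound is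
  not homogeneous in \<open>u\<close>, and \<open>sup_le_N\<close> repairs this by scaling.\<close>

lemma increment_le:
  assumes u: "u \<in> X" and x: "0 < y" "y < x" "x < T"
  shows "\<bar>u x - u y\<bar> \<le> T + energy u"
proof -
  have i: "integrable \<mu> (D u)"
    by (rule integrable_of_abs_powr[OF p_gt_1 X_measurable(2,4)[OF u]])
  then have il: "integrable lebesgue (\<lambda>t. indicator {0<..<T} t *\<^sub>R \<bar>D u t\<bar>)"
    using set_integrable_interval_measure[of T "\<lambda>t. \<bar>D u t\<bar>"] by (simp add: set_integrable_def)
  have "u x - u y = (LINT t:{y<..x}|lebesgue. D u t)"
    by (rule weak_deriv_increment[OF X_D(1)[OF u] continuous_on_subset[OF X_D(4)[OF u]] x]) auto
  also have "\<bar>\<dots>\<bar> \<le> (LINT t|lebesgue. norm (indicator {y<..x} t *\<^sub>R D u t))"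
    unfolding set_lebesgue_integral_def using integral_norm_bound by (metis real_norm_def)
  also have "\<dots> \<le> (LINT t|lebesgue. indicator {0<..<T} t *\<^sub>R \<bar>D u t\<bar>)"
    by (rule integral_mono'[OF il]) (use x in \<open>auto simp: indicator_def\<close>)
  also have "\<dots> = (LINT t|\<mu>. \<bar>D u t\<bar>)"
    using set_integral_interval_measure[of T "\<lambda>t. \<bar>D u t\<bar>"] by (simp add: set_lebesgue_integral_def)
  also have "\<dots> \<le> 1 * measure \<mu> (space \<mu>) + 1 powr (1 - p) * (LINT x|\<mu>. \<bar>D u x\<bar> powr p)"
    by (intro integral_abs_le_abs_powr X_measurable u p_gt_1) simp
  also have "\<dots> \<le> T + energy u"
    using integral_abs_deriv_powr_le[OF u] T_pos by (simp add: measure_interval_measure)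
  finally show ?thesis .
qed

lemma q_positive_interval:
  obtains a b c where "0 < a" "a < b" "b < T" "c > 0" "\<And>x. x \<in> {a..b} \<Longrightarrow> q x \<ge> c"
proof -
  obtain x0 where x0: "x0 \<in> {0..T}" "q x0 > 0"
    using q_nonzero q_nonneg by force
  obtain d where d: "d > 0" "\<And>x. x \<in> {0..T} \<Longrightarrow> dist x x0 < d \<Longrightarrow> dist (q x) (q x0) < q x0 / 2"
    using q_cont x0 half_gt_zero[of "q x0"] unfolding continuous_on_iff by meson
  \<comment> \<open>A neighbourhood of \<open>x0\<close> clipped to [0,T]; its middle third lies
    strictly inside (0,T) even if \<open>x0\<close> is an endpoint.\<close>
  define l r where "l = max 0 (x0 - d)" and "r = min T (x0 + d)"
  have lr: "l < r" "0 \<le> l" "r \<le> T" "x0 - d \<le> l" "r \<le> x0 + d"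
    using x0 d(1) T_pos by (auto simp: l_def r_def)
  show thesis
  proof
    show "0 < (2 * l + r) / 3" "(2 * l + r) / 3 < (l + 2 * r) / 3" "(l + 2 * r) / 3 < T" "q x0 / 2 > 0"
      using lr x0 by auto
    fix x assume x: "x \<in> {(2 * l + r) / 3..(l + 2 * r) / 3}"
    then have "l < x" "x < r" using lr by auto
    then have "dist (q x) (q x0) < q x0 / 2"
      using lr by (intro d(2)) (auto simp: dist_real_def)
    then show "q x \<ge> q x0 / 2"
      using abs_ge_self[of "q x0 - q x"] unfolding dist_real_def abs_minus_commute[of "q x"] by linarith
  qed
qed

text \<open>If \<open>u\<close> were large on the whole interval where \<open>q \<ge> c\<close>, the
  weighted term alone would push the energy above 1. So \<open>u\<close> is moderate at one point,
  and increments are bounded.\<close>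

lemma bounded_of_energy_le_1:
  obtains K where "\<And>u x. u \<in> X \<Longrightarrow> energy u \<le> 1 \<Longrightarrow> \<bar>u x\<bar> \<le> K"
proof -
  obtain a b c where ab: "0 < a" "a < b" "b < T" "c > 0" "\<And>x. x \<in> {a..b} \<Longrightarrow> q x \<ge> c"
    using q_positive_interval by blast
  define A where "A = (2 / (c * (b - a))) powr (1 / p)"
  have A: "A powr p = 2 / (c * (b - a))" "A > 0"
    using ab p_gt_1 by (auto simp: A_def powr_powr)
  have "\<bar>u x\<bar> \<le> A + T + 1" if u: "u \<in> X" and e: "energy u \<le> 1" for u x
  proof -
    have "\<exists>x\<in>{a..b}. \<bar>u x\<bar> \<le> A"
    proof (rule ccontr)
      assume "\<not> ?thesis"
      then have big: "\<bar>u x\<bar> > A" if "x \<in> {a..b}" for x using that by force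
      have sub: "{a..b} \<subseteq> {0<..<T}" using ab by auto
      have sets: "{a..b} \<in> sets \<mu>"
        using sub by (auto simp: interval_measure_def sets_restrict_space_iff)
      have meas: "measure \<mu> {a..b} = b - a"
        using sub ab by (simp add: interval_measure_def measure_restrict_space)
      have "(LINT x|\<mu>. indicator {a..b} x * (c * A powr p)) \<le> energy u"
        unfolding energy_def
      proof (rule integral_mono)
        show "integrable \<mu> (\<lambda>x. indicator {a..b} x * (c * A powr p))"
          using sets by (intro integrable_mult_left integrable_real_indicator) (auto simp: less_top[symmetric])
        show "integrable \<mu> (\<lambda>x. \<bar>D u x\<bar> powr p + q x * \<bar>u x\<bar> powr p)"
          using X_measurable[OF u] by (auto intro: integrable_q_mult)
        fix x assume x: "x \<in> space \<mu>"
        show "indicator {a..b} x * (c * A powr p) \<le> \<bar>D u x\<bar> powr p + q x * \<bar>u x\<bar> powr p"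
        proof (cases "x \<in> {a..b}")
          case True
          have "c * A powr p \<le> q x * \<bar>u x\<bar> powr p"
            using True ab(4) ab(5)[OF True] big[OF True] A p_gt_1
            by (intro mult_mono powr_mono2) auto
          then show ?thesis using True by (simp add: add_increasing)
        next
          case False
          then show ?thesis using x q_nonneg[of x] by simp
        qed
      qed
      moreover have "(LINT x|\<mu>. indicator {a..b} x * (c * A powr p)) = (b - a) * (c * A powr p)"
        using sub by (simp add: meas Int_absorb2)
      ultimately have "(b - a) * (c * A powr p) \<le> 1" using e by linarith
      moreover have "(b - a) * (c * A powr p) = 2"
        using ab by (simp add: A field_simps)
      ultimately show False by simp
    qed
    then obtain y where y: "y \<in> {a..b}" "\<bar>u y\<bar> \<le> A" by blast
    have inner: "norm (u x) \<le> A + T + 1" if "x \<in> {0<..<T}" for x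
    proof -
      have y': "0 < y" "y < T" using y ab by auto
      have "\<bar>u x - u y\<bar> \<le> T + energy u"
      proof (cases x y rule: linorder_cases)
        case less
        then have "\<bar>u y - u x\<bar> \<le> T + energy u"
          using that y' by (intro increment_le[OF u]) auto
        then show ?thesis by (simp add: abs_minus_commute)
      next
        case greater
        then show ?thesis using that y' by (intro increment_le[OF u]) auto
      qed (use T_pos energy_nonneg in simp)
      then show ?thesis using e y(2) by simp
    qed
    show ?thesis
    proof (cases "x \<in> {0..T}")
      case True
      \<comment> \<open>The increment bound holds inside the open interval; continuity extends it to
        the endpoints.\<close>
      have cl: "closure {0<..<T} = {0..T}" using T_pos by simp
      have "norm (u x) \<le> A + T + 1"
        by (rule continuous_on_closure_norm_le[of "{0<..<T}" u]) (use X_D(4)[OF u] True inner cl in auto)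
      then show ?thesis by simp
    next
      case False
      then show ?thesis using X_D(5)[OF u False] A T_pos by simp
    qed
  qed
  then show thesis using that by blast
qed

lemma sup_le_N:
  obtains K where "K \<ge> 0" "\<And>u x. u \<in> X \<Longrightarrow> \<bar>u x\<bar> \<le> K * N u"
proof -
  obtain K where K: "\<And>u x. u \<in> X \<Longrightarrow> energy u \<le> 1 \<Longrightarrow> \<bar>u x\<bar> \<le> K"
    using bounded_of_energy_le_1 by blast
  have K0: "K \<ge> 0"
    using K[OF X_zero] energy_zero by force
  have "\<bar>u x\<bar> \<le> K * N u" if u: "u \<in> X" for u x
  proof -
    have scaled: "\<bar>t * u x\<bar> \<le> K" if "\<bar>t\<bar> * N u \<le> 1" for t
    proof -
      have "N (\<lambda>x. t * u x) \<le> 1"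
        using that by (simp add: N_scale[OF u])
      then show ?thesis
        using K[of "\<lambda>x. t * u x" x] X_lincomb[OF u u, of t 0] N_le_iff[of 1] by simp
    qed
    show ?thesis
    proof (cases "N u = 0")
      case True
      \<comment> \<open>Every multiple of \<open>u\<close> then has norm 0 and is bounded by
        \<open>K\<close>, yet a suitable multiple takes the value \<open>K + 1\<close> at
        \<open>x\<close>.\<close>
      have "u x = 0"
      proof (rule ccontr)
        assume "u x \<noteq> 0"
        then show False
          using scaled[of "(K + 1) / u x"] True K0 by simp
      qed
      then show ?thesis using True by simp
    next
      case False
      then have "N u > 0" using N_nonneg[of u] by simp
      then show ?thesis
        using scaled[of "inverse (N u)"] by (simp add: abs_mult field_simps)
    qed
  qed
  then show thesis using that K0 by blast
qed

sublocale normed_function_space X N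
proof
  show "(\<lambda>_. 0) \<in> X" by (rule X_zero)
  show "(\<lambda>x. a * u x + b * v x) \<in> X" if "u \<in> X" "v \<in> X" for u v a b
    by (rule X_lincomb[OF that])
  show "0 \<le> N u" for u by (rule N_nonneg)
  show "N (\<lambda>x. a * u x) = \<bar>a\<bar> * N u" if "u \<in> X" for u a
    by (rule N_scale[OF that])
  show "N (\<lambda>x. u x + v x) \<le> N u + N v" if "u \<in> X" "v \<in> X" for u v
    by (rule N_triangle[OF that])
  show "u = (\<lambda>_. 0)" if "u \<in> X" "N u = 0" for u
  proof -
    obtain K where K: "K \<ge> 0" "\<And>u x. u \<in> X \<Longrightarrow> \<bar>u x\<bar> \<le> K * N u"
      using sup_le_N by blast
    have "\<bar>u x\<bar> \<le> 0" for x
      using K(2)[OF that(1), of x] that(2) by simp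
    then show ?thesis by (auto simp: fun_eq_iff)
  qed
qed

lemma N_tendsto_0_iff: "(\<lambda>n. N (s n)) \<longlonglongrightarrow> 0 \<longleftrightarrow> (\<lambda>n. energy (s n)) \<longlonglongrightarrow> 0"
proof
  assume "(\<lambda>n. N (s n)) \<longlonglongrightarrow> 0"
  then have "(\<lambda>n. N (s n) powr p) \<longlonglongrightarrow> 0 powr p"
    using p_gt_1 by (intro tendsto_powr') (auto simp: N_nonneg)
  then show "(\<lambda>n. energy (s n)) \<longlonglongrightarrow> 0"
    using p_gt_1 by (simp add: energy_eq)
next
  assume "(\<lambda>n. energy (s n)) \<longlonglongrightarrow> 0"
  then have "(\<lambda>n. energy (s n) powr (1 / p)) \<longlonglongrightarrow> 0 powr (1 / p)"
    using p_gt_1 by (intro tendsto_powr') (auto simp: energy_nonneg)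
  then show "(\<lambda>n. N (s n)) \<longlonglongrightarrow> 0"
    using p_gt_1 by (simp add: N_eq)
qed

section \<open>Completeness of the periodic space\<close>

lemma continuous_Lp:
  assumes c: "continuous_on {0..T} u"
  shows "u \<in> Lp T p"
proof -
  have "(\<lambda>x. indicator {0<..<T} x *\<^sub>R u x) \<in> borel_measurable borel"
    by (intro borel_measurable_continuous_on_indicator continuous_on_subset[OF c]) auto
  then have "(\<lambda>x. indicator {0<..<T} x *\<^sub>R u x) \<in> borel_measurable lebesgue"
    by (intro measurable_completion) simp
  then have m [measurable]: "u \<in> borel_measurable \<mu>"
    unfolding interval_measure_def by (subst borel_measurable_restrict_space_iff) auto
  have "bounded (u ` {0..T})"
    by (intro compact_imp_bounded compact_continuous_image c) simp
  then obtain Q where Q: "\<And>x. x \<in> {0..T} \<Longrightarrow> \<bar>u x\<bar> \<le> Q"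
    unfolding bounded_iff real_norm_def by (metis imageI)
  have "integrable \<mu> (\<lambda>x. \<bar>u x\<bar> powr p)"
  proof (rule integrable_const_bound[of _ "Q powr p"])
    show "AE x in \<mu>. norm (\<bar>u x\<bar> powr p) \<le> Q powr p"
      using Q p_gt_1 by (intro AE_I2) (auto intro!: powr_mono2)
  qed simp
  then show ?thesis using m by (simp add: Lp_iff)
qed

text \<open>Values converge uniformly by \<open>sup_le_N\<close>, derivatives in \<open>p\<close>-th
  mean by \<open>Lp_complete\<close>; the weak identity links the two limits.\<close>

lemma X_complete:
  assumes s: "\<And>n. s n \<in> X"
    and cauchy: "\<And>e. e > 0 \<Longrightarrow> \<exists>M. \<forall>m\<ge>M. \<forall>n\<ge>M. N (s m - s n) < e"
  obtains u where "u \<in> X" "(\<lambda>n. N (s n - u)) \<longlonglongrightarrow> 0"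
proof -
  have Ds: "D (s n) \<in> borel_measurable \<mu>" "integrable \<mu> (\<lambda>x. \<bar>D (s n) x\<bar> powr p)" for n
    using X_measurable[OF s] by auto
  have Ddiff: "AE x in \<mu>. D (v - w) x = D v x - D w x" if "v \<in> X" "w \<in> X" for v w
    using deriv_lincomb[OF that, of 1 "-1"] by (simp add: fun_diff_def)
  have Dcauchy: "\<exists>M. \<forall>m\<ge>M. \<forall>n\<ge>M. (LINT x|\<mu>. \<bar>D (s m) x - D (s n) x\<bar> powr p) < e" if e: "e > 0" for e
  proof -
    obtain M where M: "\<And>m n. m \<ge> M \<Longrightarrow> n \<ge> M \<Longrightarrow> N (s m - s n) < e powr (1 / p)"
      using cauchy[of "e powr (1 / p)"] e by auto
    have "(LINT x|\<mu>. \<bar>D (s m) x - D (s n) x\<bar> powr p) < e" if "m \<ge> M" "n \<ge> M" for m n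
    proof -
      have d: "s m - s n \<in> X" by (intro diff_in s)
      have "(LINT x|\<mu>. \<bar>D (s m) x - D (s n) x\<bar> powr p) = (LINT x|\<mu>. \<bar>D (s m - s n) x\<bar> powr p)"
      proof (rule integral_cong_AE)
        show "AE x in \<mu>. \<bar>D (s m) x - D (s n) x\<bar> powr p = \<bar>D (s m - s n) x\<bar> powr p"
          using Ddiff[OF s[of m] s[of n]] by eventually_elim simp
      qed (use Ds X_measurable(2)[OF d] in measurable)
      also have "\<dots> \<le> energy (s m - s n)"
        by (rule integral_abs_deriv_powr_le[OF d])
      also have "\<dots> < (e powr (1 / p)) powr p"
        unfolding energy_eq using M[OF that] N_nonneg p_gt_1 by (intro powr_less_mono2) auto
      also have "\<dots> = e" using e p_gt_1 by (simp add: powr_powr)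
      finally show ?thesis .
    qed
    then show ?thesis by blast
  qed
  obtain g where g: "g \<in> borel_measurable \<mu>" "integrable \<mu> (\<lambda>x. \<bar>g x\<bar> powr p)"
    "(\<lambda>n. LINT x|\<mu>. \<bar>D (s n) x - g x\<bar> powr p) \<longlonglongrightarrow> 0"
    by (rule Lp_complete[OF p_gt_1 Ds Dcauchy])
  obtain K where K: "K \<ge> 0" "\<And>u x. u \<in> X \<Longrightarrow> \<bar>u x\<bar> \<le> K * N u"
    using sup_le_N by blast
  have "uniformly_Cauchy_on UNIV s"
  proof (rule uniformly_Cauchy_onI)
    fix e :: real assume e: "e > 0"
    then have "e / (K + 1) > 0" using K(1) by simp
    then obtain M where M: "\<And>m n. m \<ge> M \<Longrightarrow> n \<ge> M \<Longrightarrow> N (s m - s n) < e / (K + 1)"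
      using cauchy by blast
    have "dist (s m x) (s n x) < e" if "m \<ge> M" "n \<ge> M" for m n x
    proof -
      have "\<bar>(s m - s n) x\<bar> \<le> K * N (s m - s n)"
        by (intro K diff_in s)
      also have "\<dots> \<le> K * (e / (K + 1))"
        using M[OF that] K by (intro mult_left_mono) auto
      also have "\<dots> < e" using e K by (simp add: field_simps)
      finally show ?thesis by (simp add: dist_real_def)
    qed
    then show "\<exists>M. \<forall>x\<in>UNIV. \<forall>m\<ge>M. \<forall>n\<ge>M. dist (s m x) (s n x) < e"
      by blast
  qed
  then obtain u where u: "uniform_limit UNIV s u sequentially"
    using Cauchy_uniformly_convergent uniformly_convergent_on_def by blast
  have lim: "(\<lambda>n. s n x) \<longlonglongrightarrow> u x" for x
    using tendsto_uniform_limitI[OF u] by simp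
  \<comment> \<open>Uniform convergence yields the continuous representative directly; the endpoint
    condition and the value 0 outside [0,T] survive pointwise limits.\<close>
  have cont: "continuous_on {0..T} u"
  proof (rule uniform_limit_theorem)
    show "uniform_limit {0..T} s u sequentially"
      by (rule uniform_limit_on_subset[OF u]) simp
    show "\<forall>\<^sub>F n in sequentially. continuous_on {0..T} (s n)"
      using X_D(4)[OF s] by simp
  qed simp
  have uLp: "u \<in> Lp T p" by (rule continuous_Lp[OF cont])
  have gLp: "g \<in> Lp T p" using g by (simp add: Lp_iff)
  have um: "u \<in> borel_measurable \<mu>" "integrable \<mu> (\<lambda>x. \<bar>u x\<bar> powr p)"
    using uLp by (auto simp: Lp_iff)
  have sm: "s n \<in> borel_measurable \<mu>" "integrable \<mu> (\<lambda>x. \<bar>s n x\<bar> powr p)" for n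
    using X_measurable[OF s] by auto
  have ul: "(\<lambda>n. LINT x|\<mu>. \<bar>s n x - u x\<bar> powr p) \<longlonglongrightarrow> 0"
  proof (rule LIMSEQ_I)
    fix e :: real assume e: "e > 0"
    \<comment> \<open>A uniform distance \<open>d\<close> contributes at most
      \<open>T * d powr p\<close>, which is \<open>e / 2\<close>.\<close>
    define d where "d = (e / (2 * T)) powr (1 / p)"
    have d: "d > 0" "d powr p = e / (2 * T)"
      using e T_pos p_gt_1 by (auto simp: d_def powr_powr)
    have "\<forall>\<^sub>F n in sequentially. \<forall>x\<in>UNIV. dist (s n x) (u x) < d"
      using u d(1) by (simp add: uniform_limit_iff)
    then have "\<forall>\<^sub>F n in sequentially. norm ((LINT x|\<mu>. \<bar>s n x - u x\<bar> powr p) - 0) < e"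
    proof eventually_elim
      case (elim n)
      have "(LINT x|\<mu>. \<bar>s n x - u x\<bar> powr p) \<le> (LINT x|\<mu>. d powr p)"
      proof (rule integral_mono)
        show "integrable \<mu> (\<lambda>x. \<bar>s n x - u x\<bar> powr p)"
          by (intro integrable_abs_powr_diff p_gt_1 um sm)
        show "\<bar>s n x - u x\<bar> powr p \<le> d powr p" for x
          using elim p_gt_1 by (intro powr_mono2) (auto simp: dist_real_def less_imp_le)
      qed simp
      also have "\<dots> = T * (e / (2 * T))"
        using T_pos by (simp add: d measure_interval_measure)
      also have "\<dots> < e" using e T_pos by simp
      finally show ?case by simp
    qed
    then show "\<exists>no. \<forall>n\<ge>no. norm ((LINT x|\<mu>. \<bar>s n x - u x\<bar> powr p) - 0) < e"
      by (simp add: eventually_sequentially)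
  qed
  have w: "has_weak_deriv T u g"
    unfolding has_weak_deriv_def
  proof (intro conjI ballI locally_integrable_of_Lp uLp gLp)
    fix \<phi> assume \<phi>: "\<phi> \<in> test_functions T"
    obtain K where K: "compact K" "\<And>x. x \<notin> K \<Longrightarrow> \<phi> x = 0" "\<And>x. x \<notin> K \<Longrightarrow> deriv \<phi> x = 0"
      "continuous_on UNIV \<phi>" "continuous_on UNIV (deriv \<phi>)"
      using test_function_props[OF \<phi>] by metis
    have props: "\<psi> \<in> borel_measurable \<mu> \<and> (\<exists>B. \<forall>x. \<bar>\<psi> x\<bar> \<le> B)"
      if c: "continuous_on UNIV \<psi>" and z: "\<And>x. x \<notin> K \<Longrightarrow> \<psi> x = 0" for \<psi> :: "real \<Rightarrow> real"
    proof
      have "\<psi> \<in> borel_measurable lebesgue"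
        using borel_measurable_continuous_onI[OF c] by (simp add: measurable_completion)
      then show "\<psi> \<in> borel_measurable \<mu>"
        unfolding interval_measure_def by (rule measurable_restrict_space1)
      have "bounded (\<psi> ` K)"
        using K(1) c by (intro compact_imp_bounded compact_continuous_image) (auto intro: continuous_on_subset)
      then obtain B where B: "\<And>x. x \<in> K \<Longrightarrow> \<bar>\<psi> x\<bar> \<le> B"
        unfolding bounded_iff real_norm_def by (metis imageI)
      have "\<bar>\<psi> x\<bar> \<le> \<bar>B\<bar>" for x
        using B[of x] z[of x] by (cases "x \<in> K") auto
      then show "\<exists>B. \<forall>x. \<bar>\<psi> x\<bar> \<le> B" by blast
    qed
    obtain B B' where B: "\<phi> \<in> borel_measurable \<mu>" "\<And>x. \<bar>\<phi> x\<bar> \<le> B"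
      "deriv \<phi> \<in> borel_measurable \<mu>" "\<And>x. \<bar>deriv \<phi> x\<bar> \<le> B'"
      using props[OF K(4,2)] props[OF K(5,3)] by blast
    have l1: "(\<lambda>n. LINT x|\<mu>. s n x * deriv \<phi> x) \<longlonglongrightarrow> (LINT x|\<mu>. u x * deriv \<phi> x)"
      by (rule tendsto_integral_mult_bounded[OF p_gt_1 sm(1) um(1) B(3) sm(2) um(2) ul B(4)])
    have l2: "(\<lambda>n. LINT x|\<mu>. D (s n) x * \<phi> x) \<longlonglongrightarrow> (LINT x|\<mu>. g x * \<phi> x)"
      by (rule tendsto_integral_mult_bounded[OF p_gt_1 Ds(1) g(1) B(1) Ds(2) g(2) g(3) B(2)])
    have eq: "(LINT x|\<mu>. s n x * deriv \<phi> x) = - (LINT x|\<mu>. D (s n) x * \<phi> x)" for n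
      using X_D(1)[OF s, of n] \<phi> by (simp add: has_weak_deriv_def set_integral_interval_measure)
    have "(LINT x|\<mu>. u x * deriv \<phi> x) = - (LINT x|\<mu>. g x * \<phi> x)"
      by (rule LIMSEQ_unique[OF l1]) (use tendsto_minus[OF l2] in \<open>simp add: eq\<close>)
    then show "(LINT x:{0<..<T}|lebesgue. u x * deriv \<phi> x) = - (LINT x:{0<..<T}|lebesgue. g x * \<phi> x)"
      by (simp add: set_integral_interval_measure)
  qed
  have uX: "u \<in> X"
  proof (rule X_I[OF uLp w gLp cont])
    show "u x = 0" if "x \<notin> {0..T}" for x
      using lim[of x] X_D(5)[OF s that] by (simp add: LIMSEQ_const_iff)
    show "u 0 = u T"
      using lim[of 0] lim[of T] X_D(6)[OF s] LIMSEQ_unique by auto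
  qed
  obtain Q where Q: "Q \<ge> 0" "\<And>x. x \<in> {0<..<T} \<Longrightarrow> \<bar>q x\<bar> \<le> Q"
    using q_bounded by blast
  have "(\<lambda>n. energy (s n - u)) \<longlonglongrightarrow> 0"
  proof (rule tendsto_sandwich[OF _ _ tendsto_const])
    show "\<forall>\<^sub>F n in sequentially. 0 \<le> energy (s n - u)"
      by (simp add: energy_nonneg)
    have "(\<lambda>n. (LINT x|\<mu>. \<bar>D (s n) x - g x\<bar> powr p) + Q * (LINT x|\<mu>. \<bar>s n x - u x\<bar> powr p)) \<longlonglongrightarrow> 0 + Q * 0"
      by (intro tendsto_intros g ul)
    then show "(\<lambda>n. (LINT x|\<mu>. \<bar>D (s n) x - g x\<bar> powr p) + Q * (LINT x|\<mu>. \<bar>s n x - u x\<bar> powr p)) \<longlonglongrightarrow> 0"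
      by simp
    show "\<forall>\<^sub>F n in sequentially. energy (s n - u) \<le> (LINT x|\<mu>. \<bar>D (s n) x - g x\<bar> powr p) + Q * (LINT x|\<mu>. \<bar>s n x - u x\<bar> powr p)"
    proof (intro always_eventually allI)
      fix n
      have i: "integrable \<mu> (\<lambda>x. \<bar>D (s n) x - g x\<bar> powr p)" "integrable \<mu> (\<lambda>x. \<bar>s n x - u x\<bar> powr p)"
        by (intro integrable_abs_powr_diff p_gt_1 um sm Ds g)+
      have "energy (s n - u) \<le> (LINT x|\<mu>. \<bar>D (s n) x - g x\<bar> powr p + Q * \<bar>s n x - u x\<bar> powr p)"
        unfolding energy_def
      proof (rule integral_mono_AE)
        show "integrable \<mu> (\<lambda>x. \<bar>D (s n - u) x\<bar> powr p + q x * \<bar>(s n - u) x\<bar> powr p)"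
          by (intro Bochner_Integration.integrable_add integrable_q_mult X_measurable diff_in s uX)
        show "integrable \<mu> (\<lambda>x. \<bar>D (s n) x - g x\<bar> powr p + Q * \<bar>s n x - u x\<bar> powr p)"
          using i by simp
        have "AE x in \<mu>. x \<in> space \<mu>" by (rule AE_space)
        then show "AE x in \<mu>. \<bar>D (s n - u) x\<bar> powr p + q x * \<bar>(s n - u) x\<bar> powr p
            \<le> \<bar>D (s n) x - g x\<bar> powr p + Q * \<bar>s n x - u x\<bar> powr p"
          using Ddiff[OF s[of n] uX] weak_deriv_AE_eq[OF w]
        proof eventually_elim
          case (elim x)
          then have "q x * \<bar>s n x - u x\<bar> powr p \<le> Q * \<bar>s n x - u x\<bar> powr p"
            using Q(2)[of x] by (intro mult_right_mono) auto
          then show ?case using elim by simp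
        qed
      qed
      also have "\<dots> = (LINT x|\<mu>. \<bar>D (s n) x - g x\<bar> powr p) + Q * (LINT x|\<mu>. \<bar>s n x - u x\<bar> powr p)"
        using i by simp
      finally show "energy (s n - u) \<le> (LINT x|\<mu>. \<bar>D (s n) x - g x\<bar> powr p) + Q * (LINT x|\<mu>. \<bar>s n x - u x\<bar> powr p)" .
    qed
  qed
  then show thesis
    using that[OF uX] by (simp add: N_tendsto_0_iff)
qed

end

section \<open>The operator\<close>

context periodic_sobolev
begin

abbreviation L :: "(real \<Rightarrow> real) \<Rightarrow> (real \<Rightarrow> real) \<Rightarrow> real" where "L \<equiv> L_op T p q"

section \<open>Boundedness and continuity of the operator\<close>

text \<open>The estimate \<open>abs_form_le\<close> is not homogeneous in \<open>v\<close>; for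
  \<open>v\<close> scaled to norm 1 its right side is \<open>energy u + 1\<close>.\<close>

lemma form_bounded:
  assumes u: "u \<in> X" and v: "v \<in> X"
  shows "\<bar>form u v\<bar> \<le> (energy u + 1) * N v"
proof (cases "N v = 0")
  case True
  then have "v = (\<lambda>_. 0)" using norm_zero_imp[OF v] by blast
  then have "form u v = 0"
    using form_right_lincomb[OF u v v, of 0 0] by simp
  then show ?thesis using True by simp
next
  case False
  then have n: "N v > 0" using N_nonneg[of v] by simp
  define w where "w = (\<lambda>x. inverse (N v) * v x)"
  have w: "w \<in> X" "N w = 1"
    unfolding w_def using scale_in[OF v] N_scale[OF v, of "inverse (N v)"] n by auto
  have "form u w = inverse (N v) * form u v"
    using form_right_lincomb[OF u v v, of "inverse (N v)" 0] by (simp add: w_def)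
  then have "inverse (N v) * \<bar>form u v\<bar> \<le> energy u + 1"
    using abs_form_le[OF u w(1)] energy_eq[of w] w(2) n by (simp add: abs_mult)
  then show ?thesis
    using n by (simp add: field_simps)
qed

lemma L_dual:
  assumes u: "u \<in> X"
  shows "L u \<in> dual_space X N"
proof -
  have "L u (\<lambda>x. a * v x + b * w x) = a * L u v + b * L u w" if "v \<in> X" "w \<in> X" for v w a b
    using that X_lincomb[OF that] form_right_lincomb[OF u that] by (simp add: L_op_eq)
  moreover have "\<forall>v\<in>X. \<bar>L u v\<bar> \<le> (energy u + 1) * N v"
    using form_bounded[OF u] by (simp add: L_op_eq)
  moreover have "L u v = 0" if "v \<notin> X" for v
    using that by (simp add: L_op_def)
  ultimately show ?thesis
    unfolding dual_space_def by blast
qed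

lemma L_diff_apply: "w \<in> X \<Longrightarrow> (L u - L v) w = form u w - form v w"
  by (simp add: L_op_eq)

sublocale dual: normed_function_space "dual_space X N" "dual_norm X N"
  by (rule normed_dual_space)

lemma L_continuous_at:
  assumes u: "u \<in> X" and e: "e > 0"
  obtains d where "d > 0" "\<And>v. v \<in> X \<Longrightarrow> N (v - u) < d \<Longrightarrow> dual_norm X N (L v - L u) < e"
proof -
  \<comment> \<open>Bounds the energy of every function at distance less than 1 from
    \<open>u\<close>, which is why \<open>d \<le> 1\<close> below.\<close>
  define R where "R = (N u + 1) powr p"
  have R: "R \<ge> 0" "energy u \<le> R"
    unfolding R_def energy_eq using N_nonneg p_gt_1 by (auto intro!: powr_mono2)
  \<comment> \<open>The two energies and the test direction contribute at most
    \<open>2 * R + 1\<close>, hence an error of \<open>e / 4\<close>; \<open>d\<close> makes the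
    other term at most \<open>e / 4\<close> too. The dual norm is a supremum, so a bound below
    \<open>e\<close> is needed for strictness.\<close>
  define \<epsilon> where "\<epsilon> = e / (4 * (2 * R + 1))"
  have \<epsilon>: "\<epsilon> > 0" "\<epsilon> * (2 * R + 1) = e / 4"
    using e R by (auto simp: \<epsilon>_def field_simps)
  obtain C where C: "C \<ge> 0" "\<And>u v w. u \<in> X \<Longrightarrow> v \<in> X \<Longrightarrow> w \<in> X \<Longrightarrow>
    \<bar>form u w - form v w\<bar> \<le> \<epsilon> * (energy u + energy v + energy w) + C * energy (u - v)"
    using form_diff_le[OF \<epsilon>(1)] by blast
  define d where "d = min 1 ((e / (4 * (C + 1))) powr (1 / p))"
  have d: "d > 0" "d \<le> 1" using e C(1) by (auto simp: d_def)
  have "d powr p \<le> ((e / (4 * (C + 1))) powr (1 / p)) powr p"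
    using d p_gt_1 by (intro powr_mono2) (auto simp: d_def)
  also have "\<dots> = e / (4 * (C + 1))"
    using e C(1) p_gt_1 by (simp add: powr_powr)
  finally have dp: "d powr p \<le> e / (4 * (C + 1))" .
  have "C * d powr p \<le> C * (e / (4 * (C + 1)))"
    using dp C(1) by (rule mult_left_mono)
  also have "\<dots> \<le> e / 4"
    using e C(1) by (simp add: field_simps)
  finally have Cd: "C * d powr p \<le> e / 4" .
  have "dual_norm X N (L v - L u) < e" if v: "v \<in> X" and vd: "N (v - u) < d" for v
  proof -
    have "N v \<le> N u + 1"
      using norm_le_add_diff[OF v u] vd d by simp
    then have ev: "energy v \<le> R"
      unfolding R_def energy_eq using N_nonneg p_gt_1 by (intro powr_mono2) auto
    have ed: "energy (v - u) \<le> d powr p"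
      unfolding energy_eq using vd N_nonneg p_gt_1 by (intro powr_mono2) auto
    have "dual_norm X N (L v - L u) \<le> e / 2"
    proof (rule dual_norm_leI)
      fix w assume w: "w \<in> X" "N w \<le> 1"
      have ew: "energy w \<le> 1" using w(2) N_le_iff[of 1] by simp
      have "\<bar>(L v - L u) w\<bar> \<le> \<epsilon> * (energy v + energy u + energy w) + C * energy (v - u)"
        unfolding L_diff_apply[OF w(1)] by (rule C(2)[OF v u w(1)])
      also have "\<dots> \<le> \<epsilon> * (2 * R + 1) + C * d powr p"
        using \<epsilon>(1) ev R ew ed C(1) by (intro add_mono mult_left_mono) auto
      finally show "\<bar>(L v - L u) w\<bar> \<le> e / 2"
        using \<epsilon>(2) Cd by linarith
    qed
    then show ?thesis using e by simp
  qed
  then show thesis using that d(1) by blast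
qed

lemma continuous_map_L: "continuous_map (norm_topology X N) (dual_topology X N) L"
  unfolding dual_topology_def
proof (rule continuous_map_norm_topology)
  show "normed_function_space X N" by unfold_locales
  show "normed_function_space (dual_space X N) (dual_norm X N)" by (rule normed_dual_space)
  show "L u \<in> dual_space X N" if "u \<in> X" for u by (rule L_dual[OF that])
  show "\<exists>d>0. \<forall>v\<in>X. N (v - u) < d \<longrightarrow> dual_norm X N (L v - L u) < e" if "u \<in> X" "e > 0" for u e
    by (rule L_continuous_at[OF that]) blast
qed

section \<open>Strict monotonicity and the (S+) property\<close>

text \<open>If the pairing were nonpositive, so would be its product with the constant
  \<open>C\<close>, however large; the energy of \<open>u - v\<close> would be below every multiple
  of the error term.\<close>

lemma strictly_monotone_L: "strictly_monotone X L"
  unfolding strictly_monotone_def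
proof (intro ballI impI, rule ccontr)
  fix u v assume u: "u \<in> X" and v: "v \<in> X" and "u \<noteq> v" and "\<not> (L u - L v) (u - v) > 0"
  then have le: "form u (u - v) - form v (u - v) \<le> 0"
    unfolding L_diff_apply[OF diff_in[OF u v]] by linarith
  have "energy (u - v) \<le> 0"
  proof (rule field_le_epsilon)
    fix e :: real assume e: "e > 0"
    define \<epsilon> where "\<epsilon> = e / (energy u + energy v + 1)"
    have s: "energy u + energy v \<ge> 0" using energy_nonneg[of u] energy_nonneg[of v] by simp
    have \<epsilon>: "\<epsilon> > 0" "\<epsilon> * (energy u + energy v) \<le> e"
      using e s by (auto simp: \<epsilon>_def field_simps)
    obtain C where C: "C \<ge> 0" "\<And>u v. u \<in> X \<Longrightarrow> v \<in> X \<Longrightarrow>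
      energy (u - v) \<le> \<epsilon> * (energy u + energy v) + C * (form u (u - v) - form v (u - v))"
      using energy_diff_le[OF \<epsilon>(1)] by blast
    have "C * (form u (u - v) - form v (u - v)) \<le> 0"
      using C(1) le by (rule mult_nonneg_nonpos)
    then show "energy (u - v) \<le> 0 + e"
      using C(2)[OF u v] \<epsilon>(2) by linarith
  qed
  then have "N (u - v) = 0"
    using N_le_iff[of 0 "u - v"] N_nonneg[of "u - v"] p_gt_1 by simp
  then have "u - v = (\<lambda>_. 0)"
    by (rule norm_zero_imp[OF diff_in[OF u v]])
  then have "u = v" by (auto simp: fun_eq_iff)
  with \<open>u \<noteq> v\<close> show False ..
qed

lemma type_S_plus_L: "type_S_plus X N L"
  unfolding type_S_plus_def
proof (intro allI impI)
  fix s u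
  assume w: "weakly_converges X N s u"
    and ls: "limsup (\<lambda>n. ereal ((L (s n) - L u) (s n - u))) \<le> 0"
  have s: "s n \<in> X" and u: "u \<in> X" for n
    using w by (auto simp: weakly_converges_def)
  define g where "g n = form (s n) (s n - u) - form u (s n - u)" for n
  have g: "eventually (\<lambda>n. g n < \<eta>) sequentially" if "\<eta> > 0" for \<eta>
  proof -
    have "(L (s n) - L u) (s n - u) = g n" for n
      unfolding g_def by (rule L_diff_apply[OF diff_in[OF s u]])
    then have "limsup (\<lambda>n. ereal (g n)) < ereal \<eta>"
      using ls that by (simp add: zero_ereal_def order.strict_trans1)
    from Limsup_lessD[OF this] show ?thesis by simp
  qed
  obtain C1 where C1: "C1 \<ge> 0" "\<And>u v. u \<in> X \<Longrightarrow> v \<in> X \<Longrightarrow>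
    energy u \<le> 2 * (form u (u - v) - form v (u - v)) + C1 * energy v"
    using energy_le_form_diff by blast
  \<comment> \<open>The coercivity bound for those \<open>n\<close> for which the pairing is below
    1.\<close>
  define R where "R = 2 + C1 * energy u"
  have R: "R \<ge> 0" using C1(1) energy_nonneg[of u] by (simp add: R_def)
  have bdd: "eventually (\<lambda>n. energy (s n) \<le> R) sequentially"
    using g[OF zero_less_one]
  proof eventually_elim
    case (elim n)
    then show ?case using C1(2)[OF s u, of n] by (simp add: R_def g_def)
  qed
  have "(\<lambda>n. energy (s n - u)) \<longlonglongrightarrow> 0"
  proof (rule LIMSEQ_I)
    fix e :: real assume e: "e > 0"
    define \<epsilon> where "\<epsilon> = e / (2 * (R + energy u + 1))"
    have \<epsilon>: "\<epsilon> > 0" "\<epsilon> * (R + energy u) \<le> e / 2"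
      using e R energy_nonneg[of u] by (auto simp: \<epsilon>_def field_simps add_pos_nonneg)
    obtain C where C: "C \<ge> 0" "\<And>u v. u \<in> X \<Longrightarrow> v \<in> X \<Longrightarrow>
      energy (u - v) \<le> \<epsilon> * (energy u + energy v) + C * (form u (u - v) - form v (u - v))"
      using energy_diff_le[OF \<epsilon>(1)] by blast
    \<comment> \<open>The constant \<open>C\<close> depends on \<open>\<epsilon>\<close>, so the
      level for the pairing is fixed only now; it makes the second term less than
      \<open>e / 2\<close>.\<close>
    have pos: "e / (2 * (C + 1)) > 0" using e C(1) by simp
    have "eventually (\<lambda>n. norm (energy (s n - u) - 0) < e) sequentially"
      using bdd g[OF pos]
    proof eventually_elim
      case (elim n)
      have "energy (s n - u) \<le> \<epsilon> * (energy (s n) + energy u) + C * g n"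
        unfolding g_def by (rule C(2)[OF s u])
      also have "\<dots> \<le> \<epsilon> * (R + energy u) + C * (e / (2 * (C + 1)))"
        using elim \<epsilon>(1) C(1) by (intro add_mono mult_left_mono) auto
      also have "C * (e / (2 * (C + 1))) < e / 2"
        using e C(1) by (simp add: field_simps)
      finally show ?case using \<epsilon>(2) energy_nonneg[of "s n - u"] by simp
    qed
    then show "\<exists>no. \<forall>n\<ge>no. norm (energy (s n - u) - 0) < e"
      by (simp add: eventually_sequentially)
  qed
  then show "limitin (norm_topology X N) s u sequentially"
    using N_tendsto_0_iff[of "\<lambda>n. s n - u"] by (intro limitin_norm_topology s u) simp
qed

section \<open>Surjectivity by minimisation\<close>

text \<open>Division of \<open>N u powr p \<le> K * N u\<close> by the norm. It gives coercivity of
  the minimised functional and bounds preimages under \<open>L\<close>.\<close>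

lemma N_powr_le:
  assumes "energy u \<le> K * N u" "K > 0"
  shows "N u \<le> K powr (1 / (p - 1))"
proof (cases "N u = 0")
  case False
  then have n: "N u > 0" using N_nonneg[of u] by simp
  have "N u powr (p - 1) * N u = N u powr p"
    using n powr_add[of "N u" "p - 1" 1] by simp
  then have "N u powr (p - 1) * N u \<le> K * N u"
    using assms(1) by (simp add: energy_eq)
  then have "N u powr (p - 1) \<le> K"
    using n by (rule mult_right_le_imp_le)
  then have "(N u powr (p - 1)) powr (1 / (p - 1)) \<le> K powr (1 / (p - 1))"
    using p_gt_1 by (intro powr_mono2) auto
  then show ?thesis
    using n p_gt_1 by (simp add: powr_powr)
qed simp

lemma minimizer_exists:
  assumes f: "f \<in> dual_space X N"
  obtains u where "u \<in> X" "\<And>v. v \<in> X \<Longrightarrow> energy u / p - f u \<le> energy v / p - f v"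
proof -
  define J where "J u = energy u / p - f u" for u
  define C where "C = dual_norm X N f"
  have C: "C \<ge> 0" "\<And>u. u \<in> X \<Longrightarrow> \<bar>f u\<bar> \<le> C * N u"
    unfolding C_def using dual_norm_nonneg[OF f] dual_bound[OF f] by auto
  \<comment> \<open>Outside the ball of this radius the energy exceeds
    \<open>p * (C + 1) * N u\<close>, so that \<open>J u \<ge> N u\<close> although \<open>f\<close>
    may take away \<open>C * N u\<close>.\<close>
  define R where "R = (p * (C + 1)) powr (1 / (p - 1))"
  have R: "R \<ge> 0" by (simp add: R_def)
  have large: "N u \<le> J u" if u: "u \<in> X" and "N u > R" for u
  proof -
    have "\<not> energy u \<le> p * (C + 1) * N u"
      using N_powr_le[of u "p * (C + 1)"] that C(1) p_gt_1 by (auto simp: R_def)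
    then have "(C + 1) * N u \<le> energy u / p"
      using p_gt_1 by (simp add: field_simps)
    then show ?thesis
      using C(2)[OF u] by (simp add: J_def algebra_simps)
  qed
  have lower: "J u \<ge> - (C * R)" if u: "u \<in> X" for u
  proof (cases "N u > R")
    case True
    then show ?thesis using large[OF u] N_nonneg[of u] mult_nonneg_nonneg[OF C(1) R] by linarith
  next
    case False
    then have "C * N u \<le> C * R" using C(1) by (intro mult_left_mono) auto
    moreover have "energy u / p \<ge> 0" using energy_nonneg p_gt_1 by simp
    ultimately show ?thesis using C(2)[OF u] by (simp add: J_def)
  qed
  define m where "m = Inf (J ` X)"
  have bdd: "bdd_below (J ` X)"
    using lower by (auto intro!: bdd_belowI[of _ "- (C * R)"])
  have m_le: "m \<le> J u" if "u \<in> X" for u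
    unfolding m_def using bdd that by (intro cInf_lower) auto
  have ne: "J ` X \<noteq> {}" using X_zero by blast
  have "\<exists>u\<in>X. J u < m + 1 / (real n + 1)" for n
  proof -
    have "Inf (J ` X) < m + 1 / (real n + 1)" by (simp add: m_def add_pos_nonneg)
    from cInf_lessD[OF ne this] show ?thesis by blast
  qed
  then obtain s where s: "\<And>n. s n \<in> X" "\<And>n. J (s n) < m + 1 / (real n + 1)"
    by metis
  have "f (\<lambda>_. 0) = 0" using dual_scale[OF f X_zero, of 0] by simp
  then have "m \<le> 0" using m_le[OF X_zero] by (simp add: J_def energy_zero)
  have J1: "J (s n) \<le> 1" for n
  proof -
    have "1 / (real n + 1) \<le> 1" by simp
    then show ?thesis using s(2)[of n] \<open>m \<le> 0\<close> by linarith
  qed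
  \<comment> \<open>Since \<open>m \<le> J 0 = 0\<close>, all \<open>J (s n)\<close> are at most 1;
    a norm above \<open>R\<close> is bounded by \<open>J\<close>, hence by 1.\<close>
  define E where "E = (max R 1) powr p"
  have E: "E \<ge> 0" "energy (s n) \<le> E" for n
  proof -
    have "N (s n) \<le> max R 1"
      using large[OF s(1), of n] J1[of n] by (cases "N (s n) > R") auto
    then show "energy (s n) \<le> E"
      unfolding E_def energy_eq using N_nonneg p_gt_1 by (intro powr_mono2) auto
  qed (simp add: E_def)
  \<comment> \<open>The linear part \<open>f\<close> cancels in the midpoint defect, so the defect
    of the energy is \<open>p\<close> times that of \<open>J\<close>, and \<open>J\<close> at the
    midpoint is at least \<open>m\<close>.\<close>
  have mid: "energy u + energy v - 2 * energy (\<lambda>x. 1/2 * u x + 1/2 * v x) \<le> p * (J u + J v - 2 * m)"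
    if "u \<in> X" "v \<in> X" for u v
  proof -
    let ?w = "\<lambda>x. 1/2 * u x + 1/2 * v x"
    have "?w \<in> X" by (rule X_lincomb[OF that])
    from m_le[OF this] have "m \<le> energy ?w / p - (1/2 * f u + 1/2 * f v)"
      using dual_lincomb[OF f that, of "1/2" "1/2"] by (simp add: J_def)
    then have "p * m \<le> p * (energy ?w / p - (1/2 * f u + 1/2 * f v))"
      using p_gt_1 by (intro mult_left_mono) auto
    then have "p * m \<le> energy ?w - p * (1/2 * f u + 1/2 * f v)"
      using p_gt_1 by (simp add: right_diff_distrib)
    moreover have "p * (J u + J v - 2 * m) = energy u + energy v - 2 * (p * (1/2 * f u + 1/2 * f v)) - 2 * (p * m)"
      using p_gt_1 by (simp add: J_def algebra_simps)
    ultimately show ?thesis by linarith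
  qed
  have cauchy: "\<exists>M. \<forall>k\<ge>M. \<forall>n\<ge>M. N (s k - s n) < e" if e: "e > 0" for e
  proof -
    define \<eta> where "\<eta> = e powr p"
    have \<eta>: "\<eta> > 0" using e by (simp add: \<eta>_def)
    define \<epsilon> where "\<epsilon> = \<eta> / (4 * (E + 1))"
    have \<epsilon>: "\<epsilon> > 0" "\<epsilon> * (2 * E) \<le> \<eta> / 2"
      using \<eta> E(1) by (auto simp: \<epsilon>_def field_simps)
    obtain C' where C': "C' \<ge> 0" "\<And>u v. u \<in> X \<Longrightarrow> v \<in> X \<Longrightarrow>
      energy (u - v) \<le> \<epsilon> * (energy u + energy v) +
        C' * (energy u + energy v - 2 * energy (\<lambda>x. 1/2 * u x + 1/2 * v x))"
      using energy_uniformly_convex[OF \<epsilon>(1)] by blast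
    \<comment> \<open>Each \<open>J\<close> value exceeds \<open>m\<close> by less than
      \<open>1 / (real M + 1)\<close>, so the defect term is at most
      \<open>C' * (p * (2 / (real M + 1)))\<close>, and this \<open>M\<close> makes it less than
      \<open>\<eta> / 2\<close>.\<close>
    obtain M where M: "real M > 4 * C' * p / \<eta>"
      using reals_Archimedean2 by blast
    have "N (s k - s n) < e" if k: "k \<ge> M" and n: "n \<ge> M" for k n
    proof -
      have inv: "1 / (real j + 1) \<le> 1 / (real M + 1)" if "j \<ge> M" for j
        using that by (intro divide_left_mono) auto
      have "J (s k) + J (s n) - 2 * m \<le> 2 / (real M + 1)"
        using s(2)[of k] s(2)[of n] inv[OF k] inv[OF n] by linarith
      then have "p * (J (s k) + J (s n) - 2 * m) \<le> p * (2 / (real M + 1))"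
        using p_gt_1 by (intro mult_left_mono) auto
      then have "energy (s k) + energy (s n) - 2 * energy (\<lambda>x. 1/2 * s k x + 1/2 * s n x) \<le> p * (2 / (real M + 1))"
        using mid[OF s(1) s(1), of k n] by linarith
      then have "C' * (energy (s k) + energy (s n) - 2 * energy (\<lambda>x. 1/2 * s k x + 1/2 * s n x)) \<le> C' * (p * (2 / (real M + 1)))"
        using C'(1) by (rule mult_left_mono)
      moreover have "C' * (p * (2 / (real M + 1))) < \<eta> / 2"
      proof -
        have "4 * C' * p < \<eta> * (real M + 1)"
          using M \<eta> by (simp add: field_simps)
        then show ?thesis by (simp add: field_simps)
      qed
      moreover have "\<epsilon> * (energy (s k) + energy (s n)) \<le> \<epsilon> * (2 * E)"
        using \<epsilon>(1) E(2)[of k] E(2)[of n] by (intro mult_left_mono) auto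
      ultimately have "energy (s k - s n) < \<eta>"
        using C'(2)[OF s(1) s(1), of k n] \<epsilon>(2) by linarith
      then show ?thesis
        using N_le_iff[of "N (s k - s n)"] e p_gt_1 powr_mono2[of p e "N (s k - s n)"]
        unfolding \<eta>_def energy_eq by (cases "N (s k - s n) < e") auto
    qed
    then show ?thesis by blast
  qed
  obtain u where u: "u \<in> X" "(\<lambda>n. N (s n - u)) \<longlonglongrightarrow> 0"
    using X_complete[OF s(1) cauchy] by blast
  have "(\<lambda>n. N (s n) - N u) \<longlonglongrightarrow> 0"
  proof (rule Lim_null_comparison[OF _ u(2)], intro always_eventually allI)
    fix n show "norm (N (s n) - N u) \<le> N (s n - u)"
      using norm_le_add_diff[OF s(1) u(1), of n] norm_le_add_diff[OF u(1) s(1), of n]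
        norm_minus_commute[OF u(1) s(1), of n] by simp
  qed
  then have "(\<lambda>n. N (s n)) \<longlonglongrightarrow> N u"
    by (rule LIM_zero_cancel)
  then have "(\<lambda>n. energy (s n)) \<longlonglongrightarrow> energy u"
    unfolding energy_eq using p_gt_1 N_nonneg by (intro tendsto_powr') auto
  moreover have "(\<lambda>n. f (s n)) \<longlonglongrightarrow> f u"
  proof (rule LIM_zero_cancel, rule Lim_null_comparison)
    show "(\<lambda>n. C * N (s n - u)) \<longlonglongrightarrow> 0"
      using tendsto_mult_right_zero[OF u(2)] .
    show "\<forall>\<^sub>F n in sequentially. norm (f (s n) - f u) \<le> C * N (s n - u)"
      using C(2)[OF diff_in[OF s(1) u(1)]] dual_diff[OF f s(1) u(1)] by simp
  qed
  ultimately have "(\<lambda>n. J (s n)) \<longlonglongrightarrow> J u"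
    unfolding J_def using p_gt_1 by (intro tendsto_intros) auto
  moreover have "(\<lambda>n. m + 1 / (real n + 1)) \<longlonglongrightarrow> m + 0"
    using LIMSEQ_inverse_real_of_nat by (intro tendsto_add tendsto_const) (simp add: inverse_eq_divide add.commute)
  ultimately have "J u \<le> m + 0"
    using s(2) by (intro LIMSEQ_le) (auto intro: less_imp_le)
  then show thesis
    using that[OF u(1)] m_le unfolding J_def by force
qed

text \<open>Minimality and the tangent inequality bound \<open>f v\<close> by the form at
  \<open>u + t v\<close>; continuity of \<open>L\<close> removes \<open>t\<close>, and exchanging
  \<open>v\<close> with its negative gives equality.\<close>

lemma L_surj:
  assumes f: "f \<in> dual_space X N"
  obtains u where "u \<in> X" "L u = f"
proof -
  obtain u where u: "u \<in> X" and min: "\<And>v. v \<in> X \<Longrightarrow> energy u / p - f u \<le> energy v / p - f v"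
    using minimizer_exists[OF f] by blast
  have pert: "f v \<le> form (\<lambda>x. u x + t * v x) v" if v: "v \<in> X" and t: "t > 0" for v t
  proof -
    let ?w = "\<lambda>x. u x + t * v x"
    have w: "?w \<in> X" using X_lincomb[OF u v, of 1 t] by simp
    have fw: "f ?w = f u + t * f v" using dual_lincomb[OF f u v, of 1 t] by simp
    have "t * f v \<le> (energy ?w - energy u) / p"
      using min[OF w] unfolding fw diff_divide_distrib by linarith
    then have "p * (t * f v) \<le> energy ?w - energy u"
      using p_gt_1 by (simp add: pos_le_divide_eq mult.commute)
    also have "\<dots> \<le> p * (t * form ?w v)"
      using energy_tangent[OF u v, of t] by (simp add: mult.assoc)
    finally show ?thesis using p_gt_1 t by simp
  qed
  have le: "f v \<le> form u v" if v: "v \<in> X" for v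
  proof (rule field_le_epsilon)
    fix e :: real assume e: "e > 0"
    have pos: "e / (N v + 1) > 0" using e N_nonneg[of v] by (simp add: add_nonneg_pos)
    obtain d where d: "d > 0" "\<And>w. w \<in> X \<Longrightarrow> N (w - u) < d \<Longrightarrow> dual_norm X N (L w - L u) < e / (N v + 1)"
      using L_continuous_at[OF u pos] by blast
    \<comment> \<open>Keeps \<open>t * N v\<close> below \<open>d\<close>; the added 1 covers the
      case \<open>N v = 0\<close>.\<close>
    define t where "t = d / (N v + 1)"
    have t: "t > 0" "t * N v < d"
      using d(1) N_nonneg[of v] by (auto simp: t_def field_simps add_nonneg_pos)
    let ?w = "\<lambda>x. u x + t * v x"
    have w: "?w \<in> X" using X_lincomb[OF u v, of 1 t] by simp
    have "?w - u = (\<lambda>x. t * v x)" by (simp add: fun_eq_iff)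
    then have "N (?w - u) < d" using t N_scale[OF v, of t] by simp
    then have dn: "dual_norm X N (L ?w - L u) < e / (N v + 1)" by (rule d(2)[OF w])
    have "form ?w v - form u v \<le> dual_norm X N (L ?w - L u) * N v"
      using dual_bound[OF dual.diff_in[OF L_dual[OF w] L_dual[OF u]] v] L_diff_apply[OF v, of ?w u] by simp
    also have "\<dots> \<le> e / (N v + 1) * N v"
      using dn N_nonneg by (intro mult_right_mono) auto
    also have "\<dots> \<le> e"
      using e N_nonneg[of v] by (simp add: field_simps add_nonneg_pos)
    finally show "f v \<le> form u v + e"
      using pert[OF v t(1)] by linarith
  qed
  have "f v = form u v" if v: "v \<in> X" for v
  proof (rule antisym[OF le[OF v]])
    have "f (\<lambda>x. (-1) * v x) \<le> form u (\<lambda>x. (-1) * v x)"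
      by (rule le[OF scale_in[OF v]])
    then show "form u v \<le> f v"
      using dual_scale[OF f v, of "-1"] form_right_lincomb[OF u v v, of "-1" 0] by simp
  qed
  then have "L u v = f v" for v
    using dual_outside[OF f, of v] by (cases "v \<in> X") (simp_all add: L_op_eq, simp add: L_op_def)
  then have "L u = f" by (rule ext)
  then show thesis using that u by blast
qed

lemma L_inj: "inj_on L X"
proof (rule inj_onI, rule ccontr)
  fix u v assume "u \<in> X" "v \<in> X" "L u = L v" "u \<noteq> v"
  then have "(L v - L v) (u - v) > 0"
    using strictly_monotone_L unfolding strictly_monotone_def by metis
  then show False by simp
qed

section \<open>Continuity of the inverse\<close>

text \<open>Testing \<open>L v\<close> with \<open>v\<close> itself bounds the norm of
  \<open>v\<close> by that of \<open>L v\<close>, so preimages of bounded sets are bounded; there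
  the error term is under control and \<open>energy_diff_le\<close> bounds the distance of
  preimages.\<close>

lemma L_inverse_continuous_at:
  assumes u: "u \<in> X" and e: "e > 0"
  obtains d where "d > 0" "\<And>v. v \<in> X \<Longrightarrow> dual_norm X N (L v - L u) < d \<Longrightarrow> N (v - u) < e"
proof -
  \<comment> \<open>The added 1 makes the dual ball of radius \<open>K\<close> contain every
    \<open>L v\<close> at distance less than 1 from \<open>L u\<close>.\<close>
  define K where "K = dual_norm X N (L u) + 1"
  have K: "K > 0" using dual_norm_nonneg[OF L_dual[OF u]] by (simp add: K_def)
  define R where "R = K powr (1 / (p - 1))"
  define E where "E = R powr p"
  define \<eta> where "\<eta> = e powr p"
  have R: "R \<ge> 0" "E \<ge> 0" "\<eta> > 0" using e by (auto simp: R_def E_def \<eta>_def)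
  have small: "N v \<le> R" "energy v \<le> E" if v: "v \<in> X" and n: "dual_norm X N (L v) \<le> K" for v
  proof -
    have "energy v = L v v" using v by (simp add: L_op_eq form_self)
    also have "\<dots> \<le> dual_norm X N (L v) * N v"
      using dual_bound[OF L_dual[OF v] v] by simp
    also have "\<dots> \<le> K * N v" using n N_nonneg by (rule mult_right_mono)
    finally show "N v \<le> R" unfolding R_def using K by (rule N_powr_le)
    then show "energy v \<le> E" unfolding E_def using N_le_iff[OF R(1)] by simp
  qed
  define \<epsilon> where "\<epsilon> = \<eta> / (4 * (E + 1))"
  have \<epsilon>: "\<epsilon> > 0" "\<epsilon> * (2 * E) \<le> \<eta> / 2"
    using R by (auto simp: \<epsilon>_def field_simps)
  obtain C where C: "C \<ge> 0" "\<And>u v. u \<in> X \<Longrightarrow> v \<in> X \<Longrightarrow>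
    energy (u - v) \<le> \<epsilon> * (energy u + energy v) + C * (form u (u - v) - form v (u - v))"
    using energy_diff_le[OF \<epsilon>(1)] by blast
  \<comment> \<open>Both functions have norm at most \<open>R\<close>, so \<open>N (v - u)\<close>
    is at most \<open>2 * R\<close> and the form difference, multiplied by \<open>C\<close>, is at
    most \<open>B * d\<close>.\<close>
  define B where "B = C * (2 * R)"
  have B: "B \<ge> 0" using C(1) R by (simp add: B_def)
  define d where "d = min 1 (\<eta> / (2 * (B + 1)))"
  have d: "d > 0" "d \<le> 1" using R B by (auto simp: d_def)
  have "B * d \<le> B * (\<eta> / (2 * (B + 1)))"
    using B by (intro mult_left_mono) (auto simp: d_def)
  also have "\<dots> < \<eta> / 2" using R B by (simp add: field_simps)
  finally have Bd: "B * d < \<eta> / 2" .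
  have "N (v - u) < e" if v: "v \<in> X" and vd: "dual_norm X N (L v - L u) < d" for v
  proof -
    have "dual_norm X N (L v) \<le> K"
      using dual.norm_le_add_diff[OF L_dual[OF v] L_dual[OF u]] vd d by (simp add: K_def)
    note sv = small[OF v this]
    have su: "N u \<le> R" "energy u \<le> E" using small[OF u] by (auto simp: K_def)
    have "N (v - u) \<le> 2 * R"
      using norm_triangle_sub[OF v X_zero u] sv(1) su(1) norm_minus_commute[OF X_zero u]
      by (simp add: fun_diff_def)
    then have "dual_norm X N (L v - L u) * N (v - u) \<le> d * (2 * R)"
      using vd d R N_nonneg by (intro mult_mono) auto
    moreover have "form v (v - u) - form u (v - u) \<le> dual_norm X N (L v - L u) * N (v - u)"
      using dual_bound[OF dual.diff_in[OF L_dual[OF v] L_dual[OF u]] diff_in[OF v u]]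
        L_diff_apply[OF diff_in[OF v u], of v u] by simp
    ultimately have "C * (form v (v - u) - form u (v - u)) \<le> C * (d * (2 * R))"
      using C(1) by (intro mult_left_mono) auto
    also have "\<dots> = B * d" by (simp add: B_def)
    finally have 1: "C * (form v (v - u) - form u (v - u)) \<le> B * d" .
    have 2: "\<epsilon> * (energy v + energy u) \<le> \<epsilon> * (2 * E)"
      using \<epsilon>(1) sv(2) su(2) by (intro mult_left_mono) auto
    have "energy (v - u) < \<eta>"
      using C(2)[OF v u] 1 2 Bd \<epsilon>(2) by linarith
    then show ?thesis
      using e p_gt_1 powr_mono2[of p e "N (v - u)"]
      unfolding \<eta>_def energy_eq by (cases "N (v - u) < e") auto
  qed
  then show thesis using that d(1) by blast
qed

lemma homeomorphic_map_L: "homeomorphic_map (norm_topology X N) (dual_topology X N) L"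
proof -
  define G where "G = inv_into X L"
  have image: "f \<in> L ` X" if "f \<in> dual_space X N" for f
    using L_surj[OF that] by blast
  have GX: "G f \<in> X" "L (G f) = f" if "f \<in> dual_space X N" for f
    unfolding G_def using inv_into_into[OF image[OF that]] f_inv_into_f[OF image[OF that]] by simp_all
  have "continuous_map (dual_topology X N) (norm_topology X N) G"
    unfolding dual_topology_def
  proof (rule continuous_map_norm_topology)
    show "normed_function_space X N" by unfold_locales
    show "normed_function_space (dual_space X N) (dual_norm X N)" by (rule normed_dual_space)
    show "G f \<in> X" if "f \<in> dual_space X N" for f by (rule GX[OF that])
    fix f :: "(real \<Rightarrow> real) \<Rightarrow> real" and e :: real
    assume f: "f \<in> dual_space X N" and e: "e > 0"
    obtain d where d: "d > 0" "\<And>v. v \<in> X \<Longrightarrow> dual_norm X N (L v - L (G f)) < d \<Longrightarrow> N (v - G f) < e"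
      using L_inverse_continuous_at[OF GX(1)[OF f] e] by blast
    \<comment> \<open>Every \<open>h\<close> in the dual is \<open>L (G h)\<close>, so the preceding
      estimate is read at \<open>v = G h\<close>.\<close>
    show "\<exists>d>0. \<forall>h\<in>dual_space X N. dual_norm X N (h - f) < d \<longrightarrow> N (G h - G f) < e"
      using d GX f by (intro exI[of _ d]) auto
  qed
  then have "homeomorphic_maps (norm_topology X N) (dual_topology X N) L G"
    unfolding homeomorphic_maps_def
    using continuous_map_L GX(2) L_inj
    by (auto simp: topspace_norm_topology dual.topspace_norm_topology dual_topology_def G_def)
  then show ?thesis by (rule homeomorphic_maps_imp_map)
qed

end

theorem proposition2p2:
  fixes T p :: real and q :: "real \<Rightarrow> real"
  assumes "T > 0" and "p > 1"
    and "continuous_on {0..T} q"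
    and "\<forall>x\<in>{0..T}. q x \<ge> 0"
    and "\<exists>x\<in>{0..T}. q x \<noteq> 0"
  defines "X \<equiv> W1p_periodic T p"
    and "N \<equiv> W1p_norm T p q"
    and "L \<equiv> L_op T p q"
  shows "(continuous_map (norm_topology X N) (dual_topology X N) L \<and> strictly_monotone X L) \<and>
         type_S_plus X N L \<and>
         homeomorphic_map (norm_topology X N) (dual_topology X N) L"
proof -
  interpret periodic_sobolev T p q
    by (rule periodic_sobolev.intro) (use assms(1-5) in blast)+
  show ?thesis
    unfolding X_def N_def L_def
    using continuous_map_L strictly_monotone_L type_S_plus_L homeomorphic_map_L by blast
qed

end
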